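(* Let $\Gamma \subset \mathbb{R}^d$ be a closed, solid and acute convex cone, let $\mu$ be a nonzero positive measure of finite mass supported by the polar cone $\Gamma^\ast$, and let $\Omega = (0,\infty)\times \operatorname{int}\Gamma \subset \mathbb{R}^{d+1}$ with tube domain $T_\Omega = \mathbb{R}^{d+1} + i\Omega$. Then the Fantappiè transform of $\mu$ admits the exponential representation $$ \int_{\Gamma^\ast} \frac{d\mu(x)}{z_0 + z\cdot x} = -\exp[\, i F(z_0,z)\,], \qquad (z_0,z)\in T_\Omega, $$ where $F(z_0,z) = -i \ln\Big[-\int_{\Gamma^\ast} \frac{d\mu(x)}{z_0 + z\cdot x}\Big]$ is analytic in $T_\Omega$ (the branch of the logarithm on the upper half-plane having imaginary part in $(0,\pi)$). Moreover, for any fixed $\alpha\in i\Omega$, there exist a measurable function $\phi:\mathbb{R}^{d+1}\to[0,\pi]$ and a real constant $C\in\mathbb{R}$ such that $$ F(\zeta) = iC + \int_{\mathbb{R}^{d+1}} H(\zeta,\sigma;\alpha)\,\phi(\sigma)\,d\sigma $$ for all $\zeta=(z_0,z)\in T_\Omega$ with $S(\zeta,\alpha)\neq 0$, where $S$ is the Szegő kernel and $H$ is the Herglotz kernel of $T_\Omega$.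
   Context: A convex cone is solid if it has nonempty interior, and acute if its closure contains no full line. The polar cone of a cone $\Gamma\subset\mathbb{R}^d$ is $\Gamma^\ast=\{x\in\mathbb{R}^d:\ \omega\cdot x\ge 0 \text{ for all } \omega\in\Gamma\}$; likewise $\Omega^\ast=\{x\in\mathbb{R}^{d+1}:\ \omega\cdot x\ge 0 \text{ for all }\omega\in\Omega\}$. The dot denotes the bilinear product $u\cdot v=\sum_k u_kv_k$, also for complex vectors. Points of $T_\Omega\subset\mathbb{C}^{d+1}=\mathbb{C}\times\mathbb{C}^d$ are written $(z_0,z)$. The Szegő kernel of $T_\Omega$ is $$S(z,w)=\frac{1}{(2\pi)^{d+1}}\int_{\Omega^\ast} e^{i(z-\overline{w})\cdot x}\,dx ,$$ for $z,w\in T_\Omega$, and by the same formula when one of the two arguments lies in $T_\Omega$ and the other in $\mathbb{R}^{d+1}$. For $\alpha\in i\Omega$ (that is, $\alpha=i\omega$ with $\omega\in\Omega$, viewed as a point of $T_\Omega$) the Herglotz kernel is $$H(z,w;\alpha)=2\,\frac{S(z,w)S(w,\alpha)}{S(z,\alpha)}-\frac{|S(w,\alpha)|^2}{S(\alpha,\alpha)},$$ defined whenever $S(z,\alpha)\ne0$, for $z\in T_\Omega$ and $w\in T_\Omega$ or $w \in\mathbb{R}^{d+1}$. *)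

theory Defs
  imports "HOL-Analysis.Analysis"
begin

definition solid_cone :: "'a::real_normed_vector set \<Rightarrow> bool" where
  "solid_cone G \<longleftrightarrow> convex_cone G \<and> interior G \<noteq> {}"

definition acute_cone :: "'a::real_normed_vector set \<Rightarrow> bool" where
  "acute_cone G \<longleftrightarrow>
     convex_cone G \<and> \<not> (\<exists>a v. v \<noteq> 0 \<and> range (\<lambda>t::real. a + t *\<^sub>R v) \<subseteq> closure G)"

definition polar_cone :: "'a::real_inner set \<Rightarrow> 'a set" where
  "polar_cone G = {x. \<forall>\<omega>\<in>G. \<omega> \<bullet> x \<ge> 0}"

text \<open>
  Real and complex \<open>(d+1)\<close>-space are \<open>real \<times> (real^'d)\<close> and \<open>complex \<times> (complex^'d)\<close>
  with \<open>d = CARD('d)\<close>. The inner product of the library on \<open>complex^'d\<close> is real-valued, so the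
  bilinear products are written out here.
\<close>

definition vdot :: "complex^'d \<Rightarrow> complex^'d \<Rightarrow> complex" where
  "vdot u v = (\<Sum>k\<in>UNIV. u $ k * v $ k)"

definition pdot :: "complex \<times> (complex^'d) \<Rightarrow> complex \<times> (complex^'d) \<Rightarrow> complex" where
  "pdot u v = fst u * fst v + vdot (snd u) (snd v)"

definition complex_vec :: "real^'d \<Rightarrow> complex^'d" where
  "complex_vec x = (\<chi> k. complex_of_real (x $ k))"

text \<open>The point \<open>x + iy\<close>. In particular, \<open>x\<close> and \<open>iy\<close>, regarded as complex points, are
  \<open>complex_point x 0\<close> and \<open>complex_point 0 y\<close>.\<close>

definition complex_point ::
    "real \<times> (real^'d) \<Rightarrow> real \<times> (real^'d) \<Rightarrow> complex \<times> (complex^'d)" where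
  "complex_point x y = (Complex (fst x) (fst y), \<chi> k. Complex (snd x $ k) (snd y $ k))"

definition cnj_point :: "complex \<times> (complex^'d) \<Rightarrow> complex \<times> (complex^'d)" where
  "cnj_point w = (cnj (fst w), \<chi> k. cnj (snd w $ k))"

definition tube :: "(real \<times> (real^'d)) set \<Rightarrow> (complex \<times> (complex^'d)) set" where
  "tube \<Omega> = {complex_point x y | x y. y \<in> \<Omega>}"

text \<open>Analyticity in several variables: complex Frechet differentiability near every point,
  as in the definition of \<open>analytic_on\<close> for one variable.\<close>

definition complex_differentiable_at ::
    "(complex \<times> (complex^'d) \<Rightarrow> complex) \<Rightarrow> complex \<times> (complex^'d) \<Rightarrow> bool" where
  "complex_differentiable_at f z \<longleftrightarrow>
     (\<exists>D. (f has_derivative D) (at z) \<and> (\<forall>c v. D (c * fst v, c *s snd v) = c * D v))"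

definition multi_analytic_on ::
    "(complex \<times> (complex^'d) \<Rightarrow> complex) \<Rightarrow> (complex \<times> (complex^'d)) set \<Rightarrow> bool" where
  "multi_analytic_on f S \<longleftrightarrow> (\<forall>z\<in>S. \<exists>e>0. \<forall>w\<in>ball z e. complex_differentiable_at f w)"

text \<open>The Szego kernel, for arguments in \<open>tube \<Omega>\<close> or, one of them, real.\<close>

definition szego ::
    "(real \<times> (real^'d)) set \<Rightarrow> complex \<times> (complex^'d) \<Rightarrow> complex \<times> (complex^'d) \<Rightarrow> complex" where
  "szego \<Omega> z w =
     1 / complex_of_real ((2 * pi) ^ (CARD('d) + 1)) *
     (LINT x:polar_cone \<Omega>|lborel. exp (\<i> * pdot (z - cnj_point w) (complex_point x 0)))"

definition herglotz ::
    "(real \<times> (real^'d)) set \<Rightarrow> complex \<times> (complex^'d) \<Rightarrow> complex \<times> (complex^'d)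
      \<Rightarrow> complex \<times> (complex^'d) \<Rightarrow> complex" where
  "herglotz \<Omega> z w \<alpha> =
     2 * (szego \<Omega> z w * szego \<Omega> w \<alpha> / szego \<Omega> z \<alpha>)
     - complex_of_real ((cmod (szego \<Omega> w \<alpha>))\<^sup>2) / szego \<Omega> \<alpha> \<alpha>"

definition fantappie ::
    "(real^'d) set \<Rightarrow> (real^'d) measure \<Rightarrow> complex \<times> (complex^'d) \<Rightarrow> complex" where
  "fantappie K \<mu> Z = (LINT x:K|\<mu>. 1 / (fst Z + vdot (snd Z) (complex_vec x)))"

text \<open>On the upper half-plane, \<open>Ln\<close> is the branch with imaginary part in \<open>(0,\<pi>)\<close>.\<close>

definition fantappie_exponent ::
    "(real^'d) set \<Rightarrow> (real^'d) measure \<Rightarrow> complex \<times> (complex^'d) \<Rightarrow> complex" where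
  "fantappie_exponent K \<mu> Z = - \<i> * Ln (- fantappie K \<mu> Z)"

end

theory Submission
  imports Defs "HOL-Probability.Characteristic_Functions" "HOL-Probability.Sinc_Integral"
    "HOL-Complex_Analysis.Cauchy_Integral_Theorem"
begin

text \<open>
  The transform of a positive measure on the polar cone, with its sign reversed, maps the tube into
  the upper half-plane, because \<open>z\<^sub>0 + z \<cdot> x\<close> has positive imaginary part for \<open>x\<close> in the polar
  cone. Hence the exponent \<open>F = - i Ln\<close> of that function is analytic and its real part, an argument,
  lies in \<open>(0, \<pi>)\<close>. What remains is to recover a function with bounded real part from boundary data
  of its real part.

  For a bounded analytic \<open>G\<close> the Szego kernel reproduces the product of a kernel with \<open>G\<close>
  (\<open>reproducing_bounded\<close>):
  \<open>\<integral> S(\<zeta>,\<sigma>) S(\<sigma>,\<alpha>) G(\<sigma>) d\<sigma> = S(\<zeta>,\<alpha>) G(\<zeta>)\<close>. Conjugating the identity with the roles of \<open>\<zeta>\<close>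
  and \<open>\<alpha>\<close> exchanged evaluates the same integral with the conjugate of \<open>G\<close> in place of \<open>G\<close>, as
  \<open>S(\<zeta>,\<alpha>)\<close> times the conjugate of \<open>G(\<alpha>)\<close>. Half the sum of the two concerns \<open>Re G\<close>, and
  the Herglotz kernel is the combination that gives \<open>\<integral> H(\<zeta>,\<sigma>;\<alpha>) Re G(\<sigma>) d\<sigma> = G(\<zeta>) - i Im G(\<alpha>)\<close>
  (\<open>herglotz_bounded\<close>).

  The function \<open>F\<close> may be unbounded and need not extend to the boundary of the tube. It is approximated
  by bounded functions \<open>G\<^sub>n\<close> that are analytic beyond the real points and have real part in \<open>[0, \<pi>]\<close>:
  translate by \<open>i \<omega> / n\<close> and add \<open>i / n\<close> before the logarithm is taken. The boundary functions
  \<open>Re G\<^sub>n\<close> have a weak-star cluster point \<open>\<phi>\<close> (\<open>weak_star_cluster_point\<close>). As the Herglotz kernel is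
  integrable in \<open>\<sigma>\<close> and \<open>G\<^sub>n\<close> tends to \<open>F\<close> in the tube, the representation passes to the limit,
  with \<open>C = Im F(\<alpha>)\<close>.

  The reproducing property itself is a Paley-Wiener argument. For an integrable analytic function, a
  contour shift (\<open>contour_shift\<close>) compares the Fourier transforms of its horizontal slices; letting
  the shift tend to infinity shows that they vanish outside the polar cone, and Fourier inversion
  then identifies the integral against the Szego kernel. A bounded \<open>G\<close> is brought into that class
  by the factor \<open>S(\<sigma>,\<alpha>)\<close> and a second kernel at small scale, both of which are square
  integrable by a Bessel inequality (\<open>ft_bessel\<close>).

  Up to the last section, \<open>x + iy\<close> is written as the pair \<open>(x, y)\<close> of points of a Euclidean space.
  The results on the kernels hold over any open convex cone.
\<close>

section \<open>Lebesgue integrals on Euclidean space\<close>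

lemma lborel_basis_product:
  fixes f :: "'a::euclidean_space \<Rightarrow> real \<Rightarrow> 'b::{real_normed_field,banach,second_countable_topology}"
  assumes "\<And>b. b \<in> Basis \<Longrightarrow> integrable lborel (f b)"
  shows "integrable (lborel :: 'a measure) (\<lambda>x. \<Prod>b\<in>Basis. f b (x \<bullet> b))"
    and "integral\<^sup>L lborel (\<lambda>x::'a. \<Prod>b\<in>Basis. f b (x \<bullet> b)) = (\<Prod>b\<in>Basis. integral\<^sup>L lborel (f b))"
proof -
  interpret product_sigma_finite "\<lambda>_::'a. lborel :: real measure" ..
  let ?T = "\<lambda>g. \<Sum>b\<in>(Basis :: 'a set). g b *\<^sub>R b"
  have T: "?T \<in> measurable (\<Pi>\<^sub>M b\<in>Basis. lborel) borel" by measurable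
  have m: "(\<lambda>x::'a. \<Prod>b\<in>Basis. f b (x \<bullet> b)) \<in> borel_measurable borel"
  proof (rule borel_measurable_prod)
    fix b :: 'a assume "b \<in> Basis"
    from borel_measurable_integrable[OF assms[OF this]]
    have [measurable]: "f b \<in> borel_measurable borel" by simp
    show "(\<lambda>x. f b (x \<bullet> b)) \<in> borel_measurable borel" by measurable
  qed
  have eq: "(\<Prod>b\<in>Basis. f b (?T g \<bullet> b)) = (\<Prod>b\<in>Basis. f b (g b))" for g
    by (intro prod.cong) auto
  show "integrable (lborel :: 'a measure) (\<lambda>x. \<Prod>b\<in>Basis. f b (x \<bullet> b))"
    unfolding lborel_eq[where 'a='a] integrable_distr_eq[OF T m] eq
    by (rule product_integrable_prod[OF _ assms]) auto
  show "integral\<^sup>L lborel (\<lambda>x::'a. \<Prod>b\<in>Basis. f b (x \<bullet> b)) = (\<Prod>b\<in>Basis. integral\<^sup>L lborel (f b))"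
    unfolding lborel_eq[where 'a='a] integral_distr[OF T m] eq
    by (rule product_integral_prod[OF _ assms]) auto
qed

lemma integrable_scaleR_iff:
  fixes f :: "'a \<Rightarrow> 'b::{banach,second_countable_topology}"
  assumes "c \<noteq> 0"
  shows "integrable M (\<lambda>x. c *\<^sub>R f x) \<longleftrightarrow> integrable M f"
  using assms integrable_scaleR_right[where c=c and f=f and M=M]
    integrable_scaleR_right[where c="inverse c" and f="\<lambda>x. c *\<^sub>R f x" and M=M] by auto

lemma lborel_integral_affine:
  fixes f :: "'a::euclidean_space \<Rightarrow> 'b::{banach,second_countable_topology}"
  assumes [measurable]: "f \<in> borel_measurable borel" and c: "c \<noteq> 0"
  shows "(LINT x|lborel. f x) = \<bar>c\<bar>^DIM('a) *\<^sub>R (LINT x|lborel. f (t + c *\<^sub>R x))"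
    and "integrable lborel f \<longleftrightarrow> integrable lborel (\<lambda>x. f (t + c *\<^sub>R x))"
proof -
  have p: "\<bar>c\<bar>^DIM('a) > 0" using c by simp
  have D: "lborel = density (distr lborel borel (\<lambda>x. t + c *\<^sub>R x)) (\<lambda>_. ennreal (\<bar>c\<bar>^DIM('a)))"
    using lborel_affine[OF c, of t] by simp
  have "(LINT x|lborel. f x) =
      (LINT x|density (distr lborel borel (\<lambda>x. t + c *\<^sub>R x)) (\<lambda>_. ennreal (\<bar>c\<bar>^DIM('a))). f x)"
    using D by simp
  also have "\<dots> = \<bar>c\<bar>^DIM('a) *\<^sub>R (LINT x|lborel. f (t + c *\<^sub>R x))"
    by (subst integral_density) (auto simp: integral_distr)
  finally show "(LINT x|lborel. f x) = \<bar>c\<bar>^DIM('a) *\<^sub>R (LINT x|lborel. f (t + c *\<^sub>R x))" .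
  have "integrable lborel f \<longleftrightarrow>
      integrable (density (distr lborel borel (\<lambda>x. t + c *\<^sub>R x)) (\<lambda>_. ennreal (\<bar>c\<bar>^DIM('a)))) f"
    using D by simp
  also have "\<dots> \<longleftrightarrow> integrable lborel (\<lambda>x. f (t + c *\<^sub>R x))"
    using c by (subst integrable_density) (auto simp: integrable_distr_eq integrable_scaleR_iff)
  finally show "integrable lborel f \<longleftrightarrow> integrable lborel (\<lambda>x. f (t + c *\<^sub>R x))" .
qed

lemma lborel_integral_shift:
  fixes f :: "'a::euclidean_space \<Rightarrow> 'b::{banach,second_countable_topology}"
  assumes "f \<in> borel_measurable borel"
  shows "(LINT x|lborel. f (x + t)) = (LINT x|lborel. f x)"
    and "integrable lborel (\<lambda>x. f (x + t)) \<longleftrightarrow> integrable lborel f"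
  using lborel_integral_affine[OF assms, of 1 t] by (simp_all add: add.commute)

lemma lborel_integral_reflect:
  fixes f :: "'a::euclidean_space \<Rightarrow> 'b::{banach,second_countable_topology}"
  assumes "f \<in> borel_measurable borel"
  shows "(LINT x|lborel. f (t - x)) = (LINT x|lborel. f x)"
    and "integrable lborel (\<lambda>x. f (t - x)) \<longleftrightarrow> integrable lborel f"
  using lborel_integral_affine[OF assms, of "-1" t] by simp_all

lemma lborel_nn_integral_shift:
  fixes f :: "'a::euclidean_space \<Rightarrow> ennreal"
  assumes [measurable]: "f \<in> borel_measurable borel"
  shows "(\<integral>\<^sup>+x. f (x + t) \<partial>lborel) = (\<integral>\<^sup>+x. f x \<partial>lborel)"
proof -
  have "(\<integral>\<^sup>+x. f x \<partial>lborel) = (\<integral>\<^sup>+x. f x \<partial>distr lborel borel ((+) t))"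
    by (simp add: lborel_distr_plus)
  also have "\<dots> = (\<integral>\<^sup>+x. f (x + t) \<partial>lborel)"
    by (subst nn_integral_distr) (auto simp: add.commute)
  finally show ?thesis by simp
qed

lemma integrable_lborel_pairI:
  fixes f :: "'a::euclidean_space \<Rightarrow> complex" and g :: "'b::euclidean_space \<Rightarrow> complex"
  assumes f: "integrable lborel f" and g: "integrable lborel g"
  shows "integrable (lborel \<Otimes>\<^sub>M lborel) (\<lambda>(x,y). f x * g y)"
  by (rule lborel_pair.Fubini_integrable)
    (use f g in \<open>auto simp: norm_mult intro!: integrable_mult_left\<close>)

section \<open>Gaussian regularisation of Fourier integrals\<close>

definition gaussian :: "'a::euclidean_space \<Rightarrow> real" where
  "gaussian x = (\<Prod>b\<in>Basis. std_normal_density (x \<bullet> b))"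

lemma norm_power2_Basis: "(norm (x::'a::euclidean_space))\<^sup>2 = (\<Sum>b\<in>Basis. (x \<bullet> b)\<^sup>2)"
  unfolding power2_norm_eq_inner by (subst euclidean_inner) (simp add: power2_eq_square)

lemma gaussian_eq: "gaussian (x::'a::euclidean_space) = exp (- (norm x)\<^sup>2 / 2) / sqrt (2 * pi) ^ DIM('a)"
proof -
  have "(\<Sum>b\<in>Basis. - (x \<bullet> b)\<^sup>2 / 2) = - (norm x)\<^sup>2 / 2"
    by (simp add: norm_power2_Basis sum_negf flip: sum_divide_distrib)
  moreover have "gaussian x = (\<Prod>b\<in>Basis. exp (- (x \<bullet> b)\<^sup>2 / 2)) / sqrt (2 * pi) ^ DIM('a)"
    by (simp add: gaussian_def std_normal_density_def prod_dividef)
  ultimately show ?thesis by (simp add: exp_sum[symmetric])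
qed

lemma gaussian_pos: "0 < gaussian x"
  by (simp add: gaussian_eq)

lemma continuous_gaussian [continuous_intros]: "continuous_on S (gaussian :: 'a::euclidean_space \<Rightarrow> real)"
  unfolding gaussian_eq by (intro continuous_intros) auto

lemma measurable_gaussian [measurable]: "(gaussian :: 'a::euclidean_space \<Rightarrow> real) \<in> borel_measurable borel"
  by (intro borel_measurable_continuous_onI continuous_gaussian)

lemma integrable_gaussian: "integrable lborel (gaussian :: 'a::euclidean_space \<Rightarrow> real)"
  and integral_gaussian: "(LINT x|lborel. gaussian (x::'a::euclidean_space)) = 1"
  using lborel_basis_product[of "\<lambda>_::'a. std_normal_density"]
  by (auto simp: gaussian_def[abs_def] integral_normal_density integrable_normal_density)

definition ft :: "('a::euclidean_space \<Rightarrow> complex) \<Rightarrow> 'a \<Rightarrow> complex" where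
  "ft h x = (LINT u|lborel. cis (x \<bullet> u) * h u)"

lemma cis_measurable [measurable (raw)]:
  "f \<in> borel_measurable M \<Longrightarrow> (\<lambda>x. cis (f x)) \<in> borel_measurable M"
  by (rule measurable_compose[of f]) (auto intro!: borel_measurable_continuous_onI continuous_intros)

lemma integrable_cis_mult:
  fixes h :: "'a::euclidean_space \<Rightarrow> complex"
  assumes "integrable lborel h"
  shows "integrable lborel (\<lambda>u. cis (x \<bullet> u) * h u)"
proof (rule Bochner_Integration.integrable_bound[OF assms])
  have [measurable]: "h \<in> borel_measurable borel" using assms by auto
  show "(\<lambda>u. cis (x \<bullet> u) * h u) \<in> borel_measurable lborel" by measurable
qed (auto simp: norm_mult)

lemma norm_ft_le: "norm (ft h x) \<le> (LINT u|lborel. norm (h u))"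
  unfolding ft_def using integral_norm_bound[of lborel "\<lambda>u. cis (x \<bullet> u) * h u"]
  by (simp add: norm_mult)

lemma ft_gaussian:
  "ft (\<lambda>u. complex_of_real (gaussian u)) (x::'a::euclidean_space) = exp (- (norm x)\<^sup>2 / 2)"
proof -
  define f :: "'a \<Rightarrow> real \<Rightarrow> complex" where
    "f b s = cis (x \<bullet> b * s) * std_normal_density s" for b s
  have int: "integrable lborel (f b)" for b
    using integrable_cis_mult[of "\<lambda>s. complex_of_real (std_normal_density s)" "x \<bullet> b"]
    by (simp add: f_def[abs_def] integrable_normal_density)
  have val: "integral\<^sup>L lborel (f b) = exp (- (x \<bullet> b)\<^sup>2 / 2)" for b
  proof -
    have "integral\<^sup>L lborel (f b) = char std_normal_distribution (x \<bullet> b)"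
      unfolding char_def
      by (subst integral_density)
         (auto simp: f_def[abs_def] normal_density_nonneg cis_conv_exp scaleR_conv_of_real mult.commute)
    then show ?thesis by (simp add: char_std_normal_distribution)
  qed
  have "cis (x \<bullet> u) * gaussian u = (\<Prod>b\<in>Basis. f b (u \<bullet> b))" for u
  proof -
    have "cis (x \<bullet> u) = (\<Prod>b\<in>Basis. cis ((x \<bullet> b) * (u \<bullet> b)))"
      by (subst euclidean_inner) (simp add: cis_conv_exp exp_sum sum_distrib_left)
    then show ?thesis by (simp add: gaussian_def f_def prod.distrib)
  qed
  then have "ft (\<lambda>u. complex_of_real (gaussian u)) x = (\<Prod>b\<in>Basis. complex_of_real (exp (- (x \<bullet> b)\<^sup>2 / 2)))"
    unfolding ft_def using lborel_basis_product(2)[of f, OF int] by (simp add: val)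
  also have "\<dots> = exp (- (norm x)\<^sup>2 / 2)"
    by (simp add: norm_power2_Basis sum_negf flip: of_real_prod exp_sum sum_divide_distrib)
  finally show ?thesis .
qed

lemma ft_gaussian_scaled:
  fixes a :: "'a::euclidean_space"
  assumes e: "\<epsilon> > 0"
  shows "(LINT u|lborel. cis (a \<bullet> u) * exp (- (norm (\<epsilon> *\<^sub>R u))\<^sup>2 / 2)) =
    (2 * pi) ^ DIM('a) / \<epsilon> ^ DIM('a) * gaussian (a /\<^sub>R \<epsilon>)"
proof -
  let ?f = "\<lambda>v::'a. cis ((a /\<^sub>R \<epsilon>) \<bullet> v) * complex_of_real (gaussian v)"
  define c where "c = sqrt (2 * pi) ^ DIM('a)"
  have c: "c > 0" by (simp add: c_def)
  have g: "gaussian v = exp (- (norm v)\<^sup>2 / 2) / c" for v :: 'a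
    by (simp add: gaussian_eq c_def)
  have pt: "cis (a \<bullet> u) * exp (- (norm (\<epsilon> *\<^sub>R u))\<^sup>2 / 2) = c * ?f (0 + \<epsilon> *\<^sub>R u)" for u
    using e c by (simp add: g mult.assoc[symmetric] del: norm_scaleR)
  have "(LINT u|lborel. cis (a \<bullet> u) * exp (- (norm (\<epsilon> *\<^sub>R u))\<^sup>2 / 2)) =
     c * (LINT u|lborel. ?f (0 + \<epsilon> *\<^sub>R u))"
    by (simp only: pt integral_mult_right_zero)
  also have "ft (\<lambda>u. complex_of_real (gaussian u)) (a /\<^sub>R \<epsilon>) =
      \<epsilon> ^ DIM('a) * (LINT u|lborel. ?f (0 + \<epsilon> *\<^sub>R u))"
    unfolding ft_def by (subst lborel_integral_affine(1)[of ?f \<epsilon> 0])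
      (use e in \<open>simp_all add: scaleR_conv_of_real\<close>)
  then have "(LINT u|lborel. ?f (0 + \<epsilon> *\<^sub>R u)) = c * gaussian (a /\<^sub>R \<epsilon>) / \<epsilon> ^ DIM('a)"
    unfolding ft_gaussian using e c by (simp add: g field_simps)
  finally have "(LINT u|lborel. cis (a \<bullet> u) * exp (- (norm (\<epsilon> *\<^sub>R u))\<^sup>2 / 2)) =
      complex_of_real (c * c) / \<epsilon> ^ DIM('a) * gaussian (a /\<^sub>R \<epsilon>)"
    by simp
  moreover have "c * c = (2 * pi) ^ DIM('a)"
  proof -
    have "c * c = (sqrt (2 * pi) * sqrt (2 * pi)) ^ DIM('a)"
      by (simp only: c_def power_mult_distrib)
    also have "sqrt (2 * pi) * sqrt (2 * pi) = 2 * pi" by (rule real_sqrt_mult_self[THEN trans]) simp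
    finally show ?thesis .
  qed
  ultimately show ?thesis by simp
qed

lemma integrable_gaussian_scaled:
  assumes e: "\<epsilon> > 0"
  shows "integrable lborel (\<lambda>u::'a::euclidean_space. exp (- (norm (\<epsilon> *\<^sub>R u))\<^sup>2 / 2))"
proof -
  have "integrable lborel (\<lambda>u::'a. gaussian (0 + \<epsilon> *\<^sub>R u))"
    using lborel_integral_affine(2)[of "gaussian :: 'a \<Rightarrow> real" \<epsilon> 0] e integrable_gaussian[where 'a='a] by simp
  then have "integrable lborel (\<lambda>u::'a. sqrt (2 * pi) ^ DIM('a) * gaussian (0 + \<epsilon> *\<^sub>R u))"
    by (rule integrable_mult_right)
  then show ?thesis by (simp add: gaussian_eq)
qed

lemma measurable_ft [measurable]:
  fixes h :: "'a::euclidean_space \<Rightarrow> complex"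
  assumes [measurable]: "h \<in> borel_measurable borel"
  shows "ft h \<in> borel_measurable borel"
proof -
  have "(\<lambda>x. LINT u|lborel. cis (x \<bullet> u) * h u) \<in> borel_measurable (borel :: 'a measure)"
    by (rule lborel.borel_measurable_lebesgue_integral) measurable
  then show ?thesis by (simp add: ft_def[abs_def])
qed

text \<open>Fubini's theorem and the transform of the Gaussian turn the damped inversion integral into an
average of \<open>h\<close> around \<open>\<xi>\<close> at scale \<open>\<epsilon>\<close>. Both the inversion formula and the Bessel inequality are
the limit \<open>\<epsilon> \<rightarrow> 0\<close> of this identity.\<close>

lemma gaussian_inversion:
  fixes h :: "'a::euclidean_space \<Rightarrow> complex"
  assumes h: "integrable lborel h" and e: "\<epsilon> > 0"
  shows "(LINT u|lborel. ft h u * cis (- (\<xi> \<bullet> u)) * exp (- (norm (\<epsilon> *\<^sub>R u))\<^sup>2 / 2)) =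
    (2 * pi) ^ DIM('a) * (LINT t|lborel. gaussian t * h (\<xi> + \<epsilon> *\<^sub>R t))"
proof -
  have [measurable]: "h \<in> borel_measurable borel" using h by auto
  let ?w = "\<lambda>u::'a. exp (- (norm (\<epsilon> *\<^sub>R u))\<^sup>2 / 2)"
  let ?F = "\<lambda>u v. cis (v \<bullet> u) * h v * cis (- (\<xi> \<bullet> u)) * ?w u"
  have w: "integrable lborel (\<lambda>u. complex_of_real (?w u))"
    unfolding complex_of_real_integrable_eq by (rule integrable_gaussian_scaled[OF e])
  have I: "integrable (lborel \<Otimes>\<^sub>M lborel) (\<lambda>(u,v). ?F u v)"
    by (rule Bochner_Integration.integrable_bound[OF integrable_lborel_pairI[OF w h]])
       (auto simp: norm_mult)
  have "(LINT u|lborel. ft h u * cis (- (\<xi> \<bullet> u)) * ?w u) = (LINT u|lborel. LINT v|lborel. ?F u v)"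
    by (simp add: ft_def inner_commute)
  also have "\<dots> = (LINT v|lborel. LINT u|lborel. ?F u v)"
    using lborel_pair.Fubini_integral[OF I] by simp
  also have "\<dots> = (LINT v|lborel. h v * (LINT u|lborel. cis ((v - \<xi>) \<bullet> u) * ?w u))"
  proof (rule Bochner_Integration.integral_cong[OF refl])
    fix v
    have "cis ((v - \<xi>) \<bullet> u) = cis (v \<bullet> u) * cis (- (\<xi> \<bullet> u))" for u
      by (simp add: inner_diff_left cis_mult)
    then have *: "?F u v = h v * (cis ((v - \<xi>) \<bullet> u) * ?w u)" for u
      by simp
    then show "(LINT u|lborel. ?F u v) = h v * (LINT u|lborel. cis ((v - \<xi>) \<bullet> u) * ?w u)"
      by (simp only: * integral_mult_right_zero)
  qed
  also have "\<dots> = (LINT v|lborel. h v * ((2 * pi) ^ DIM('a) / \<epsilon> ^ DIM('a) * gaussian ((v - \<xi>) /\<^sub>R \<epsilon>)))"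
    by (simp only: ft_gaussian_scaled[OF e])
  also have "\<dots> = \<epsilon> ^ DIM('a) *
     (LINT t|lborel. h (\<xi> + \<epsilon> *\<^sub>R t) * ((2 * pi) ^ DIM('a) / \<epsilon> ^ DIM('a) * gaussian t))"
    by (subst lborel_integral_affine(1)[where c=\<epsilon> and t=\<xi>]) (use e in \<open>auto simp: scaleR_conv_of_real\<close>)
  also have "\<dots> = \<epsilon> ^ DIM('a) *
     (LINT t|lborel. ((2 * pi) ^ DIM('a) / \<epsilon> ^ DIM('a)) * (gaussian t * h (\<xi> + \<epsilon> *\<^sub>R t)))"
    by (simp add: mult_ac)
  also have "\<dots> = (2 * pi) ^ DIM('a) * (LINT t|lborel. gaussian t * h (\<xi> + \<epsilon> *\<^sub>R t))"
    using e by (subst integral_mult_right_zero) simp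
  finally show ?thesis .
qed

lemma fourier_inversion:
  fixes h :: "'a::euclidean_space \<Rightarrow> complex"
  assumes h: "integrable lborel h" and fh: "integrable lborel (ft h)"
    and cont: "continuous_on UNIV h" and B: "\<And>x. norm (h x) \<le> B"
  shows "(LINT u|lborel. ft h u * cis (- (\<xi> \<bullet> u))) = (2 * pi) ^ DIM('a) * h \<xi>"
proof (rule LIMSEQ_unique)
  have [measurable]: "h \<in> borel_measurable borel" using h by auto
  define \<epsilon> where "\<epsilon> n = inverse (real (Suc n))" for n
  have pos: "\<epsilon> n > 0" for n by (simp add: \<epsilon>_def)
  have lim: "\<epsilon> \<longlonglongrightarrow> 0" unfolding \<epsilon>_def by (rule LIMSEQ_inverse_real_of_nat)
  show "(\<lambda>n. LINT u|lborel. ft h u * cis (- (\<xi> \<bullet> u)) * exp (- (norm (\<epsilon> n *\<^sub>R u))\<^sup>2 / 2))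
      \<longlonglongrightarrow> (LINT u|lborel. ft h u * cis (- (\<xi> \<bullet> u)))"
  proof (rule integral_dominated_convergence[where w="\<lambda>u::'a. norm (ft h u)"])
    show "AE u in lborel. (\<lambda>n. ft h u * cis (- (\<xi> \<bullet> u)) * exp (- (norm (\<epsilon> n *\<^sub>R u))\<^sup>2 / 2))
        \<longlonglongrightarrow> ft h u * cis (- (\<xi> \<bullet> u))"
    proof (rule AE_I2)
      fix u :: 'a
      have "(\<lambda>n. ft h u * cis (- (\<xi> \<bullet> u)) * exp (- (norm (\<epsilon> n *\<^sub>R u))\<^sup>2 / 2))
        \<longlonglongrightarrow> ft h u * cis (- (\<xi> \<bullet> u)) * complex_of_real (exp (- (norm (0 *\<^sub>R u))\<^sup>2 / 2))"
        by (intro tendsto_intros lim) simp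
      then show "(\<lambda>n. ft h u * cis (- (\<xi> \<bullet> u)) * exp (- (norm (\<epsilon> n *\<^sub>R u))\<^sup>2 / 2))
        \<longlonglongrightarrow> ft h u * cis (- (\<xi> \<bullet> u))" by simp
    qed
    have "norm (ft h u * cis (- (\<xi> \<bullet> u)) * exp (- (norm (\<epsilon> n *\<^sub>R u))\<^sup>2 / 2)) \<le> norm (ft h u)" for n u
      by (simp add: norm_mult mult_left_le)
    then show "AE u in lborel. norm (ft h u * cis (- (\<xi> \<bullet> u)) * exp (- (norm (\<epsilon> n *\<^sub>R u))\<^sup>2 / 2))
        \<le> norm (ft h u)" for n by simp
    show "integrable lborel (\<lambda>u. norm (ft h u))" by (rule integrable_norm[OF fh])
    show "(\<lambda>u. ft h u * cis (- (\<xi> \<bullet> u))) \<in> borel_measurable lborel"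
      by measurable
    show "(\<lambda>u. ft h u * cis (- (\<xi> \<bullet> u)) * exp (- (norm (\<epsilon> n *\<^sub>R u))\<^sup>2 / 2)) \<in> borel_measurable lborel" for n
      by measurable
  qed
  have "(\<lambda>n. LINT t|lborel. gaussian t * h (\<xi> + \<epsilon> n *\<^sub>R t)) \<longlonglongrightarrow> (LINT t|lborel. gaussian (t::'a) * h \<xi>)"
  proof (rule integral_dominated_convergence[where w="\<lambda>t::'a. gaussian t * B"])
    have "(\<lambda>n. h (\<xi> + \<epsilon> n *\<^sub>R t)) \<longlonglongrightarrow> h (\<xi> + 0 *\<^sub>R t)" for t
      by (rule continuous_on_tendsto_compose[OF cont]) (intro tendsto_intros lim, simp_all)
    then have "(\<lambda>n. gaussian t * h (\<xi> + \<epsilon> n *\<^sub>R t)) \<longlonglongrightarrow> gaussian t * h \<xi>" for t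
      by (intro tendsto_mult tendsto_const) simp
    then show "AE t in lborel. (\<lambda>n. gaussian t * h (\<xi> + \<epsilon> n *\<^sub>R t)) \<longlonglongrightarrow> gaussian t * h \<xi>"
      by simp
    show "integrable lborel (\<lambda>t::'a. gaussian t * B)"
      using integrable_gaussian by (rule integrable_mult_left)
    have "norm (gaussian t * h (\<xi> + \<epsilon> n *\<^sub>R t)) \<le> gaussian t * B" for n t
      using B gaussian_pos[of t] by (simp add: norm_mult abs_of_pos)
    then show "AE t in lborel. norm (gaussian t * h (\<xi> + \<epsilon> n *\<^sub>R t)) \<le> gaussian t * B" for n
      by simp
  qed measurable
  also have "(LINT t|lborel. gaussian (t::'a) * h \<xi>) = h \<xi>"
    using integral_gaussian[where 'a='a] by simp
  finally have "(\<lambda>n. (2 * pi) ^ DIM('a) * (LINT t|lborel. gaussian t * h (\<xi> + \<epsilon> n *\<^sub>R t)))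
     \<longlonglongrightarrow> (2 * pi) ^ DIM('a) * h \<xi>" by (rule tendsto_mult_left)
  then show "(\<lambda>n. LINT u|lborel. ft h u * cis (- (\<xi> \<bullet> u)) * exp (- (norm (\<epsilon> n *\<^sub>R u))\<^sup>2 / 2))
      \<longlonglongrightarrow> (2 * pi) ^ DIM('a) * h \<xi>"
    by (simp only: gaussian_inversion[OF h pos])
qed

text \<open>Without integrability the Bochner integral is \<open>0\<close>, so the bound is unconditional.\<close>

lemma norm_integral_le_nn_integral:
  fixes f :: "'a \<Rightarrow> 'b::{banach,second_countable_topology}"
  shows "ennreal (norm (integral\<^sup>L M f)) \<le> (\<integral>\<^sup>+x. norm (f x) \<partial>M)"
proof (cases "integrable M f")
  case True
  then show ?thesis by (rule integral_norm_bound_ennreal)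
qed (simp add: not_integrable_integral_eq)

text \<open>By \<open>2ab \<le> a\<^sup>2 + b\<^sup>2\<close> the integrand is at most a mean of two squares, and both of them integrate to
the right-hand side by translation invariance.\<close>

lemma gaussian_correlation_le:
  fixes E :: "'a::euclidean_space \<Rightarrow> real"
  assumes [measurable]: "E \<in> borel_measurable borel" and nonneg: "\<And>u. 0 \<le> E u"
  shows "(\<integral>\<^sup>+v. \<integral>\<^sup>+t. ennreal (gaussian t * (E v * E (v + \<epsilon> *\<^sub>R t))) \<partial>lborel \<partial>lborel)
    \<le> (\<integral>\<^sup>+v. ennreal ((E v)\<^sup>2) \<partial>lborel)" (is "_ \<le> ?A")
proof -
  have g0: "0 \<le> gaussian t" for t :: 'a by (rule less_imp_le[OF gaussian_pos])
  have one: "(\<integral>\<^sup>+t. ennreal (gaussian (t::'a)) \<partial>lborel) = 1"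
    by (subst nn_integral_eq_integral[OF integrable_gaussian]) (auto simp: g0 integral_gaussian)
  have am: "gaussian t * (E v * E w) \<le> gaussian t * (E v)\<^sup>2 / 2 + gaussian t * (E w)\<^sup>2 / 2" for t :: 'a and v w
  proof -
    have "E v * E w \<le> ((E v)\<^sup>2 + (E w)\<^sup>2) / 2"
      using sum_squares_bound[of "E v" "E w"] by simp
    from mult_left_mono[OF this g0[of t]] show ?thesis by (simp add: algebra_simps add_divide_distrib)
  qed
  have "(\<integral>\<^sup>+v. \<integral>\<^sup>+t. ennreal (gaussian t * (E v * E (v + \<epsilon> *\<^sub>R t))) \<partial>lborel \<partial>lborel) \<le>
      (\<integral>\<^sup>+v. \<integral>\<^sup>+t. ennreal (gaussian t) * ennreal ((E v)\<^sup>2 / 2)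
          + ennreal (gaussian t) * ennreal ((E (v + \<epsilon> *\<^sub>R t))\<^sup>2 / 2) \<partial>lborel \<partial>lborel)"
  proof (intro nn_integral_mono)
    fix v t :: 'a
    have "ennreal (gaussian t * (E v * E (v + \<epsilon> *\<^sub>R t))) \<le>
        ennreal (gaussian t * ((E v)\<^sup>2 / 2) + gaussian t * ((E (v + \<epsilon> *\<^sub>R t))\<^sup>2 / 2))"
      using am[of t v "v + \<epsilon> *\<^sub>R t"] by (intro ennreal_leI) simp
    also have "\<dots> = ennreal (gaussian t) * ennreal ((E v)\<^sup>2 / 2)
          + ennreal (gaussian t) * ennreal ((E (v + \<epsilon> *\<^sub>R t))\<^sup>2 / 2)"
      by (subst ennreal_plus) (simp_all add: g0 ennreal_mult'[symmetric])
    finally show "ennreal (gaussian t * (E v * E (v + \<epsilon> *\<^sub>R t))) \<le> \<dots>" .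
  qed
  also have "\<dots> = (\<integral>\<^sup>+v. ennreal ((E v)\<^sup>2 / 2) \<partial>lborel) +
      (\<integral>\<^sup>+v. \<integral>\<^sup>+t. ennreal (gaussian t) * ennreal ((E (v + \<epsilon> *\<^sub>R t))\<^sup>2 / 2) \<partial>lborel \<partial>lborel)"
    by (simp add: nn_integral_add nn_integral_multc one)
  also have "(\<integral>\<^sup>+v. \<integral>\<^sup>+t. ennreal (gaussian t) * ennreal ((E (v + \<epsilon> *\<^sub>R t))\<^sup>2 / 2) \<partial>lborel \<partial>lborel) =
      (\<integral>\<^sup>+t. \<integral>\<^sup>+v. ennreal (gaussian t) * ennreal ((E (v + \<epsilon> *\<^sub>R t))\<^sup>2 / 2) \<partial>lborel \<partial>lborel)"
    by (rule lborel_pair.Fubini') measurable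
  also have "\<dots> = (\<integral>\<^sup>+t. ennreal (gaussian (t::'a)) * (\<integral>\<^sup>+v. ennreal ((E v)\<^sup>2 / 2) \<partial>lborel) \<partial>lborel)"
    by (simp add: nn_integral_cmult lborel_nn_integral_shift[of "\<lambda>v. ennreal ((E v)\<^sup>2 / 2)"])
  also have "\<dots> = (\<integral>\<^sup>+v. ennreal ((E v)\<^sup>2 / 2) \<partial>lborel)"
    by (simp add: nn_integral_multc one)
  also have "(\<integral>\<^sup>+v. ennreal ((E v)\<^sup>2 / 2) \<partial>lborel) + (\<integral>\<^sup>+v. ennreal ((E v)\<^sup>2 / 2) \<partial>lborel) = ?A"
    by (subst nn_integral_add[symmetric]) (auto simp flip: ennreal_plus)
  finally show ?thesis .
qed

text \<open>One half of Plancherel's theorem. Against the Gaussian weight of width \<open>1/\<epsilon>\<close>, the integral of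
\<open>\<bar>ft E\<bar>\<^sup>2\<close> is, up to a constant, a Gaussian average of correlations of \<open>E\<close>; the weight is removed with Fatou's lemma.\<close>

lemma ft_bessel:
  fixes E :: "'a::euclidean_space \<Rightarrow> real"
  assumes E: "integrable lborel E" and E2: "integrable lborel (\<lambda>u. (E u)\<^sup>2)" and nonneg: "\<And>u. 0 \<le> E u"
  shows "integrable lborel (\<lambda>x. (norm (ft (\<lambda>u. complex_of_real (E u)) x))\<^sup>2)"
    and "(LINT x|lborel. (norm (ft (\<lambda>u. complex_of_real (E u)) x))\<^sup>2) \<le> (2 * pi) ^ DIM('a) * (LINT u|lborel. (E u)\<^sup>2)"
proof -
  have [measurable]: "E \<in> borel_measurable borel" using E by auto
  have Ec: "integrable lborel (\<lambda>u. complex_of_real (E u))"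
    using E by (simp add: complex_of_real_integrable_eq)
  let ?f = "ft (\<lambda>u. complex_of_real (E u))"
  let ?A = "LINT u|lborel. (E u)\<^sup>2"
  let ?c = "(2 * pi) ^ DIM('a)"
  let ?w = "\<lambda>\<epsilon> u::'a. exp (- (norm (\<epsilon> *\<^sub>R u))\<^sup>2 / 2)"
  have A: "(\<integral>\<^sup>+v. ennreal ((E v)\<^sup>2) \<partial>lborel) = ennreal ?A"
    by (rule nn_integral_eq_integral[OF E2]) simp
  have g0: "0 \<le> gaussian t" for t :: 'a by (rule less_imp_le[OF gaussian_pos])
  \<comment> \<open>Expanding only the conjugate factor of \<open>\<bar>ft E\<bar>\<^sup>2\<close> leaves an inner integral of inversion type.\<close>
  have step: "(\<integral>\<^sup>+u. ennreal ((norm (?f u))\<^sup>2 * ?w \<epsilon> u) \<partial>lborel) \<le> ennreal (?c * ?A)" if e: "\<epsilon> > 0" for \<epsilon>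
  proof -
    let ?F = "\<lambda>u v. ?f u * cis (- (v \<bullet> u)) * ?w \<epsilon> u * E v"
    define B where "B = (LINT u|lborel. norm (complex_of_real (E u)))"
    have B: "norm (?f u) \<le> B" for u unfolding B_def by (rule norm_ft_le)
    have B0: "0 \<le> B" unfolding B_def by simp
    have w: "integrable lborel (\<lambda>u. complex_of_real (?w \<epsilon> u))"
      unfolding complex_of_real_integrable_eq by (rule integrable_gaussian_scaled[OF e])
    have I: "integrable (lborel \<Otimes>\<^sub>M lborel) (\<lambda>(u,v). ?F u v)"
    proof (rule Bochner_Integration.integrable_bound)
      show "integrable (lborel \<Otimes>\<^sub>M lborel) (\<lambda>(u,v). (B * complex_of_real (?w \<epsilon> u)) * complex_of_real (E v))"
        by (rule integrable_lborel_pairI[OF integrable_mult_right[OF w] Ec])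
      show "AE x in lborel \<Otimes>\<^sub>M lborel. norm (case x of (u,v) \<Rightarrow> ?F u v) \<le>
          norm (case x of (u,v) \<Rightarrow> (B * complex_of_real (?w \<epsilon> u)) * complex_of_real (E v))"
        using B B0 by (intro AE_I2) (auto simp: norm_mult intro!: mult_right_mono)
    qed measurable
    have wi: "integrable lborel (\<lambda>u. (norm (?f u))\<^sup>2 * ?w \<epsilon> u)"
    proof (rule Bochner_Integration.integrable_bound)
      show "integrable lborel (\<lambda>u. B\<^sup>2 * ?w \<epsilon> u)"
        by (intro integrable_mult_right integrable_gaussian_scaled[OF e])
      show "AE u in lborel. norm ((norm (?f u))\<^sup>2 * ?w \<epsilon> u) \<le> norm (B\<^sup>2 * ?w \<epsilon> u)"
        using B by (intro AE_I2) (auto simp: abs_mult intro!: mult_right_mono power_mono)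
    qed measurable
    have cnj: "cnj (?f u) = (LINT v|lborel. cis (- (v \<bullet> u)) * E v)" for u
    proof -
      have "cnj (?f u) = (LINT v|lborel. cnj (cis (u \<bullet> v) * E v))"
        by (simp only: ft_def Bochner_Integration.integral_cnj)
      also have "\<dots> = (LINT v|lborel. cis (- (v \<bullet> u)) * E v)"
        by (simp only: complex_cnj_mult cis_cnj complex_cnj_complex_of_real inner_commute)
      finally show ?thesis .
    qed
    have "complex_of_real (LINT u|lborel. (norm (?f u))\<^sup>2 * ?w \<epsilon> u) =
        (LINT u|lborel. complex_of_real ((norm (?f u))\<^sup>2 * ?w \<epsilon> u))"
      by (rule integral_complex_of_real[symmetric])
    also have "\<dots> = (LINT u|lborel. (LINT v|lborel. ?F u v))"
    proof (rule Bochner_Integration.integral_cong[OF refl])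
      fix u
      have "complex_of_real ((norm (?f u))\<^sup>2 * ?w \<epsilon> u) = ?f u * ?w \<epsilon> u * cnj (?f u)"
        by (simp only: of_real_mult complex_norm_square mult_ac)
      also have "\<dots> = (LINT v|lborel. (?f u * ?w \<epsilon> u) * (cis (- (v \<bullet> u)) * E v))"
        unfolding cnj by (rule integral_mult_right_zero[symmetric])
      finally show "complex_of_real ((norm (?f u))\<^sup>2 * ?w \<epsilon> u) = (LINT v|lborel. ?F u v)"
        by (simp only: mult_ac)
    qed
    also have "\<dots> = (LINT v|lborel. (LINT u|lborel. ?F u v))"
      using lborel_pair.Fubini_integral[OF I] by simp
    also have "\<dots> = (LINT v|lborel. complex_of_real (?c * (LINT t|lborel. gaussian t * (E v * E (v + \<epsilon> *\<^sub>R t)))))"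
    proof (rule Bochner_Integration.integral_cong[OF refl])
      fix v
      have "(LINT u|lborel. ?F u v) =
          complex_of_real ?c * (LINT t|lborel. complex_of_real (gaussian t) * complex_of_real (E (v + \<epsilon> *\<^sub>R t))) * E v"
        by (simp only: integral_mult_left_zero gaussian_inversion[OF Ec e])
      also have "(LINT t|lborel. complex_of_real (gaussian t) * complex_of_real (E (v + \<epsilon> *\<^sub>R t))) =
          complex_of_real (LINT t|lborel. gaussian t * E (v + \<epsilon> *\<^sub>R t))"
        by (simp only: of_real_mult[symmetric] integral_complex_of_real)
      also have "complex_of_real ?c * \<dots> * E v = complex_of_real (?c * (E v * (LINT t|lborel. gaussian t * E (v + \<epsilon> *\<^sub>R t))))"
        by (simp only: of_real_mult mult_ac)
      also have "E v * (LINT t|lborel. gaussian t * E (v + \<epsilon> *\<^sub>R t)) =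
          (LINT t|lborel. E v * (gaussian t * E (v + \<epsilon> *\<^sub>R t)))"
        by (rule integral_mult_right_zero[symmetric])
      also have "\<dots> = (LINT t|lborel. gaussian t * (E v * E (v + \<epsilon> *\<^sub>R t)))"
        by (simp only: mult_ac)
      finally show "(LINT u|lborel. ?F u v) =
          complex_of_real (?c * (LINT t|lborel. gaussian t * (E v * E (v + \<epsilon> *\<^sub>R t))))" .
    qed
    also have "\<dots> = complex_of_real (?c * (LINT v|lborel. LINT t|lborel. gaussian t * (E v * E (v + \<epsilon> *\<^sub>R t))))"
      by (simp only: integral_complex_of_real integral_mult_right_zero)
    finally have eq: "(LINT u|lborel. (norm (?f u))\<^sup>2 * ?w \<epsilon> u) =
        ?c * (LINT v|lborel. LINT t|lborel. gaussian t * (E v * E (v + \<epsilon> *\<^sub>R t)))"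
      by (simp only: of_real_eq_iff)
    have "(\<integral>\<^sup>+u. ennreal ((norm (?f u))\<^sup>2 * ?w \<epsilon> u) \<partial>lborel) = ennreal (LINT u|lborel. (norm (?f u))\<^sup>2 * ?w \<epsilon> u)"
      by (rule nn_integral_eq_integral[OF wi]) simp
    also have "\<dots> = ennreal ?c * ennreal (LINT v|lborel. LINT t|lborel. gaussian t * (E v * E (v + \<epsilon> *\<^sub>R t)))"
      unfolding eq by (rule ennreal_mult') simp
    also have "\<dots> \<le> ennreal ?c * ennreal ?A"
    proof (rule mult_left_mono)
      have "ennreal (LINT v|lborel. LINT t|lborel. gaussian t * (E v * E (v + \<epsilon> *\<^sub>R t))) \<le>
         ennreal (norm (LINT v|lborel. LINT t|lborel. gaussian t * (E v * E (v + \<epsilon> *\<^sub>R t))))"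
        by (intro ennreal_leI) simp
      also have "\<dots> \<le> (\<integral>\<^sup>+v. ennreal (norm (LINT t|lborel. gaussian t * (E v * E (v + \<epsilon> *\<^sub>R t)))) \<partial>lborel)"
        by (rule norm_integral_le_nn_integral)
      also have "\<dots> \<le> (\<integral>\<^sup>+v. \<integral>\<^sup>+t. ennreal (norm (gaussian t * (E v * E (v + \<epsilon> *\<^sub>R t)))) \<partial>lborel \<partial>lborel)"
        by (intro nn_integral_mono norm_integral_le_nn_integral)
      also have "\<dots> = (\<integral>\<^sup>+v. \<integral>\<^sup>+t. ennreal (gaussian t * (E v * E (v + \<epsilon> *\<^sub>R t))) \<partial>lborel \<partial>lborel)"
        by (simp add: g0 nonneg)
      also have "\<dots> \<le> ennreal ?A"
        unfolding A[symmetric] by (rule gaussian_correlation_le) (use nonneg in simp_all)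
      finally show "ennreal (LINT v|lborel. LINT t|lborel. gaussian t * (E v * E (v + \<epsilon> *\<^sub>R t))) \<le> ennreal ?A" .
    qed simp
    also have "\<dots> = ennreal (?c * ?A)" by (rule ennreal_mult'[symmetric]) simp
    finally show ?thesis .
  qed
  define \<epsilon> where "\<epsilon> n = inverse (real (Suc n))" for n
  have pos: "\<epsilon> n > 0" for n by (simp add: \<epsilon>_def)
  have lim: "\<epsilon> \<longlonglongrightarrow> 0" unfolding \<epsilon>_def by (rule LIMSEQ_inverse_real_of_nat)
  have nn: "(\<integral>\<^sup>+u. ennreal ((norm (?f u))\<^sup>2) \<partial>lborel) \<le> ennreal (?c * ?A)"
  proof -
    have "(\<lambda>n. ennreal ((norm (?f u))\<^sup>2 * ?w (\<epsilon> n) u)) \<longlonglongrightarrow> ennreal ((norm (?f u))\<^sup>2)" for u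
    proof -
      have "(\<lambda>n. ennreal ((norm (?f u))\<^sup>2 * ?w (\<epsilon> n) u)) \<longlonglongrightarrow>
          ennreal ((norm (?f u))\<^sup>2 * exp (- (norm (0 *\<^sub>R u))\<^sup>2 / 2))"
        by (intro tendsto_ennrealI tendsto_mult tendsto_exp tendsto_divide tendsto_minus tendsto_power
            tendsto_norm tendsto_scaleR lim tendsto_const) simp
      then show ?thesis by simp
    qed
    then have "(\<integral>\<^sup>+u. ennreal ((norm (?f u))\<^sup>2) \<partial>lborel) =
        (\<integral>\<^sup>+u. liminf (\<lambda>n. ennreal ((norm (?f u))\<^sup>2 * ?w (\<epsilon> n) u)) \<partial>lborel)"
      by (intro nn_integral_cong lim_imp_Liminf[symmetric] sequentially_bot)
    also have "\<dots> \<le> liminf (\<lambda>n. \<integral>\<^sup>+u. ennreal ((norm (?f u))\<^sup>2 * ?w (\<epsilon> n) u) \<partial>lborel)"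
      by (rule nn_integral_liminf) measurable
    also have "\<dots> \<le> liminf (\<lambda>n::nat. ennreal (?c * ?A))"
      by (intro Liminf_mono always_eventually allI step pos)
    also have "\<dots> = ennreal (?c * ?A)" by (simp add: Liminf_const)
    finally show ?thesis .
  qed
  show int: "integrable lborel (\<lambda>x. (norm (?f x))\<^sup>2)"
  proof (rule integrableI_bounded)
    show "(\<integral>\<^sup>+u. ennreal (norm ((norm (?f u))\<^sup>2)) \<partial>lborel) < \<infinity>"
      using nn by (simp add: le_less_trans)
  qed measurable
  have "ennreal (LINT x|lborel. (norm (?f x))\<^sup>2) \<le> ennreal (?c * ?A)"
    using nn nn_integral_eq_integral[OF int] by simp
  then show "(LINT x|lborel. (norm (?f x))\<^sup>2) \<le> ?c * ?A"
    by (simp add: ennreal_le_iff)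
qed

section \<open>Weak-star cluster points of bounded functions\<close>

text \<open>Tychonoff's theorem for the product of the intervals \<open>[- b i, b i]\<close>. A cluster point is described
here by what is used of it: it lies in every closed set that contains almost all terms. Subsequences
would not do, because the index type is uncountable.\<close>

lemma pointwise_cluster_point:
  fixes L :: "nat \<Rightarrow> 'i \<Rightarrow> real" and b :: "'i \<Rightarrow> real"
  assumes bound: "\<And>n i. \<bar>L n i\<bar> \<le> b i"
  obtains \<Lambda> where
    "\<And>C. closed C \<Longrightarrow> eventually (\<lambda>n. L n \<in> C) sequentially \<Longrightarrow> \<Lambda> \<in> C"
proof -
  let ?S = "\<lambda>i. {- b i..b i}"
  have "compactin (product_topology (\<lambda>i::'i. euclidean :: real topology) UNIV) (Pi\<^sub>E UNIV ?S)"
    by (simp add: compactin_PiE)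
  then have K: "compact (Pi\<^sub>E UNIV ?S)"
    by (simp add: euclidean_product_topology)
  have mem: "L n \<in> Pi\<^sub>E UNIV ?S" for n
    using bound[of n] by (auto simp: abs_le_iff minus_le_iff)
  let ?F = "{C. closed C \<and> eventually (\<lambda>n. L n \<in> C) sequentially}"
  have "Pi\<^sub>E UNIV ?S \<inter> \<Inter>?F \<noteq> {}"
  proof (rule compact_imp_fip[OF K])
    fix F' assume F': "finite F'" "F' \<subseteq> ?F"
    then have "eventually (\<lambda>n. \<forall>C\<in>F'. L n \<in> C) sequentially"
      by (auto simp: eventually_ball_finite_distrib)
    then obtain n where "\<forall>C\<in>F'. L n \<in> C"
      by (auto simp: eventually_sequentially)
    with mem[of n] show "Pi\<^sub>E UNIV ?S \<inter> \<Inter>F' \<noteq> {}" by blast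
  qed auto
  then have "\<exists>\<Lambda>. \<Lambda> \<in> Pi\<^sub>E UNIV ?S \<inter> \<Inter>?F" by (simp only: ex_in_conv not_False_eq_True)
  then obtain \<Lambda> where "\<Lambda> \<in> \<Inter>?F" by (elim exE IntE)
  then show thesis by (intro that[of \<Lambda>]) auto
qed

text \<open>On indicators such a functional is a measure, countable additivity coming from the bound \<open>upper\<close>. Its
Radon-Nikodym density is the function \<open>\<phi>\<close>, and density of simple functions carries the formula over
to all integrable functions.\<close>

lemma bounded_functional_density:
  fixes M :: "'a measure" and L :: "('a \<Rightarrow> real) \<Rightarrow> real"
  assumes fin: "finite_measure M" and c: "0 \<le> c"
    and add: "\<And>f g. integrable M f \<Longrightarrow> integrable M g \<Longrightarrow> L (\<lambda>x. f x + g x) = L f + L g"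
    and scale: "\<And>f a. integrable M f \<Longrightarrow> L (\<lambda>x. a * f x) = a * L f"
    and pos: "\<And>f. integrable M f \<Longrightarrow> (\<And>x. 0 \<le> f x) \<Longrightarrow> 0 \<le> L f"
    and upper: "\<And>f. integrable M f \<Longrightarrow> (\<And>x. 0 \<le> f x) \<Longrightarrow> L f \<le> c * (LINT x|M. f x)"
  shows "\<exists>\<phi>. \<phi> \<in> borel_measurable M \<and> range \<phi> \<subseteq> {0..c} \<and>
    (\<forall>f. integrable M f \<longrightarrow> L f = (LINT x|M. f x * \<phi> x))"
proof -
  interpret M: finite_measure M by (rule fin)
  have ind: "integrable M (indicator A :: 'a \<Rightarrow> real)" if "A \<in> sets M" for A
    using that M.emeasure_finite[of A] by (auto simp: less_top[symmetric])
  define \<nu> where "\<nu> A = ennreal (L (indicator A))" for A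
  have diff: "L (\<lambda>x. f x - g x) = L f - L g" if "integrable M f" "integrable M g" for f g
    using add[OF that(1), of "\<lambda>x. - 1 * g x"] scale[OF that(2), of "-1"] that(2) by simp
  have bnd: "\<bar>L f\<bar> \<le> c * (LINT x|M. \<bar>f x\<bar>)" if f: "integrable M f" for f
  proof -
    have a: "integrable M (\<lambda>x. \<bar>f x\<bar>)" using f by simp
    have "0 \<le> L (\<lambda>x. \<bar>f x\<bar> - f x)" "0 \<le> L (\<lambda>x. \<bar>f x\<bar> + f x)"
      using f a by (auto intro!: pos)
    then have "\<bar>L f\<bar> \<le> L (\<lambda>x. \<bar>f x\<bar>)"
      using diff[OF a f] add[OF a f] by auto
    also have "\<dots> \<le> c * (LINT x|M. \<bar>f x\<bar>)" by (rule upper[OF a]) simp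
    finally show ?thesis .
  qed
  have L0: "L (\<lambda>x. 0) = 0" using scale[of "\<lambda>x. 0" 0] by simp
  have fin_add: "L (indicator (\<Union>i<n. A i)) = (\<Sum>i<n. L (indicator (A i)))"
    if A: "range A \<subseteq> sets M" "disjoint_family A" for A :: "nat \<Rightarrow> 'a set" and n
  proof (induction n)
    case 0
    then show ?case using L0 by (simp add: indicator_def[abs_def])
  next
    case (Suc n)
    have "A i \<inter> A n = {}" if "i < n" for i
      using A(2) that unfolding disjoint_family_on_def by (metis UNIV_I less_irrefl)
    then have disj: "(\<Union>i<n. A i) \<inter> A n = {}" by blast
    have "(\<Union>i<Suc n. A i) = (\<Union>i<n. A i) \<union> A n"
      by (auto simp: lessThan_Suc)
    then have "indicator (\<Union>i<Suc n. A i) = (\<lambda>x. indicator (\<Union>i<n. A i) x + (indicator (A n) x :: real))"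
      by (simp only: fun_eq_iff indicator_disj_union[OF disj] simp_thms)
    moreover have "L (\<lambda>x. indicator (\<Union>i<n. A i) x + indicator (A n) x) =
        L (indicator (\<Union>i<n. A i)) + L (indicator (A n))"
      using A by (intro add ind) auto
    ultimately show ?case using Suc by simp
  qed
  have ca: "countably_additive (sets M) \<nu>"
  proof (rule countably_additiveI)
    fix A :: "nat \<Rightarrow> 'a set"
    assume A: "range A \<subseteq> sets M" "disjoint_family A" "(\<Union>i. A i) \<in> sets M"
    let ?U = "\<Union>i. A i"
    have "(\<lambda>n. \<Sum>i<n. L (indicator (A i))) \<longlonglongrightarrow> L (indicator ?U)"
    proof (rule Lim_null[THEN iffD2], rule Lim_null_comparison)
      have sub: "(\<Union>i<n. A i) \<in> sets M" for n using A by auto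
      have "norm ((\<Sum>i<n. L (indicator (A i))) - L (indicator ?U)) \<le>
          c * (measure M ?U - measure M (\<Union>i<n. A i))" for n
      proof -
        have "(\<Sum>i<n. L (indicator (A i))) - L (indicator ?U) =
            L (\<lambda>x. indicator (\<Union>i<n. A i) x - indicator ?U x)"
          using diff[OF ind[OF sub] ind[OF A(3)], of n] fin_add[OF A(1,2), of n] by simp
        also have "norm \<dots> \<le> c * (LINT x|M. \<bar>indicator (\<Union>i<n. A i) x - indicator ?U x\<bar>)"
          unfolding real_norm_def using ind[OF sub] ind[OF A(3)] by (intro bnd) auto
        also have "(LINT x|M. \<bar>indicator (\<Union>i<n. A i) x - indicator ?U x\<bar> :: real) =
            (LINT x|M. indicator ?U x - indicator (\<Union>i<n. A i) x)"
          by (intro Bochner_Integration.integral_cong) (auto simp: indicator_def)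
        also have "\<dots> = measure M ?U - measure M (\<Union>i<n. A i)"
          using ind[OF sub] ind[OF A(3)] sub A(3)
          by (subst Bochner_Integration.integral_diff) auto
        finally show ?thesis .
      qed
      then show "eventually (\<lambda>n. norm ((\<Sum>i<n. L (indicator (A i))) - L (indicator ?U)) \<le>
          c * (measure M ?U - measure M (\<Union>i<n. A i))) sequentially" by simp
      have "(\<lambda>n. measure M (\<Union>i<n. A i)) \<longlonglongrightarrow> measure M (\<Union>n. \<Union>i<n. A i)"
        using sub by (intro M.finite_Lim_measure_incseq) (auto simp: incseq_def, force)
      moreover have "(\<Union>n. \<Union>i<n. A i) = ?U" by auto
      ultimately have "(\<lambda>n. c * (measure M ?U - measure M (\<Union>i<n. A i))) \<longlonglongrightarrow> c * (measure M ?U - measure M ?U)"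
        by (intro tendsto_intros) auto
      then show "(\<lambda>n. c * (measure M ?U - measure M (\<Union>i<n. A i))) \<longlonglongrightarrow> 0" by simp
    qed
    then have "(\<lambda>i. L (indicator (A i))) sums L (indicator ?U)" by (simp add: sums_def)
    then show "(\<Sum>i. \<nu> (A i)) = \<nu> ?U"
      unfolding \<nu>_def using A by (intro suminf_ennreal_eq pos ind) auto
  qed
  define N where "N = measure_of (space M) (sets M) \<nu>"
  have setsN: "sets N = sets M" and spaceN: "space N = space M"
    by (auto simp: N_def)
  have N: "emeasure N A = \<nu> A" if "A \<in> sets M" for A
  proof (rule emeasure_measure_of[OF N_def])
    show "positive (sets N) \<nu>"
      using L0 by (auto simp: positive_def \<nu>_def indicator_def[abs_def])
    show "countably_additive (sets N) \<nu>" unfolding setsN by (rule ca)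
  qed (use that in \<open>auto simp: setsN sets.space_closed\<close>)
  have Nle: "emeasure N A \<le> ennreal c * emeasure M A" if A: "A \<in> sets M" for A
  proof -
    have "L (indicator A) \<le> c * measure M A"
      using upper[OF ind[OF A]] A by (simp add: M.emeasure_finite)
    then have "ennreal (L (indicator A)) \<le> ennreal (c * measure M A)" by (rule ennreal_leI)
    also have "\<dots> = ennreal c * emeasure M A"
      by (simp add: M.emeasure_eq_measure ennreal_mult c)
    finally show ?thesis by (simp add: N[OF A] \<nu>_def)
  qed
  have "absolutely_continuous M N"
    unfolding absolutely_continuous_def
  proof
    fix A assume "A \<in> null_sets M"
    then have "A \<in> sets M" "emeasure M A = 0" by auto
    with Nle[of A] show "A \<in> null_sets N" by (auto simp: setsN null_sets_def)
  qed
  from M.Radon_Nikodym[OF this setsN] obtain f where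
    f[measurable]: "f \<in> borel_measurable M" and dens: "density M f = N" by auto
  have fle: "AE x in M. f x \<le> ennreal c"
  proof -
    define B where "B = {x \<in> space M. ennreal c < f x}"
    have B[measurable]: "B \<in> sets M" unfolding B_def by measurable
    have "AE x in M. f x * indicator B x \<le> ennreal c * indicator B x"
    proof (rule ccontr)
      assume neg: "\<not> ?thesis"
      have "(\<integral>\<^sup>+x. ennreal c * indicator B x \<partial>M) < (\<integral>\<^sup>+x. f x * indicator B x \<partial>M)"
      proof (rule nn_integral_less[OF _ _ _ _ neg])
        show "(\<integral>\<^sup>+x. ennreal c * indicator B x \<partial>M) \<noteq> \<infinity>"
          using M.emeasure_finite[of B] by (simp add: nn_integral_cmult_indicator ennreal_mult_eq_top_iff)
        show "AE x in M. ennreal c * indicator B x \<le> f x * indicator B x"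
          by (rule AE_I2) (auto simp: B_def indicator_def)
      qed measurable
      also have "\<dots> = emeasure N B"
        unfolding dens[symmetric] by (rule emeasure_density[symmetric]) measurable
      also have "\<dots> \<le> ennreal c * emeasure M B" by (rule Nle[OF B])
      finally show False by (simp add: nn_integral_cmult_indicator)
    qed
    then show ?thesis
      using AE_space
    proof eventually_elim
      case (elim x)
      then show ?case by (cases "x \<in> B") (simp, simp add: B_def)
    qed
  qed
  define \<phi> where "\<phi> x = min c (enn2real (f x))" for x
  have \<phi>m[measurable]: "\<phi> \<in> borel_measurable M" unfolding \<phi>_def by measurable
  have \<phi>r: "\<phi> x \<in> {0..c}" for x using c by (auto simp: \<phi>_def)
  have f\<phi>: "AE x in M. f x = ennreal (\<phi> x)"
    using fle
  proof eventually_elim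
    case (elim x)
    then obtain r where "f x = ennreal r" "0 \<le> r" by (cases "f x") (auto simp: top_unique)
    with elim c show ?case by (simp add: \<phi>_def ennreal_le_iff min_absorb2)
  qed
  have int: "integrable M (\<lambda>x. g x * \<phi> x)" if "integrable M g" for g :: "'a \<Rightarrow> real"
  proof (rule Bochner_Integration.integrable_bound[OF integrable_mult_left[OF that, of c]])
    show "AE x in M. norm (g x * \<phi> x) \<le> norm (g x * c)"
      using \<phi>r c by (intro AE_I2) (auto simp: abs_mult intro!: mult_left_mono)
    show "(\<lambda>x. g x * \<phi> x) \<in> borel_measurable M" using that by measurable
  qed
  have main: "L g = (LINT x|M. g x * \<phi> x)" if "integrable M g" for g
    using that
  proof (induction rule: integrable_induct)
    case (base A a)
    have "ennreal (L (indicator A)) = emeasure (density M f) A"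
      using base by (simp add: dens N \<nu>_def)
    also have "\<dots> = (\<integral>\<^sup>+x. f x * indicator A x \<partial>M)"
      using base by (intro emeasure_density) auto
    also have "\<dots> = (\<integral>\<^sup>+x. ennreal (indicator A x * \<phi> x) \<partial>M)"
      by (rule nn_integral_cong_AE) (use f\<phi> in \<open>eventually_elim, auto simp: indicator_def\<close>)
    also have "\<dots> = ennreal (LINT x|M. indicator A x * \<phi> x)"
      using int[OF ind[OF base(1)]] \<phi>r by (intro nn_integral_eq_integral) auto
    finally have "L (indicator A) = (LINT x|M. indicator A x * \<phi> x)"
      using pos[OF ind[OF base(1)]] \<phi>r by (subst (asm) ennreal_inj) (auto intro!: integral_nonneg_AE)
    moreover have "L (\<lambda>x. indicator A x *\<^sub>R a) = a * L (indicator A)"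
      using scale[OF ind[OF base(1)], of a] by (simp add: mult.commute)
    ultimately show ?case by (simp add: mult_ac)
  next
    case (add f g)
    then show ?case by (simp add: assms(3) int distrib_right)
  next
    case (lim f s)
    have I: "integrable M (\<lambda>x. \<bar>s i x - f x\<bar>)" for i using lim.hyps(1,4) by simp
    have conv: "(\<lambda>i. LINT x|M. \<bar>s i x - f x\<bar>) \<longlonglongrightarrow> (LINT x|M. 0)"
    proof (rule integral_dominated_convergence[where w="\<lambda>x. 3 * \<bar>f x\<bar>"])
      show "AE x in M. (\<lambda>i. \<bar>s i x - f x\<bar>) \<longlonglongrightarrow> 0"
        using lim.hyps(2) by (intro AE_I2 tendsto_rabs_zero) (simp add: LIM_zero)
      show "AE x in M. norm \<bar>s i x - f x\<bar> \<le> 3 * \<bar>f x\<bar>" for i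
      proof (rule AE_I2)
        fix x assume "x \<in> space M"
        from lim.hyps(3)[OF this, of i] show "norm \<bar>s i x - f x\<bar> \<le> 3 * \<bar>f x\<bar>" by simp
      qed
    qed (use lim.hyps(1,4) in auto)
    have "(\<lambda>i. L (s i)) \<longlonglongrightarrow> L f"
    proof (rule Lim_null[THEN iffD2], rule Lim_null_comparison)
      show "eventually (\<lambda>i. norm (L (s i) - L f) \<le> c * (LINT x|M. \<bar>s i x - f x\<bar>)) sequentially"
        using bnd lim.hyps(1,4) by (intro always_eventually allI) (simp add: diff[symmetric])
      show "(\<lambda>i. c * (LINT x|M. \<bar>s i x - f x\<bar>)) \<longlonglongrightarrow> 0"
        using tendsto_mult_left[OF conv, of c] by simp
    qed
    moreover have "(\<lambda>i. L (s i)) \<longlonglongrightarrow> (LINT x|M. f x * \<phi> x)"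
      unfolding lim.IH
    proof (rule integral_dominated_convergence[where w="\<lambda>x. 2 * c * \<bar>f x\<bar>"])
      show "AE x in M. (\<lambda>i. s i x * \<phi> x) \<longlonglongrightarrow> f x * \<phi> x"
        using lim.hyps(2) by (intro AE_I2 tendsto_intros) auto
      show "AE x in M. norm (s i x * \<phi> x) \<le> 2 * c * \<bar>f x\<bar>" for i
      proof (rule AE_I2)
        fix x assume "x \<in> space M"
        from lim.hyps(3)[OF this, of i] \<phi>r[of x] c show "norm (s i x * \<phi> x) \<le> 2 * c * \<bar>f x\<bar>"
          using mult_mono[of "\<bar>s i x\<bar>" "2 * \<bar>f x\<bar>" "\<phi> x" c] by (simp add: abs_mult mult_ac)
      qed
    qed (use lim.hyps(1,4) in \<open>auto intro: borel_measurable_times \<phi>m\<close>)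
    ultimately show ?case by (rule LIMSEQ_unique)
  qed
  show ?thesis using \<phi>m \<phi>r main by (intro exI[of _ \<phi>]) auto
qed


text \<open>The sequence induces bounded functionals on real integrable functions. Linearity, positivity and
the bound by \<open>c\<close> are closed conditions on a functional, hence are inherited by a cluster point, which is
therefore given by a function. A convergent sequence of integrals can only cluster at its limit.
The Gaussian weight makes Lebesgue measure finite for the representation of the functional.\<close>

lemma weak_star_cluster_point:
  fixes \<phi> :: "nat \<Rightarrow> 'a::euclidean_space \<Rightarrow> real"
  assumes meas: "\<And>n. \<phi> n \<in> borel_measurable borel" and rng: "\<And>n x. \<phi> n x \<in> {0..c}"
  obtains \<psi> where "\<psi> \<in> borel_measurable borel" "range \<psi> \<subseteq> {0..c}"
    "\<And>(h :: 'a \<Rightarrow> complex) l. integrable lborel h \<Longrightarrow>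
       (\<lambda>n. LINT x|lborel. h x * complex_of_real (\<phi> n x)) \<longlonglongrightarrow> l \<Longrightarrow>
       (LINT x|lborel. h x * complex_of_real (\<psi> x)) = l"
proof -
  have c: "0 \<le> c" using rng[of 0 0] by auto
  have intp: "integrable lborel (\<lambda>x. h x * p x)"
    if h: "integrable lborel h" and p: "p \<in> borel_measurable borel" "\<And>x. p x \<in> {0..c}"
    for h p :: "'a \<Rightarrow> real"
  proof (rule Bochner_Integration.integrable_bound[OF integrable_mult_left[OF h, of c]])
    show "AE x in lborel. norm (h x * p x) \<le> norm (h x * c)"
      using p(2) c by (intro AE_I2) (auto simp: abs_mult intro!: mult_left_mono)
    show "(\<lambda>x. h x * p x) \<in> borel_measurable lborel"
      using borel_measurable_integrable[OF h] p(1) by simp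
  qed
  define L where "L n h = (if integrable lborel h then (LINT x|lborel. h x * \<phi> n x) else 0)"
    for n and h :: "'a \<Rightarrow> real"
  have Lint: "L n h = (LINT x|lborel. h x * \<phi> n x)" if "integrable lborel h" for n h
    using that by (simp add: L_def)
  have "\<bar>L n h\<bar> \<le> c * (LINT x|lborel. \<bar>h x\<bar>)" for n h
  proof (cases "integrable lborel h")
    case True
    have "\<bar>L n h\<bar> \<le> (LINT x|lborel. \<bar>h x * \<phi> n x\<bar>)"
      unfolding Lint[OF True] by (rule integral_abs_bound)
    also have "\<dots> \<le> (LINT x|lborel. c * \<bar>h x\<bar>)"
    proof (rule integral_mono)
      show "integrable lborel (\<lambda>x. \<bar>h x * \<phi> n x\<bar>)"
        using intp[OF True meas rng] by (rule integrable_abs)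
      show "integrable lborel (\<lambda>x. c * \<bar>h x\<bar>)" using True by simp
      show "\<bar>h x * \<phi> n x\<bar> \<le> c * \<bar>h x\<bar>" for x
        using rng[of n x] mult_right_mono[of "\<phi> n x" c "\<bar>h x\<bar>"] by (simp add: abs_mult mult.commute)
    qed
    finally show ?thesis by simp
  qed (simp add: L_def c)
  from pointwise_cluster_point[of L, OF this] obtain \<Lambda> where
    \<Lambda>: "\<And>C. closed C \<Longrightarrow> eventually (\<lambda>n. L n \<in> C) sequentially \<Longrightarrow> \<Lambda> \<in> C"
    by blast
  let ?M = "density lborel (\<lambda>x. ennreal (gaussian (x::'a)))"
  have g0: "0 \<le> gaussian x" for x :: 'a by (rule less_imp_le[OF gaussian_pos])
  have fin: "finite_measure ?M"
  proof (rule finite_measureI)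
    have "emeasure ?M (space ?M) = (\<integral>\<^sup>+x. ennreal (gaussian (x::'a)) \<partial>lborel)"
      by (simp add: emeasure_density)
    also have "\<dots> = ennreal (LINT x|lborel. gaussian (x::'a))"
      by (rule nn_integral_eq_integral[OF integrable_gaussian]) (simp add: g0)
    finally show "emeasure ?M (space ?M) \<noteq> \<infinity>" by simp
  qed
  have intM: "integrable ?M f \<longleftrightarrow> f \<in> borel_measurable borel \<and> integrable lborel (\<lambda>x. gaussian x * f x)"
    for f :: "'a \<Rightarrow> real"
  proof (cases "f \<in> borel_measurable borel")
    case True
    then show ?thesis by (subst integrable_density) (auto simp: g0)
  next
    case False
    then show ?thesis using borel_measurable_integrable[of ?M f] by auto
  qed
  have "\<exists>\<psi>. \<psi> \<in> borel_measurable ?M \<and> range \<psi> \<subseteq> {0..c} \<and>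
    (\<forall>f. integrable ?M f \<longrightarrow> \<Lambda> (\<lambda>x. gaussian x * f x) = (LINT x|?M. f x * \<psi> x))"
  proof (rule bounded_functional_density[OF fin c])
    fix f g :: "'a \<Rightarrow> real" assume "integrable ?M f" "integrable ?M g"
    then have f: "integrable lborel (\<lambda>x. gaussian x * f x)" and g: "integrable lborel (\<lambda>x. gaussian x * g x)"
      by (auto simp: intM)
    have "\<Lambda> \<in> {\<Lambda>. \<Lambda> (\<lambda>x. gaussian x * (f x + g x)) = \<Lambda> (\<lambda>x. gaussian x * f x) + \<Lambda> (\<lambda>x. gaussian x * g x)}" (is "_ \<in> ?C")
    proof (rule \<Lambda>)
      have "L n (\<lambda>x. gaussian x * (f x + g x)) = L n (\<lambda>x. gaussian x * f x) + L n (\<lambda>x. gaussian x * g x)" for n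
        using f g Bochner_Integration.integral_add[OF intp[OF f meas rng] intp[OF g meas rng]]
        by (simp add: Lint distrib_left distrib_right)
      then show "\<forall>\<^sub>F n in sequentially. L n \<in> ?C" by simp
    qed (intro closed_Collect_eq continuous_intros continuous_on_product_coordinates)
    then show "\<Lambda> (\<lambda>x. gaussian x * (f x + g x)) = \<Lambda> (\<lambda>x. gaussian x * f x) + \<Lambda> (\<lambda>x. gaussian x * g x)"
      by simp
  next
    fix f :: "'a \<Rightarrow> real" and a assume "integrable ?M f"
    then have f: "integrable lborel (\<lambda>x. gaussian x * f x)" by (auto simp: intM)
    have "\<Lambda> \<in> {\<Lambda>. \<Lambda> (\<lambda>x. gaussian x * (a * f x)) = a * \<Lambda> (\<lambda>x. gaussian x * f x)}" (is "_ \<in> ?C")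
    proof (rule \<Lambda>)
      have "L n (\<lambda>x. gaussian x * (a * f x)) = a * L n (\<lambda>x. gaussian x * f x)" for n
        using f integrable_mult_right[OF f, of a] integral_mult_right_zero[of lborel a "\<lambda>x. gaussian x * f x * \<phi> n x"]
        by (simp add: Lint mult_ac)
      then show "\<forall>\<^sub>F n in sequentially. L n \<in> ?C" by simp
    qed (intro closed_Collect_eq continuous_intros continuous_on_product_coordinates)
    then show "\<Lambda> (\<lambda>x. gaussian x * (a * f x)) = a * \<Lambda> (\<lambda>x. gaussian x * f x)"
      by simp
  next
    fix f :: "'a \<Rightarrow> real" assume f: "integrable ?M f" and f0: "\<And>x. 0 \<le> f x"
    then have fl: "integrable lborel (\<lambda>x. gaussian x * f x)" by (auto simp: intM)
    have "\<Lambda> \<in> {\<Lambda>. 0 \<le> \<Lambda> (\<lambda>x. gaussian x * f x)}" (is "_ \<in> ?C")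
    proof (rule \<Lambda>)
      have "0 \<le> L n (\<lambda>x. gaussian x * f x)" for n
        unfolding Lint[OF fl] using f0 g0 rng by (intro integral_nonneg_AE AE_I2) simp
      then show "\<forall>\<^sub>F n in sequentially. L n \<in> ?C" by simp
    qed (intro closed_Collect_le continuous_intros continuous_on_product_coordinates)
    then show "0 \<le> \<Lambda> (\<lambda>x. gaussian x * f x)" by simp
    have "\<Lambda> \<in> {\<Lambda>. \<Lambda> (\<lambda>x. gaussian x * f x) \<le> c * (LINT x|lborel. gaussian x * f x)}" (is "_ \<in> ?C")
    proof (rule \<Lambda>)
      have "L n (\<lambda>x. gaussian x * f x) \<le> c * (LINT x|lborel. gaussian x * f x)" for n
        unfolding Lint[OF fl] integral_mult_right_zero[symmetric]
      proof (rule integral_mono)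
        show "integrable lborel (\<lambda>x. gaussian x * f x * \<phi> n x)" by (rule intp[OF fl meas rng])
        show "integrable lborel (\<lambda>x. c * (gaussian x * f x))" by (rule integrable_mult_right[OF fl])
        show "gaussian x * f x * \<phi> n x \<le> c * (gaussian x * f x)" for x
          using rng[of n x] g0[of x] f0[of x] mult_left_mono[of "\<phi> n x" c "gaussian x * f x"]
          by (simp add: mult_ac)
      qed
      then show "\<forall>\<^sub>F n in sequentially. L n \<in> ?C" by simp
    qed (intro closed_Collect_le continuous_intros continuous_on_product_coordinates)
    moreover have "(LINT x|?M. f x) = (LINT x|lborel. gaussian x * f x)"
      using f by (subst integral_density) (auto simp: g0 intM)
    ultimately show "\<Lambda> (\<lambda>x. gaussian x * f x) \<le> c * (LINT x|?M. f x)" by simp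
  qed
  then obtain \<psi> where "\<psi> \<in> borel_measurable ?M" and \<psi>r: "range \<psi> \<subseteq> {0..c}"
    and \<psi>: "\<And>f. integrable ?M f \<Longrightarrow> \<Lambda> (\<lambda>x. gaussian x * f x) = (LINT x|?M. f x * \<psi> x)" by blast
  then have \<psi>m[measurable]: "\<psi> \<in> borel_measurable borel" by simp
  have \<psi>c: "\<psi> x \<in> {0..c}" for x using \<psi>r by blast
  have rep: "\<Lambda> h = (LINT x|lborel. h x * \<psi> x)" if h: "integrable lborel h" for h
  proof -
    have [measurable]: "h \<in> borel_measurable borel" using h by auto
    have eq: "gaussian x * (h x / gaussian x) = h x" for x
      using gaussian_pos[of x] by simp
    have "integrable ?M (\<lambda>x. h x / gaussian x)" unfolding intM eq by (intro conjI h) measurable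
    from \<psi>[OF this] have "\<Lambda> h = (LINT x|?M. h x / gaussian x * \<psi> x)" by (simp only: eq)
    also have "\<dots> = (LINT x|lborel. gaussian x * (h x / gaussian x * \<psi> x))"
      by (subst integral_density) (auto simp: g0)
    also have "\<dots> = (LINT x|lborel. h x * \<psi> x)" by (simp only: mult.assoc[symmetric] eq)
    finally show ?thesis .
  qed
  have real: "(LINT x|lborel. h x * \<psi> x) = l"
    if h: "integrable lborel h" and lim: "(\<lambda>n. LINT x|lborel. h x * \<phi> n x) \<longlonglongrightarrow> l" for h l
  proof -
    have "\<bar>\<Lambda> h - l\<bar> \<le> e" if "e > 0" for e
    proof -
      have "\<Lambda> \<in> {\<Lambda>. \<bar>\<Lambda> h - l\<bar> \<le> e}"
      proof (rule \<Lambda>)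
        from tendstoD[OF lim \<open>e > 0\<close>]
        show "\<forall>\<^sub>F n in sequentially. L n \<in> {\<Lambda>. \<bar>\<Lambda> h - l\<bar> \<le> e}"
          by eventually_elim (simp add: Lint[OF h] dist_real_def)
      qed (intro closed_Collect_le continuous_intros continuous_on_product_coordinates)
      then show ?thesis by simp
    qed
    from this[of "\<bar>\<Lambda> h - l\<bar> / 2"] have "\<Lambda> h = l" by (cases "\<Lambda> h = l") auto
    then show ?thesis using rep[OF h] by simp
  qed
  have parts: "Re (LINT x|lborel. h x * complex_of_real (p x)) = (LINT x|lborel. Re (h x) * p x)"
    "Im (LINT x|lborel. h x * complex_of_real (p x)) = (LINT x|lborel. Im (h x) * p x)"
    if h: "integrable lborel h" and p: "p \<in> borel_measurable borel" "\<And>x. p x \<in> {0..c}" for h :: "'a \<Rightarrow> complex" and p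
  proof -
    have "integrable lborel (\<lambda>x. h x * complex_of_real (p x))"
    proof (rule Bochner_Integration.integrable_bound[OF integrable_mult_left[OF h, of "complex_of_real c"]])
      show "AE x in lborel. norm (h x * complex_of_real (p x)) \<le> norm (h x * complex_of_real c)"
        using p(2) c by (intro AE_I2) (auto simp: norm_mult intro!: mult_left_mono)
      show "(\<lambda>x. h x * complex_of_real (p x)) \<in> borel_measurable lborel"
        using borel_measurable_integrable[OF h] p(1) by simp
    qed
    from integral_Re[OF this] integral_Im[OF this]
    show "Re (LINT x|lborel. h x * complex_of_real (p x)) = (LINT x|lborel. Re (h x) * p x)"
      "Im (LINT x|lborel. h x * complex_of_real (p x)) = (LINT x|lborel. Im (h x) * p x)" by simp_all
  qed
  show thesis
  proof (rule that[OF \<psi>m \<psi>r])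
    fix h :: "'a \<Rightarrow> complex" and l
    assume h: "integrable lborel h" and lim: "(\<lambda>n. LINT x|lborel. h x * complex_of_real (\<phi> n x)) \<longlonglongrightarrow> l"
    have "(LINT x|lborel. Re (h x) * \<psi> x) = Re l"
      by (rule real) (use h tendsto_Re[OF lim] in \<open>simp_all add: parts[OF h meas rng]\<close>)
    moreover have "(LINT x|lborel. Im (h x) * \<psi> x) = Im l"
      by (rule real) (use h tendsto_Im[OF lim] in \<open>simp_all add: parts[OF h meas rng]\<close>)
    ultimately show "(LINT x|lborel. h x * complex_of_real (\<psi> x)) = l"
      by (simp add: complex_eq_iff parts[OF h \<psi>m \<psi>c])
  qed
qed

section \<open>Complex differentiability over a Euclidean space\<close>

text \<open>
  The pair \<open>(a, b)\<close> stands for \<open>a + ib\<close>, so that multiplication by \<open>i\<close> is \<open>(a, b) \<mapsto> (- b, a)\<close>.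
\<close>

definition cdiff :: "('a::euclidean_space \<times> 'a \<Rightarrow> complex) \<Rightarrow> 'a \<times> 'a \<Rightarrow> bool" where
  "cdiff f p \<longleftrightarrow> (\<exists>D. (f has_derivative D) (at p) \<and> (\<forall>a b. D (- b, a) = \<i> * D (a, b)))"

lemma cdiff_const: "cdiff (\<lambda>p. c) p"
  unfolding cdiff_def by (intro exI[of _ "\<lambda>_. 0"]) auto

lemma cdiff_mult:
  assumes "cdiff f p" "cdiff g p"
  shows "cdiff (\<lambda>q. f q * g q) p"
proof -
  from assms obtain D E where D: "(f has_derivative D) (at p)" "\<And>a b. D (- b, a) = \<i> * D (a, b)"
    and E: "(g has_derivative E) (at p)" "\<And>a b. E (- b, a) = \<i> * E (a, b)"
    unfolding cdiff_def by blast
  show ?thesis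
    unfolding cdiff_def
    by (intro exI[of _ "\<lambda>h. f p * E h + D h * g p"] conjI has_derivative_mult D E)
       (simp add: D E algebra_simps)
qed

lemma cdiff_add:
  assumes "cdiff f p" "cdiff g p"
  shows "cdiff (\<lambda>q. f q + g q) p"
proof -
  from assms obtain D E where D: "(f has_derivative D) (at p)" "\<And>a b. D (- b, a) = \<i> * D (a, b)"
    and E: "(g has_derivative E) (at p)" "\<And>a b. E (- b, a) = \<i> * E (a, b)"
    unfolding cdiff_def by blast
  show ?thesis
    unfolding cdiff_def
    by (intro exI[of _ "\<lambda>h. D h + E h"] conjI has_derivative_add D E)
       (simp add: D E algebra_simps)
qed

lemma cdiff_compose:
  assumes f: "cdiff f p" and h: "(h has_field_derivative h') (at (f p))"
  shows "cdiff (\<lambda>q. h (f q)) p"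
proof -
  from f obtain D where D: "(f has_derivative D) (at p)" "\<And>a b. D (- b, a) = \<i> * D (a, b)"
    unfolding cdiff_def by blast
  show ?thesis
    unfolding cdiff_def
    by (intro exI[of _ "\<lambda>v. h' * D v"] conjI has_derivative_compose[OF D(1) h[unfolded has_field_derivative_def]])
       (simp add: D)
qed

lemma cdiff_affine:
  assumes "cdiff f (c *\<^sub>R p + v)"
  shows "cdiff (\<lambda>q. f (c *\<^sub>R q + v)) p"
proof -
  from assms obtain D where D: "(f has_derivative D) (at (c *\<^sub>R p + v))" "\<And>a b. D (- b, a) = \<i> * D (a, b)"
    unfolding cdiff_def by blast
  have g: "((\<lambda>q. c *\<^sub>R q + v) has_derivative (\<lambda>h. c *\<^sub>R h)) (at p)"
    by (auto intro!: derivative_eq_intros)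
  interpret bounded_linear D using D(1) by (rule has_derivative_bounded_linear)
  show ?thesis
    unfolding cdiff_def
  proof (intro exI conjI)
    show "((\<lambda>q. f (c *\<^sub>R q + v)) has_derivative (\<lambda>h. D (c *\<^sub>R h))) (at p)"
      by (rule has_derivative_compose[OF g D(1)])
    show "\<forall>a b. D (c *\<^sub>R (- b, a)) = \<i> * D (c *\<^sub>R (a, b))"
      unfolding scaleR by (simp only: D(2) mult_scaleR_right) simp
  qed
qed

lemma cdiff_isCont: "cdiff f p \<Longrightarrow> isCont f p"
  unfolding cdiff_def by (auto dest: has_derivative_continuous)

lemma cdiff_exp_inner: "cdiff (\<lambda>q. exp (\<i> * Complex (fst q \<bullet> u) (snd q \<bullet> u))) p"
proof (rule cdiff_compose[OF _ DERIV_exp])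
  have eq: "\<i> * Complex (fst q \<bullet> u) (snd q \<bullet> u) = \<i> * complex_of_real (fst q \<bullet> u) - complex_of_real (snd q \<bullet> u)" for q :: "'a \<times> 'a"
    by (simp add: complex_eq_iff)
  show "cdiff (\<lambda>q. \<i> * Complex (fst q \<bullet> u) (snd q \<bullet> u)) p"
    unfolding cdiff_def eq
  proof (intro exI conjI)
    show "((\<lambda>q. \<i> * complex_of_real (fst q \<bullet> u) - complex_of_real (snd q \<bullet> u)) has_derivative
        (\<lambda>h. \<i> * complex_of_real (fst h \<bullet> u) - complex_of_real (snd h \<bullet> u))) (at p)"
      by (auto intro!: derivative_eq_intros)
  qed (simp add: algebra_simps)
qed

lemma cdiff_along_complex_line:
  assumes "cdiff f (x + Re w *\<^sub>R v, y + Im w *\<^sub>R v)"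
  shows "(\<lambda>w. f (x + Re w *\<^sub>R v, y + Im w *\<^sub>R v)) field_differentiable (at w within A)"
proof -
  from assms obtain D where D: "(f has_derivative D) (at (x + Re w *\<^sub>R v, y + Im w *\<^sub>R v))"
    "\<And>a b. D (- b, a) = \<i> * D (a, b)" unfolding cdiff_def by blast
  interpret D: bounded_linear D using D(1) by (rule has_derivative_bounded_linear)
  have g: "((\<lambda>w. (x + Re w *\<^sub>R v, y + Im w *\<^sub>R v)) has_derivative (\<lambda>h. (Re h *\<^sub>R v, Im h *\<^sub>R v))) (at w)"
    by (auto intro!: derivative_eq_intros)
  have "D (Re h *\<^sub>R v, Im h *\<^sub>R v) = D (v, 0) * h" for h
  proof -
    have "D (Re h *\<^sub>R v, Im h *\<^sub>R v) = D (Re h *\<^sub>R (v, 0) + Im h *\<^sub>R (0, v))" by simp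
    also have "\<dots> = Re h *\<^sub>R D (v, 0) + Im h *\<^sub>R D (0, v)" by (simp only: D.add D.scaleR)
    also have "D (0, v) = \<i> * D (v, 0)" using D(2)[of 0 v] by simp
    also have "Re h *\<^sub>R D (v, 0) + Im h *\<^sub>R (\<i> * D (v, 0)) = D (v, 0) * h"
      by (simp add: complex_eq_iff)
    finally show ?thesis .
  qed
  with has_derivative_compose[OF g D(1)]
  have "((\<lambda>w. f (x + Re w *\<^sub>R v, y + Im w *\<^sub>R v)) has_field_derivative D (v, 0)) (at w)"
    by (simp add: has_field_derivative_def)
  then show ?thesis
    by (meson field_differentiable_def has_field_derivative_at_within)
qed

section \<open>Shifting the contour in a tube\<close>

lemma continuous_on_square_linepath:
  fixes \<phi> :: "complex \<Rightarrow> complex"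
  assumes "continuous_on (cbox 0 (Complex 1 1)) \<phi>" "a \<in> cbox 0 (Complex 1 1)" "b \<in> cbox 0 (Complex 1 1)"
  shows "continuous_on (closed_segment a b) \<phi>"
  by (rule continuous_on_subset[OF assms(1)]) (simp add: assms closed_segment_subset)

text \<open>The four integrals are the sides of the square in the contour integral of Cauchy's theorem.\<close>

lemma unit_square_integral:
  fixes \<phi> :: "complex \<Rightarrow> complex"
  assumes hol: "\<phi> holomorphic_on cbox 0 (Complex 1 1)"
  shows "(LINT s:{0..1}|lborel. \<phi> (complex_of_real s)) - (LINT s:{0..1}|lborel. \<phi> (Complex s 1))
    + \<i> * ((LINT s:{0..1}|lborel. \<phi> (Complex 1 s)) - (LINT s:{0..1}|lborel. \<phi> (Complex 0 s))) = 0"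
proof -
  let ?Q = "cbox 0 (Complex 1 1)"
  have cont: "continuous_on ?Q \<phi>" using hol by (rule holomorphic_on_imp_continuous_on)
  note seg = continuous_on_square_linepath[OF cont]
  have unit: "Complex 1 0 = 1" "Complex 0 1 = \<i>" by (simp_all add: complex_eq_iff)
  have corners: "0 \<in> ?Q" "1 \<in> ?Q" "Complex 1 1 \<in> ?Q" "\<i> \<in> ?Q"
    by (simp_all add: in_cbox_complex_iff)
  have lin: "contour_integral (linepath a b) \<phi> = (b - a) * (LINT s:{0..1}|lborel. \<phi> (linepath a b s))"
    if "a \<in> ?Q" "b \<in> ?Q" for a b
  proof -
    have c: "continuous_on {0..1} (\<lambda>s. \<phi> (linepath a b s))"
      using seg[OF that] by (intro continuous_on_compose2[OF seg[OF that]] continuous_on_linepath)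
        (auto simp: linepath_in_path)
    have "contour_integral (linepath a b) \<phi> = integral {0..1} (\<lambda>s. \<phi> (linepath a b s) * (b - a))"
      by (simp add: contour_integral_integral)
    also have "\<dots> = integral {0..1} (\<lambda>s. \<phi> (linepath a b s)) * (b - a)"
      by (rule integral_mult_left)
    also have "integral {0..1} (\<lambda>s. \<phi> (linepath a b s)) = (LINT s:{0..1}|lborel. \<phi> (linepath a b s))"
      by (rule set_borel_integral_eq_integral(2)[symmetric])
         (rule borel_integrable_atLeastAtMost', rule c)
    finally show ?thesis by (simp add: mult.commute)
  qed
  have "(\<phi> has_contour_integral 0) (rectpath 0 (Complex 1 1))"
    by (rule Cauchy_theorem_convex_simple[OF hol])
       (use path_image_rectpath_subset_cbox[of 0 "Complex 1 1"] in auto)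
  then have "0 = contour_integral (rectpath 0 (Complex 1 1)) \<phi>"
    by (simp add: contour_integral_unique)
  also have "rectpath 0 (Complex 1 1) =
      linepath 0 1 +++ linepath 1 (Complex 1 1) +++ linepath (Complex 1 1) \<i> +++ linepath \<i> 0"
    by (simp add: rectpath_def Let_def unit)
  also have "contour_integral \<dots> \<phi> = contour_integral (linepath 0 1) \<phi> + contour_integral (linepath 1 (Complex 1 1)) \<phi>
      + contour_integral (linepath (Complex 1 1) \<i>) \<phi> + contour_integral (linepath \<i> 0) \<phi>"
    using corners by (simp add: contour_integrable_continuous_linepath seg contour_integrable_joinI)
  also have "contour_integral (linepath (Complex 1 1) \<i>) \<phi> = - contour_integral (linepath \<i> (Complex 1 1)) \<phi>"
    by (rule contour_integral_reverse_linepath) (rule seg, simp_all add: corners)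
  also have "contour_integral (linepath \<i> 0) \<phi> = - contour_integral (linepath 0 \<i>) \<phi>"
    by (rule contour_integral_reverse_linepath) (rule seg, simp_all add: corners)
  finally have "0 = (1 - 0) * (LINT s:{0..1}|lborel. \<phi> (linepath 0 1 s))
      + (Complex 1 1 - 1) * (LINT s:{0..1}|lborel. \<phi> (linepath 1 (Complex 1 1) s))
      + - ((Complex 1 1 - \<i>) * (LINT s:{0..1}|lborel. \<phi> (linepath \<i> (Complex 1 1) s)))
      + - ((\<i> - 0) * (LINT s:{0..1}|lborel. \<phi> (linepath 0 \<i> s)))"
    by (simp only: lin corners)
  moreover have "linepath 0 1 s = complex_of_real s" "linepath 1 (Complex 1 1) s = Complex 1 s"
    "linepath \<i> (Complex 1 1) s = Complex s 1" "linepath 0 \<i> s = Complex 0 s" for s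
    by (simp_all add: linepath_def complex_eq_iff)
  moreover have "Complex 1 1 - 1 = \<i>" "Complex 1 1 - \<i> = 1" by (simp_all add: complex_eq_iff)
  ultimately show ?thesis by (simp add: algebra_simps)
qed

lemma integral_over_path_of_slices:
  fixes f :: "'a::euclidean_space \<times> 'a \<Rightarrow> complex" and P :: "real \<Rightarrow> 'a" and r :: "real \<Rightarrow> real"
  assumes cont: "\<And>x s. 0 \<le> s \<Longrightarrow> s \<le> 1 \<Longrightarrow> isCont f (x, y + s *\<^sub>R v)"
    and int: "\<And>s. 0 \<le> s \<Longrightarrow> s \<le> 1 \<Longrightarrow> integrable lborel (\<lambda>x. f (x, y + s *\<^sub>R v))"
    and bound: "\<And>s. 0 \<le> s \<Longrightarrow> s \<le> 1 \<Longrightarrow> (LINT x|lborel. norm (f (x, y + s *\<^sub>R v))) \<le> M"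
    and P: "continuous_on {0..1} P" and r: "continuous_on {0..1} r" "\<And>s. 0 \<le> s \<Longrightarrow> s \<le> 1 \<Longrightarrow> r s \<in> {0..1}"
  shows "integrable lborel (\<lambda>x. LINT s:{0..1}|lborel. f (x + P s, y + r s *\<^sub>R v))"
    and "(LINT x|lborel. (LINT s:{0..1}|lborel. f (x + P s, y + r s *\<^sub>R v))) =
       (LINT s:{0..1}|lborel. LINT x|lborel. f (x, y + r s *\<^sub>R v))"
proof -
  let ?F = "\<lambda>(s::real, x). indicator {0..1} s *\<^sub>R f (x + P s, y + r s *\<^sub>R v)"
  have contF: "continuous_on ({0..1} \<times> UNIV) (\<lambda>(s, x). f (x + P s, y + r s *\<^sub>R v))"
    unfolding case_prod_beta
  proof (rule continuous_on_compose2[where g=f and t="{(x, y + s *\<^sub>R v) | x s. 0 \<le> s \<and> s \<le> 1}"])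
    show "continuous_on {(x, y + s *\<^sub>R v) |x s. 0 \<le> s \<and> s \<le> 1} f"
      using cont by (intro continuous_at_imp_continuous_on) auto
    show "continuous_on ({0..1} \<times> UNIV) (\<lambda>q. (snd q + P (fst q), y + r (fst q) *\<^sub>R v))"
      by (intro continuous_intros continuous_on_compose2[OF P] continuous_on_compose2[OF r(1)]) auto
  qed (use r(2) in fastforce)
  have m: "?F \<in> borel_measurable (lborel \<Otimes>\<^sub>M (lborel :: 'a measure))"
  proof -
    have "(\<lambda>q. indicator ({0..1} \<times> UNIV) q *\<^sub>R (case q of (s, x) \<Rightarrow> f (x + P s, y + r s *\<^sub>R v)))
        \<in> borel_measurable (borel :: (real \<times> 'a) measure)"
      by (rule borel_measurable_continuous_on_indicator[OF _ contF]) (simp add: borel_closed closed_Times)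
    moreover have "(\<lambda>q. indicator ({0..1} \<times> UNIV) q *\<^sub>R (case q of (s, x) \<Rightarrow> f (x + P s, y + r s *\<^sub>R v))) = ?F"
      by (auto simp: fun_eq_iff indicator_def)
    ultimately show ?thesis by (simp add: lborel_prod)
  qed
  have slice: "integrable lborel (\<lambda>x. f (x + P s, y + r s *\<^sub>R v))"
    "(LINT x|lborel. norm (f (x + P s, y + r s *\<^sub>R v))) \<le> M"
    "(LINT x|lborel. f (x + P s, y + r s *\<^sub>R v)) = (LINT x|lborel. f (x, y + r s *\<^sub>R v))"
    if s: "0 \<le> s" "s \<le> 1" for s
  proof -
    from r(2)[OF s] have rs: "0 \<le> r s" "r s \<le> 1" by auto
    have mm: "(\<lambda>x. f (x, y + r s *\<^sub>R v)) \<in> borel_measurable borel" using int[OF rs] by auto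
    show "integrable lborel (\<lambda>x. f (x + P s, y + r s *\<^sub>R v))"
      using lborel_integral_shift(2)[OF mm, of "P s"] int[OF rs] by simp
    show "(LINT x|lborel. norm (f (x + P s, y + r s *\<^sub>R v))) \<le> M"
      using lborel_integral_shift(1)[of "\<lambda>x. norm (f (x, y + r s *\<^sub>R v))" "P s"] mm bound[OF rs] by simp
    show "(LINT x|lborel. f (x + P s, y + r s *\<^sub>R v)) = (LINT x|lborel. f (x, y + r s *\<^sub>R v))"
      using lborel_integral_shift(1)[OF mm, of "P s"] by simp
  qed
  have I: "integrable (lborel \<Otimes>\<^sub>M (lborel :: 'a measure)) ?F"
  proof (rule lborel_pair.Fubini_integrable[OF m])
    show "integrable lborel (\<lambda>s. LINT x|lborel. norm (?F (s, x)))"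
    proof (rule Bochner_Integration.integrable_bound[where f="\<lambda>s::real. indicator {0..1} s * M"])
      show "integrable lborel (\<lambda>s::real. indicator {0..1} s * M)"
        by (intro integrable_mult_left integrable_real_indicator) auto
      show "(\<lambda>s. LINT x|lborel. norm (?F (s, x))) \<in> borel_measurable lborel"
        using measurable_compose[OF m borel_measurable_norm]
        by (intro lborel.borel_measurable_lebesgue_integral) (simp only: case_prod_beta' fst_conv snd_conv)
      show "AE s in lborel. norm (LINT x|lborel. norm (?F (s, x))) \<le> norm (indicator {0..1} s * M)"
      proof (rule AE_I2)
        fix s :: real
        show "norm (LINT x|lborel. norm (?F (s, x))) \<le> norm (indicator {0..1} s * M)"
          using slice(2)[of s] by (cases "s \<in> {0..1}") auto
      qed
    qed
    show "AE s in lborel. integrable lborel (\<lambda>x. ?F (s, x))"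
    proof (rule AE_I2)
      fix s :: real
      show "integrable lborel (\<lambda>x. ?F (s, x))"
        using slice(1)[of s] by (cases "s \<in> {0..1}") auto
    qed
  qed
  show "integrable lborel (\<lambda>x. LINT s:{0..1}|lborel. f (x + P s, y + r s *\<^sub>R v))"
    using lborel_pair.integrable_snd[OF I] by (simp add: set_lebesgue_integral_def)
  have "(LINT x|lborel. LINT s|lborel. ?F (s, x)) = (LINT s|lborel. LINT x|lborel. ?F (s, x))"
    using lborel_pair.Fubini_integral[OF I] by simp
  also have "\<dots> = (LINT s|lborel. indicator {0..1} s *\<^sub>R (LINT x|lborel. f (x, y + r s *\<^sub>R v)))"
  proof (rule Bochner_Integration.integral_cong[OF refl])
    fix s :: real
    show "(LINT x|lborel. ?F (s, x)) = indicator {0..1} s *\<^sub>R (LINT x|lborel. f (x, y + r s *\<^sub>R v))"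
      using slice(3)[of s] by (cases "s \<in> {0..1}") auto
  qed
  finally show "(LINT x|lborel. (LINT s:{0..1}|lborel. f (x + P s, y + r s *\<^sub>R v))) =
       (LINT s:{0..1}|lborel. LINT x|lborel. f (x, y + r s *\<^sub>R v))"
    by (simp add: set_lebesgue_integral_def)
qed

text \<open>By translation invariance, the integral over a horizontal slice equals its average over the
translates by \<open>s v\<close> with \<open>0 \<le> s \<le> 1\<close>. On each complex line \<open>x + w v\<close> Cauchy's theorem for the unit square
compares the lower with the upper side; after integration over \<open>x\<close> the two vertical sides cancel,
again by translation invariance. Hence bounds on the \<open>L\<^sup>1\<close> norms of the slices suffice.\<close>

lemma contour_shift:
  fixes f :: "'a::euclidean_space \<times> 'a \<Rightarrow> complex"
  assumes cd: "\<And>x s. 0 \<le> s \<Longrightarrow> s \<le> 1 \<Longrightarrow> cdiff f (x, y + s *\<^sub>R v)"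
    and int: "\<And>s. 0 \<le> s \<Longrightarrow> s \<le> 1 \<Longrightarrow> integrable lborel (\<lambda>x. f (x, y + s *\<^sub>R v))"
    and bound: "\<And>s. 0 \<le> s \<Longrightarrow> s \<le> 1 \<Longrightarrow> (LINT x|lborel. norm (f (x, y + s *\<^sub>R v))) \<le> M"
  shows "(LINT x|lborel. f (x, y)) = (LINT x|lborel. f (x, y + v))"
proof -
  define J where "J P r x = (LINT s:{0..1}|lborel. f (x + P s, y + r s *\<^sub>R v))"
    for P :: "real \<Rightarrow> 'a" and r :: "real \<Rightarrow> real" and x
  have avg: "integrable lborel (J P r)"
    "integral\<^sup>L lborel (J P r) = (LINT s:{0..1}|lborel. LINT x|lborel. f (x, y + r s *\<^sub>R v))"
    if "continuous_on {0..1} P" "continuous_on {0..1} r" "\<And>s. 0 \<le> s \<Longrightarrow> s \<le> 1 \<Longrightarrow> r s \<in> {0..1}" for P r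
    using integral_over_path_of_slices[of y v f M P r] cdiff_isCont[OF cd] int bound that
    by (simp_all add: J_def[abs_def])
  let ?B = "J (\<lambda>s. s *\<^sub>R v) (\<lambda>s. 0)" and ?T = "J (\<lambda>s. s *\<^sub>R v) (\<lambda>s. 1)"
  let ?R = "J (\<lambda>s. v) (\<lambda>s. s)" and ?L = "J (\<lambda>s. 0) (\<lambda>s. s)"
  have cs: "continuous_on {0..1::real} (\<lambda>s. s *\<^sub>R v)" by (intro continuous_intros)
  note B = avg[OF cs continuous_on_const, of 0, simplified]
    and T = avg[OF cs continuous_on_const, of 1, simplified]
    and R = avg[OF continuous_on_const continuous_on_id, of v, simplified]
    and L = avg[OF continuous_on_const continuous_on_id, of 0, simplified]
  have zero: "?B x - ?T x + \<i> * (?R x - ?L x) = 0" for x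
  proof -
    have "(\<lambda>w. f (x + Re w *\<^sub>R v, y + Im w *\<^sub>R v)) holomorphic_on cbox 0 (Complex 1 1)"
      unfolding holomorphic_on_def
      by (intro ballI cdiff_along_complex_line cd) (auto simp: in_cbox_complex_iff)
    from unit_square_integral[OF this] show ?thesis by (simp add: J_def)
  qed
  have "(LINT x|lborel. ?B x - ?T x + \<i> * (?R x - ?L x)) =
      integral\<^sup>L lborel ?B - integral\<^sup>L lborel ?T + \<i> * (integral\<^sup>L lborel ?R - integral\<^sup>L lborel ?L)"
    using B(1) T(1) R(1) L(1) by simp
  then have "integral\<^sup>L lborel ?B = integral\<^sup>L lborel ?T"
    unfolding zero R(2) L(2) by simp
  then show ?thesis
    unfolding B(2) T(2) by (simp add: set_lebesgue_integral_def)
qed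

section \<open>Differentiation under the integral sign\<close>

text \<open>A remainder that is quadratic in \<open>h\<close>, with a constant that is integrable in \<open>u\<close>, stays quadratic after
integration over \<open>u\<close>.\<close>

lemma has_derivative_integral_quadratic:
  fixes f :: "'b::real_normed_vector \<Rightarrow> 'u \<Rightarrow> complex"
  assumes r: "0 < r" and g: "integrable M g"
    and f: "\<And>h. norm h < r \<Longrightarrow> integrable M (f (z + h))"
    and Dm: "\<And>h. D h \<in> borel_measurable M"
    and lin: "\<And>u. u \<in> space M \<Longrightarrow> linear (\<lambda>h. D h u)"
    and Db: "\<And>h u. u \<in> space M \<Longrightarrow> norm (D h u) \<le> g u * norm h"
    and quad: "\<And>h u. u \<in> space M \<Longrightarrow> norm h < r \<Longrightarrow> norm (f (z + h) u - f z u - D h u) \<le> g u * (norm h)\<^sup>2"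
  shows "((\<lambda>z. LINT u|M. f z u) has_derivative (\<lambda>h. LINT u|M. D h u)) (at z)"
proof -
  have Di: "integrable M (D h)" for h
  proof (rule Bochner_Integration.integrable_bound[OF integrable_mult_left[OF g, of "norm h"] Dm])
    show "AE u in M. norm (D h u) \<le> norm (g u * norm h)"
      using Db by (intro AE_I2) (fastforce intro: order_trans[OF _ abs_ge_self])
  qed
  let ?G = "LINT u|M. g u"
  have bl: "bounded_linear (\<lambda>h. LINT u|M. D h u)"
  proof (rule bounded_linear_intro)
    fix x y
    have "(LINT u|M. D (x + y) u) = (LINT u|M. D x u + D y u)"
      by (intro Bochner_Integration.integral_cong) (auto simp: linear_add[OF lin])
    then show "(LINT u|M. D (x + y) u) = (LINT u|M. D x u) + (LINT u|M. D y u)"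
      using Di by simp
  next
    fix c :: real and x
    have "(LINT u|M. D (c *\<^sub>R x) u) = (LINT u|M. c *\<^sub>R D x u)"
      by (intro Bochner_Integration.integral_cong) (auto simp: linear_scale[OF lin])
    then show "(LINT u|M. D (c *\<^sub>R x) u) = c *\<^sub>R (LINT u|M. D x u)"
      by simp
  next
    fix x
    have "norm (LINT u|M. D x u) \<le> (LINT u|M. norm (D x u))" by (rule integral_norm_bound)
    also have "\<dots> \<le> (LINT u|M. norm x * g u)"
      using Db by (intro integral_mono integrable_norm Di integrable_mult_right g) (simp add: mult.commute)
    finally show "norm (LINT u|M. D x u) \<le> norm x * ?G" by simp
  qed
  have rem: "norm ((LINT u|M. f (z + h) u) - (LINT u|M. f z u) - (LINT u|M. D h u)) \<le> ?G * (norm h)\<^sup>2"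
    if h: "norm h < r" for h
  proof -
    have i: "integrable M (f (z + h))" "integrable M (f z)" using f[OF h] f[of 0] r by auto
    then have "(LINT u|M. f (z + h) u) - (LINT u|M. f z u) - (LINT u|M. D h u) =
        (LINT u|M. f (z + h) u - f z u - D h u)"
      using Di by simp
    also have "norm \<dots> \<le> (LINT u|M. norm (f (z + h) u - f z u - D h u))" by (rule integral_norm_bound)
    also have "\<dots> \<le> (LINT u|M. g u * (norm h)\<^sup>2)"
      using quad h i Di g by (intro integral_mono integrable_norm integrable_mult_left) auto
    finally show ?thesis by simp
  qed
  show ?thesis
    unfolding has_derivative_at
  proof (intro conjI bl)
    show "(\<lambda>h. norm ((LINT u|M. f (z + h) u) - (LINT u|M. f z u) - (LINT u|M. D h u)) / norm h) \<midarrow>0\<rightarrow> 0"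
    proof (rule Lim_null_comparison)
      have "\<forall>\<^sub>F h in at 0. norm h < r"
        using r by (auto simp: eventually_at dist_norm)
      then show "\<forall>\<^sub>F h in at 0. norm (norm ((LINT u|M. f (z + h) u) - (LINT u|M. f z u) - (LINT u|M. D h u)) / norm h)
          \<le> ?G * norm h"
      proof eventually_elim
        case (elim h)
        show ?case
        proof (cases "h = 0")
          case False
          then show ?thesis using rem[OF elim] by (simp add: divide_le_eq power2_eq_square mult.assoc)
        qed simp
      qed
      have "((\<lambda>h::'b. ?G * norm h) \<longlongrightarrow> ?G * norm (0::'b)) (at 0)" by (intro tendsto_intros)
      then show "((\<lambda>h. ?G * norm h) \<longlongrightarrow> 0) (at (0::'b))" by simp
    qed
  qed
qed

section \<open>Exponential integrals over the polar cone\<close>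

lemma integrable_exp_abs: "integrable lborel (\<lambda>x::real. exp (- (c * \<bar>x\<bar>)))" if c: "c > 0" for c
proof -
  have p: "integrable lborel (\<lambda>x::real. indicator {0<..} x *\<^sub>R exp (- (x * c)))"
    using integrable_I0i_exp_mscale[OF c] by (simp add: set_integrable_def)
  have n: "integrable lborel (\<lambda>x::real. indicator {0<..} (0 - x) *\<^sub>R exp (- ((0 - x) * c)))"
    using lborel_integral_reflect(2)[of "\<lambda>x::real. indicator {0<..} x *\<^sub>R exp (- (x * c))" 0] p by simp
  have z: "integrable lborel (\<lambda>x::real. indicator {0} x *\<^sub>R (1::real))"
    by simp
  have "exp (- (c * \<bar>x\<bar>)) = indicator {0<..} x *\<^sub>R exp (- (x * c)) +
      indicator {0<..} (0 - x) *\<^sub>R exp (- ((0 - x) * c)) + indicator {0} x *\<^sub>R (1::real)" for x :: real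
    by (auto simp: indicator_def mult.commute)
  then show ?thesis using p n z by simp
qed

lemma integrable_exp_norm:
  assumes c: "c > 0"
  shows "integrable lborel (\<lambda>u::'a::euclidean_space. exp (- (c * norm u)))"
proof (rule Bochner_Integration.integrable_bound)
  let ?c = "c / DIM('a)"
  have c': "?c > 0" using c by simp
  show "integrable lborel (\<lambda>u::'a. \<Prod>b\<in>Basis. exp (- (?c * \<bar>u \<bullet> b\<bar>)))"
    by (rule lborel_basis_product(1)) (rule integrable_exp_abs[OF c'])
  show "AE u::'a in lborel. norm (exp (- (c * norm u))) \<le> norm (\<Prod>b\<in>Basis. exp (- (?c * \<bar>u \<bullet> b\<bar>)))"
  proof (rule AE_I2)
    fix u :: 'a
    have "(\<Sum>b\<in>Basis. ?c * \<bar>u \<bullet> b\<bar>) \<le> (\<Sum>b\<in>(Basis::'a set). ?c * norm u)"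
      using c' by (intro sum_mono mult_left_mono Basis_le_norm) auto
    also have "\<dots> = c * norm u" by simp
    finally have "exp (- (c * norm u)) \<le> exp (\<Sum>b\<in>Basis. - (?c * \<bar>u \<bullet> b\<bar>))"
      by (simp add: sum_negf)
    also have "\<dots> = (\<Prod>b\<in>Basis. exp (- (?c * \<bar>u \<bullet> b\<bar>)))" by (rule exp_sum) simp
    finally show "norm (exp (- (c * norm u))) \<le> norm (\<Prod>b\<in>Basis. exp (- (?c * \<bar>u \<bullet> b\<bar>)))"
      by (simp add: prod_nonneg)
  qed
qed measurable

text \<open>With \<open>x = ct/4\<close> the claim reduces to \<open>x \<le> exp x\<close> and \<open>x\<^sup>2 \<le> 2 exp x\<close>. The polynomial is what
the remainder of the exponential series produces below.\<close>

lemma polynomial_exp_bound: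
  fixes c t :: real
  assumes c: "c > 0" and t: "0 \<le> t"
  shows "(4 * t\<^sup>2 + 2 * t) * exp (- (c / 2 * t)) \<le> (128 / c\<^sup>2 + 8 / c) * exp (- (c / 4 * t))"
proof -
  define x where "x = c / 4 * t"
  have x: "0 \<le> x" and tx: "t = 4 / c * x" using c t by (auto simp: x_def)
  have e: "1 + x + x\<^sup>2 / 2 \<le> exp x" by (rule exp_lower_Taylor_quadratic[OF x])
  then have "x\<^sup>2 \<le> 2 * exp x" "x \<le> exp x" using x zero_le_power2[of x] by linarith+
  then have "4 * t\<^sup>2 + 2 * t \<le> 4 * (4 / c)\<^sup>2 * (2 * exp x) + 2 * (4 / c) * exp x"
    unfolding tx power_mult_distrib using c by (intro add_mono) (auto simp: field_simps)
  also have "\<dots> = (128 / c\<^sup>2 + 8 / c) * exp x"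
    using c by (simp add: power2_eq_square field_simps)
  finally have "(4 * t\<^sup>2 + 2 * t) * exp (- (c / 2 * t)) \<le> (128 / c\<^sup>2 + 8 / c) * exp x * exp (- (c / 2 * t))"
    by (rule mult_right_mono) simp
  also have "\<dots> = (128 / c\<^sup>2 + 8 / c) * exp (- (c / 4 * t))"
    by (simp add: mult.assoc exp_add[symmetric] x_def)
  finally show ?thesis .
qed

text \<open>
  The Szego kernel depends on its arguments only through the difference of the first and the
  conjugate of the second; \<open>cone_kernel\<close> is that function of one point of the tube.
\<close>

definition cone_kernel :: "'a::euclidean_space set \<Rightarrow> 'a \<times> 'a \<Rightarrow> complex" where
  "cone_kernel K p = (LINT u:K|lborel. exp (\<i> * Complex (fst p \<bullet> u) (snd p \<bullet> u))) / (2 * pi) ^ DIM('a)"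

definition cone_weight :: "'a::euclidean_space set \<Rightarrow> 'a \<Rightarrow> 'a \<Rightarrow> real" where
  "cone_weight K y u = indicator K u * exp (- (y \<bullet> u))"

lemma exp_i_Complex: "exp (\<i> * Complex a b) = complex_of_real (exp (- b)) * cis a"
proof -
  have "\<i> * Complex a b = complex_of_real (- b) + \<i> * complex_of_real a" by (simp add: complex_eq_iff)
  then show ?thesis by (simp only: exp_add cis_conv_exp exp_of_real)
qed

lemma cone_kernel_ft:
  "cone_kernel K (x, y :: 'a::euclidean_space) = ft (\<lambda>u. complex_of_real (cone_weight K y u)) x / (2 * pi) ^ DIM('a)"
proof -
  have "indicator K u *\<^sub>R exp (\<i> * Complex (x \<bullet> u) (y \<bullet> u)) = cis (x \<bullet> u) * complex_of_real (cone_weight K y u)" for u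
    by (auto simp: indicator_def exp_i_Complex cone_weight_def)
  then show ?thesis by (simp add: cone_kernel_def set_lebesgue_integral_def ft_def)
qed

locale open_cone =
  fixes \<Omega> :: "'a::euclidean_space set"
  assumes open_cone: "open \<Omega>"
    and add_closed: "\<And>x y. x \<in> \<Omega> \<Longrightarrow> y \<in> \<Omega> \<Longrightarrow> x + y \<in> \<Omega>"
    and scale_closed: "\<And>c x. 0 < c \<Longrightarrow> x \<in> \<Omega> \<Longrightarrow> c *\<^sub>R x \<in> \<Omega>"
begin

abbreviation "K \<equiv> polar_cone \<Omega>"
abbreviation "S \<equiv> cone_kernel K"
abbreviation "E \<equiv> cone_weight K"

lemma closed_polar: "closed K"
proof -
  have "K = (\<Inter>\<omega>\<in>\<Omega>. {x. 0 \<le> \<omega> \<bullet> x})" by (auto simp: polar_cone_def)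
  then show ?thesis by (auto intro!: closed_INT closed_halfspace_ge simp: inner_commute)
qed

lemma measurable_polar [measurable]: "K \<in> sets borel"
  by (rule borel_closed[OF closed_polar])

lemma measurable_weight [measurable]: "E y \<in> borel_measurable borel"
  unfolding cone_weight_def[abs_def] by measurable

lemma weight_nonneg: "0 \<le> E y u"
  by (simp add: cone_weight_def)

text \<open>Moving \<open>y\<close> by a fixed distance against \<open>u\<close> stays in the open cone, so \<open>y \<bullet> u\<close> exceeds a multiple
of \<open>\<parallel>u\<parallel>\<close>. All integrals over the polar cone converge for this reason.\<close>

lemma polar_coercive:
  assumes y: "y \<in> \<Omega>"
  obtains c where "c > 0" "\<And>u. u \<in> K \<Longrightarrow> c * norm u \<le> y \<bullet> u"
proof -
  from open_cone y obtain e where e: "e > 0" "ball y e \<subseteq> \<Omega>" by (auto simp: open_contains_ball)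
  have "e / 2 * norm u \<le> y \<bullet> u" if u: "u \<in> K" for u
  proof (cases "u = 0")
    case False
    let ?v = "y - (e / 2 / norm u) *\<^sub>R u"
    have "?v \<in> ball y e" using e False by (simp add: dist_norm)
    with e have "?v \<in> \<Omega>" by blast
    with u have "0 \<le> ?v \<bullet> u" by (auto simp: polar_cone_def)
    then show ?thesis
      using False by (simp add: inner_diff_left power2_norm_eq_inner[symmetric] power2_eq_square)
  qed simp
  with e show thesis by (intro that[of "e / 2"]) auto
qed

lemma weight_le_exp_norm:
  assumes "\<And>u. u \<in> K \<Longrightarrow> c * norm u \<le> y \<bullet> u"
  shows "E y u \<le> exp (- (c * norm u))"
  using assms[of u] by (auto simp: cone_weight_def indicator_def)

lemma integrable_weight: "y \<in> \<Omega> \<Longrightarrow> integrable lborel (E y)"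
proof -
  assume "y \<in> \<Omega>"
  from polar_coercive[OF this] obtain c where c: "c > 0" "\<And>u. u \<in> K \<Longrightarrow> c * norm u \<le> y \<bullet> u"
    by blast
  show ?thesis
    by (rule Bochner_Integration.integrable_bound[OF integrable_exp_norm[OF c(1)]])
       (use weight_le_exp_norm[OF c(2)] in \<open>auto simp: weight_nonneg\<close>)
qed

lemma weight_square: "(E y u)\<^sup>2 = E (2 *\<^sub>R y) u"
  by (auto simp: cone_weight_def indicator_def power2_eq_square exp_add[symmetric])

lemma weight_antimono: "y' \<in> insert 0 \<Omega> \<Longrightarrow> E (y + y') u \<le> E y u"
  by (auto simp: cone_weight_def indicator_def polar_cone_def inner_add_left)

lemma add_insert: "y \<in> \<Omega> \<Longrightarrow> y' \<in> insert 0 \<Omega> \<Longrightarrow> y + y' \<in> \<Omega>"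
  using add_closed by auto

lemma kernel_cnj: "cnj (S (x, y)) = S (- x, y)"
proof -
  have "cnj (ft (\<lambda>u. complex_of_real (E y u)) x) = ft (\<lambda>u. complex_of_real (E y u)) (- x)"
    unfolding ft_def Bochner_Integration.integral_cnj[symmetric]
    by (simp only: complex_cnj_mult cis_cnj complex_cnj_complex_of_real inner_minus_left)
  then show ?thesis by (simp add: cone_kernel_ft)
qed

lemma kernel_imaginary: "S (0, y) = complex_of_real ((LINT u|lborel. E y u) / (2 * pi) ^ DIM('a))"
  by (simp add: cone_kernel_ft ft_def)

text \<open>The oscillating factor only lowers the modulus, and the weight decreases along the cone because
vectors of the cone have nonnegative products with the polar cone. The summand \<open>y'\<close> may be \<open>0\<close>, so
that the slice at height \<open>y\<close> itself is included.\<close>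

lemma kernel_norm_le:
  assumes y: "y \<in> \<Omega>" and y': "y' \<in> insert 0 \<Omega>"
  shows "norm (S (x, y + y')) \<le> norm (S (0, y))"
proof -
  have "norm (ft (\<lambda>u. complex_of_real (E (y + y') u)) x) \<le> (LINT u|lborel. norm (complex_of_real (E (y + y') u)))"
    by (rule norm_ft_le)
  also have "\<dots> = (LINT u|lborel. E (y + y') u)" by (simp add: weight_nonneg)
  also have "\<dots> \<le> (LINT u|lborel. E y u)"
    by (intro integral_mono integrable_weight add_insert y y' weight_antimono)
  finally have *: "norm (ft (\<lambda>u. complex_of_real (E (y + y') u)) x) \<le> (LINT u|lborel. E y u)" .
  have "0 \<le> (LINT u|lborel. E y u)" by (simp add: weight_nonneg)
  with * show ?thesis
    unfolding kernel_imaginary norm_of_real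
    by (simp add: cone_kernel_ft norm_divide norm_power norm_mult divide_right_mono)
qed

lemma kernel_square_integral:
  assumes y: "y \<in> \<Omega>" and y': "y' \<in> insert 0 \<Omega>"
  shows "integrable lborel (\<lambda>x. (norm (S (x, y + y')))\<^sup>2)"
    and "(LINT x|lborel. (norm (S (x, y + y')))\<^sup>2) \<le> (LINT u|lborel. E (2 *\<^sub>R y) u) / (2 * pi) ^ DIM('a)"
proof -
  have int2: "integrable lborel (E (2 *\<^sub>R y))" "integrable lborel (E (2 *\<^sub>R (y + y')))"
    using y y' by (auto intro!: integrable_weight scale_closed add_insert)
  have E2: "integrable lborel (\<lambda>u. (E (y + y') u)\<^sup>2)" unfolding weight_square by (rule int2)
  note B = ft_bessel[OF integrable_weight[OF add_insert[OF y y']] E2 weight_nonneg]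
  have eq: "(norm (S (x, y + y')))\<^sup>2 = (norm (ft (\<lambda>u. complex_of_real (E (y + y') u)) x))\<^sup>2 / ((2 * pi) ^ DIM('a))\<^sup>2" for x
    by (simp add: cone_kernel_ft norm_divide norm_power norm_mult power_divide power_mult_distrib)
  show "integrable lborel (\<lambda>x. (norm (S (x, y + y')))\<^sup>2)" unfolding eq using B(1) by simp
  let ?c = "(2 * pi) ^ DIM('a)"
  have c: "?c > 0" by simp
  have "(LINT x|lborel. (norm (S (x, y + y')))\<^sup>2) =
      (LINT x|lborel. (norm (ft (\<lambda>u. complex_of_real (E (y + y') u)) x))\<^sup>2) / ?c\<^sup>2"
    unfolding eq by simp
  also have "\<dots> \<le> ?c * (LINT u|lborel. (E (y + y') u)\<^sup>2) / ?c\<^sup>2"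
    using B(2) by (intro divide_right_mono) auto
  also have "\<dots> = (LINT u|lborel. E (2 *\<^sub>R (y + y')) u) / ?c"
    unfolding weight_square using c by (simp add: power2_eq_square)
  also have "\<dots> \<le> (LINT u|lborel. E (2 *\<^sub>R y) u) / ?c"
  proof (intro divide_right_mono integral_mono int2)
    fix u
    have "2 *\<^sub>R y' \<in> insert 0 \<Omega>" using y' scale_closed by auto
    from weight_antimono[OF this, of "2 *\<^sub>R y" u] show "E (2 *\<^sub>R (y + y')) u \<le> E (2 *\<^sub>R y) u"
      by (simp add: scaleR_add_right)
  qed simp
  finally show "(LINT x|lborel. (norm (S (x, y + y')))\<^sup>2) \<le> (LINT u|lborel. E (2 *\<^sub>R y) u) / ?c" .
qed

text \<open>The first-order remainder of \<open>exp\<close> at \<open>i h \<cdot> u\<close> is at most \<open>exp (\<parallel>h\<parallel> \<parallel>u\<parallel>)\<close> times a multiple of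
\<open>\<parallel>h\<parallel>\<^sup>2 \<parallel>u\<parallel>\<^sup>2\<close>. Since \<open>y \<bullet> u \<ge> c \<parallel>u\<parallel>\<close> on the polar cone, the decay of the integrand absorbs this
growth as long as \<open>\<parallel>h\<parallel> < c/2\<close>.\<close>

lemma kernel_cdiff:
  assumes y: "y \<in> \<Omega>"
  shows "cdiff S (x, y)"
proof -
  obtain c where c: "c > 0" "\<And>u. u \<in> K \<Longrightarrow> c * norm u \<le> y \<bullet> u" using polar_coercive[OF y] by blast
  define A where "A = 128 / c\<^sup>2 + 8 / c"
  let ?e = "\<lambda>p u. exp (\<i> * Complex (fst p \<bullet> u) (snd p \<bullet> u))"
  let ?f = "\<lambda>p u. indicator K u *\<^sub>R ?e p u"
  let ?w = "\<lambda>h u. \<i> * Complex (fst h \<bullet> u) (snd h \<bullet> u)"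
  let ?D = "\<lambda>h u. ?f (x, y) u * ?w h u"
  let ?g = "\<lambda>u::'a. A * exp (- (c / 4 * norm u))"
  have f_weight: "?f p u = cis (fst p \<bullet> u) * complex_of_real (E (snd p) u)" for p u
    by (auto simp: indicator_def exp_i_Complex cone_weight_def)
  have fst_le: "norm (fst h) \<le> norm h" and snd_le: "norm (snd h) \<le> norm h" for h :: "'a \<times> 'a"
    using norm_fst_le[of "fst h" "snd h"] norm_snd_le[of "snd h" "fst h"] by simp_all
  have w_norm: "norm (?w h u) \<le> 2 * norm h * norm u" for h :: "'a \<times> 'a" and u
  proof -
    have "norm (?w h u) \<le> \<bar>fst h \<bullet> u\<bar> + \<bar>snd h \<bullet> u\<bar>"
      unfolding norm_mult norm_ii using cmod_le[of "Complex (fst h \<bullet> u) (snd h \<bullet> u)"] by simp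
    also have "\<dots> \<le> norm (fst h) * norm u + norm (snd h) * norm u"
      by (intro add_mono Cauchy_Schwarz_ineq2)
    also have "\<dots> \<le> norm h * norm u + norm h * norm u"
      by (intro add_mono mult_right_mono fst_le snd_le) auto
    finally show ?thesis by (simp add: mult_ac)
  qed
  have f_norm: "norm (?f (x, y) u) \<le> exp (- (c * norm u))" for u
    unfolding f_weight using weight_le_exp_norm[OF c(2)] by (simp add: norm_mult weight_nonneg)
  have quad: "norm (?f ((x, y) + h) u - ?f (x, y) u - ?D h u) \<le> ?g u * (norm h)\<^sup>2"
    if h: "norm h < c / 2" for h u
  proof -
    have "?e ((x, y) + h) u = ?e (x, y) u * exp (?w h u)"
      unfolding exp_add[symmetric] by (rule arg_cong[where f=exp]) (simp add: inner_add_left complex_eq_iff)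
    then have "?f ((x, y) + h) u - ?f (x, y) u - ?D h u = ?f (x, y) u * (exp (?w h u) - (1 + ?w h u))"
      by (simp add: algebra_simps)
    also have "norm \<dots> \<le> exp (- (c * norm u)) * (exp (c / 2 * norm u) * (2 * norm h * norm u)\<^sup>2)"
      unfolding norm_mult
    proof (intro mult_mono f_norm)
      have "norm (exp (?w h u) - (1 + ?w h u)) \<le> exp \<bar>Re (?w h u)\<bar> * (norm (?w h u))\<^sup>2"
        using Taylor_exp[of "?w h u" 1] by (simp add: numeral_2_eq_2)
      also have "\<dots> \<le> exp (c / 2 * norm u) * (2 * norm h * norm u)\<^sup>2"
      proof (intro mult_mono power_mono w_norm)
        have "\<bar>snd h \<bullet> u\<bar> \<le> norm (snd h) * norm u" by (rule Cauchy_Schwarz_ineq2)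
        also have "\<dots> \<le> c / 2 * norm u"
          using h snd_le[of h] by (intro mult_right_mono) auto
        finally show "exp \<bar>Re (?w h u)\<bar> \<le> exp (c / 2 * norm u)" by simp
      qed auto
      finally show "norm (exp (?w h u) - (1 + ?w h u)) \<le> exp (c / 2 * norm u) * (2 * norm h * norm u)\<^sup>2" .
    qed auto
    also have "\<dots> = 4 * (norm u)\<^sup>2 * exp (- (c / 2 * norm u)) * (norm h)\<^sup>2"
      by (simp add: mult.assoc[symmetric] exp_add[symmetric] power_mult_distrib)
    also have "\<dots> \<le> ?g u * (norm h)\<^sup>2"
    proof (intro mult_right_mono)
      have "4 * (norm u)\<^sup>2 * exp (- (c / 2 * norm u)) \<le> (4 * (norm u)\<^sup>2 + 2 * norm u) * exp (- (c / 2 * norm u))"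
        by (intro mult_right_mono) auto
      also have "\<dots> \<le> ?g u" unfolding A_def by (rule polynomial_exp_bound) (use c in auto)
      finally show "4 * (norm u)\<^sup>2 * exp (- (c / 2 * norm u)) \<le> ?g u" .
    qed simp
    finally show ?thesis .
  qed
  have "((\<lambda>p. LINT u|lborel. ?f p u) has_derivative (\<lambda>h. LINT u|lborel. ?D h u)) (at (x, y))"
  proof (rule has_derivative_integral_quadratic)
    show "integrable lborel ?g" using c by (intro integrable_mult_right integrable_exp_norm) simp
    show "integrable lborel (\<lambda>u. ?f ((x, y) + h) u)" if h: "norm h < c / 2" for h
    proof (rule Bochner_Integration.integrable_bound)
      show "integrable lborel (\<lambda>u::'a. exp (- (c / 2 * norm u)))" using c by (intro integrable_exp_norm) simp
      show "(\<lambda>u. ?f ((x, y) + h) u) \<in> borel_measurable lborel"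
        unfolding f_weight by measurable
      show "AE u in lborel. norm (?f ((x, y) + h) u) \<le> norm (exp (- (c / 2 * norm u)))"
      proof (rule AE_I2)
        fix u
        have "c / 2 * norm v \<le> snd ((x, y) + h) \<bullet> v" if v: "v \<in> K" for v
        proof -
          have "\<bar>snd h \<bullet> v\<bar> \<le> norm (snd h) * norm v" by (rule Cauchy_Schwarz_ineq2)
          also have "\<dots> \<le> c / 2 * norm v"
            using h snd_le[of h] by (intro mult_right_mono) auto
          finally show ?thesis using c(2)[OF v] by (simp add: inner_add_left)
        qed
        from weight_le_exp_norm[OF this]
        show "norm (?f ((x, y) + h) u) \<le> norm (exp (- (c / 2 * norm u)))"
          unfolding f_weight by (simp add: norm_mult weight_nonneg)
      qed
    qed
    show "0 < c / 2" using c by simp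
    have "Complex (fst h \<bullet> u) (snd h \<bullet> u) = complex_of_real (fst h \<bullet> u) + \<i> * complex_of_real (snd h \<bullet> u)" for h :: "'a \<times> 'a" and u
      by (simp add: complex_eq_iff)
    then show "(\<lambda>u. ?D h u) \<in> borel_measurable lborel" for h
      unfolding f_weight by simp
    show "linear (\<lambda>h. ?D h u)" for u
      by (rule linearI) (simp_all add: inner_add_left complex_eq_iff algebra_simps)
    show "norm (?D h u) \<le> ?g u * norm h" for h u
    proof -
      have "norm (?D h u) \<le> exp (- (c * norm u)) * (2 * norm h * norm u)"
        unfolding norm_mult[of "?f (x, y) u"] by (intro mult_mono f_norm w_norm) auto
      also have "\<dots> \<le> exp (- (c / 2 * norm u)) * (2 * norm h * norm u)"
        using c by (intro mult_right_mono) (auto simp: mult_right_mono)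
      also have "\<dots> = 2 * norm u * exp (- (c / 2 * norm u)) * norm h" by simp
      also have "\<dots> \<le> ?g u * norm h"
      proof (intro mult_right_mono)
        have "2 * norm u * exp (- (c / 2 * norm u)) \<le> (4 * (norm u)\<^sup>2 + 2 * norm u) * exp (- (c / 2 * norm u))"
          by (intro mult_right_mono) auto
        also have "\<dots> \<le> ?g u" unfolding A_def by (rule polynomial_exp_bound) (use c in auto)
        finally show "2 * norm u * exp (- (c / 2 * norm u)) \<le> ?g u" .
      qed simp
      finally show ?thesis .
    qed
  qed (rule quad)
  then have "cdiff (\<lambda>p. LINT u|lborel. ?f p u) (x, y)"
    unfolding cdiff_def
  proof (intro exI conjI allI)
    fix a b :: 'a
    have w: "?w (- b, a) u = \<i> * ?w (a, b) u" for u by (simp add: complex_eq_iff)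
    have "?D (- b, a) u = \<i> * ?D (a, b) u" for u unfolding w by (rule mult.left_commute)
    then show "(LINT u|lborel. ?D (- b, a) u) = \<i> * (LINT u|lborel. ?D (a, b) u)"
      by (simp only: integral_mult_right_zero)
  qed
  from cdiff_mult[OF this cdiff_const[of "1 / complex_of_real ((2 * pi) ^ DIM('a))"]]
  show ?thesis by (simp add: cone_kernel_def[abs_def] set_lebesgue_integral_def)
qed

end

section \<open>The reproducing property of the Szego kernel\<close>

lemma cdiff_continuous_slice:
  fixes f :: "'a::euclidean_space \<times> 'a \<Rightarrow> complex"
  assumes "\<And>x. cdiff f (x, y)"
  shows "continuous_on UNIV (\<lambda>x. f (x, y))"
proof (rule continuous_at_imp_continuous_on, rule ballI)
  fix x :: 'a
  have "isCont (\<lambda>x. (x, y)) x" by (intro continuous_intros)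
  then show "isCont (\<lambda>x. f (x, y)) x" by (rule isCont_o2) (rule cdiff_isCont[OF assms])
qed

lemma cdiff_measurable:
  fixes f :: "'a::euclidean_space \<times> 'a \<Rightarrow> complex"
  assumes "\<And>x. cdiff f (x, y)"
  shows "(\<lambda>x. f (x, y)) \<in> borel_measurable borel"
  by (rule borel_measurable_continuous_onI[OF cdiff_continuous_slice[OF assms]])

context open_cone
begin

text \<open>Write \<open>kh y\<close> for the Fourier transform of the slice of \<open>k\<close> at height \<open>y\<close>. The contour shift gives
\<open>kh 0 u = exp (y \<bullet> u) * kh y u\<close>, and the \<open>L\<^sup>1\<close> bounds make \<open>kh y\<close> bounded uniformly in \<open>y\<close>. If \<open>u\<close> is not
in the polar cone, some \<open>y\<close> has \<open>y \<bullet> u < 0\<close> and its large multiples force \<open>kh 0 u = 0\<close>. So \<open>kh \<eta>\<close> is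
the weight of the kernel times \<open>kh 0\<close>, and inversion at height \<open>\<eta>\<close> is the claimed identity.\<close>

lemma reproducing_integrable:
  assumes cd: "\<And>x y. y \<in> insert 0 \<Omega> \<Longrightarrow> cdiff k (x, y)"
    and int: "\<And>y. y \<in> insert 0 \<Omega> \<Longrightarrow> integrable lborel (\<lambda>x. k (x, y))"
    and bound: "\<And>y. y \<in> insert 0 \<Omega> \<Longrightarrow> (LINT x|lborel. norm (k (x, y))) \<le> M"
    and B: "\<And>x y. y \<in> insert 0 \<Omega> \<Longrightarrow> norm (k (x, y)) \<le> B"
    and \<eta>: "\<eta> \<in> \<Omega>"
  shows "(LINT \<sigma>|lborel. S (\<xi> - \<sigma>, \<eta>) * k (\<sigma>, 0)) = k (\<xi>, \<eta>)"
proof -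
  define kh where "kh y u = ft (\<lambda>\<sigma>. k (\<sigma>, y)) (- u)" for y u
  let ?c = "(2 * pi) ^ DIM('a)"
  have meas: "(\<lambda>x. k (x, y)) \<in> borel_measurable borel" if "y \<in> insert 0 \<Omega>" for y
    by (rule cdiff_measurable[OF cd[OF that]])
  have kh_bound: "norm (kh y u) \<le> M" if "y \<in> insert 0 \<Omega>" for y u
    unfolding kh_def using norm_ft_le bound[OF that] by (rule order_trans)
  have shift: "kh 0 u = exp (y \<bullet> u) * kh y u" if y: "y \<in> \<Omega>" for y u
  proof -
    let ?f = "\<lambda>p. exp (\<i> * Complex (fst p \<bullet> - u) (snd p \<bullet> - u)) * k p"
    have mem: "0 + s *\<^sub>R y \<in> insert 0 \<Omega>" if "0 \<le> s" for s :: real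
      using scale_closed[OF _ y, of s] that by (cases "s = 0") auto
    have f: "?f (x, y') = complex_of_real (exp (y' \<bullet> u)) * (cis (- u \<bullet> x) * k (x, y'))" for x y'
      by (simp add: exp_i_Complex inner_commute)
    have "(LINT x|lborel. ?f (x, 0)) = (LINT x|lborel. ?f (x, 0 + y))"
    proof (rule contour_shift)
      fix x and s :: real assume s: "0 \<le> s" "s \<le> 1"
      show "cdiff ?f (x, 0 + s *\<^sub>R y)"
        by (intro cdiff_mult cdiff_exp_inner cd mem s)
      show "integrable lborel (\<lambda>x. ?f (x, 0 + s *\<^sub>R y))"
        unfolding f by (intro integrable_mult_right integrable_cis_mult int mem s)
      have "norm (?f (x, 0 + s *\<^sub>R y)) = exp ((0 + s *\<^sub>R y) \<bullet> u) * norm (k (x, 0 + s *\<^sub>R y))" for x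
        unfolding f norm_mult by simp
      then have "(LINT x|lborel. norm (?f (x, 0 + s *\<^sub>R y))) =
          exp ((0 + s *\<^sub>R y) \<bullet> u) * (LINT x|lborel. norm (k (x, 0 + s *\<^sub>R y)))"
        by (simp only: integral_mult_right_zero)
      also have "\<dots> \<le> exp \<bar>y \<bullet> u\<bar> * M"
      proof (intro mult_mono bound mem s)
        have "s * (y \<bullet> u) \<le> s * \<bar>y \<bullet> u\<bar>" using s by (intro mult_left_mono) auto
        also have "\<dots> \<le> \<bar>y \<bullet> u\<bar>" using s by (intro mult_left_le_one_le) auto
        finally show "exp ((0 + s *\<^sub>R y) \<bullet> u) \<le> exp \<bar>y \<bullet> u\<bar>" by simp
      qed auto
      finally show "(LINT x|lborel. norm (?f (x, 0 + s *\<^sub>R y))) \<le> exp \<bar>y \<bullet> u\<bar> * M" .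
    qed
    then show ?thesis
      unfolding f integral_mult_right_zero by (simp add: kh_def ft_def)
  qed
  have outside: "kh 0 u = 0" if u: "u \<notin> K" for u
  proof (rule ccontr)
    assume nz: "kh 0 u \<noteq> 0"
    from u obtain y where y: "y \<in> \<Omega>" "y \<bullet> u < 0" by (auto simp: polar_cone_def not_le)
    have "norm (kh 0 u) \<le> exp (real n * (y \<bullet> u)) * M" if "n > 0" for n
    proof -
      have "real n *\<^sub>R y \<in> \<Omega>" using y that by (intro scale_closed) auto
      from shift[OF this, of u] kh_bound[of "real n *\<^sub>R y" u] this
      show ?thesis by (simp add: norm_mult mult_left_mono)
    qed
    moreover have "(\<lambda>n. exp (real n * (y \<bullet> u)) * M) \<longlonglongrightarrow> 0 * M"
    proof (intro tendsto_mult tendsto_const)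
      have "(\<lambda>n. exp (y \<bullet> u) ^ n) \<longlonglongrightarrow> 0"
        using y by (intro LIMSEQ_power_zero) simp
      then show "(\<lambda>n. exp (real n * (y \<bullet> u))) \<longlonglongrightarrow> 0" by (simp add: exp_of_nat_mult)
    qed
    ultimately have "norm (kh 0 u) \<le> 0 * M"
      by (intro LIMSEQ_le_const) (auto intro: exI[of _ 1])
    with nz show False by simp
  qed
  have kh_eta: "kh \<eta> u = E \<eta> u * kh 0 u" for u
  proof (cases "u \<in> K")
    case True
    then show ?thesis
      unfolding shift[OF \<eta>, of u] by (simp add: cone_weight_def exp_minus field_simps flip: exp_of_real)
  next
    case False
    then show ?thesis using shift[OF \<eta>, of u] outside[OF False] by simp
  qed
  have kh_meas: "kh y \<in> borel_measurable borel" if "y \<in> insert 0 \<Omega>" for y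
    unfolding kh_def[abs_def] by (rule measurable_compose[OF _ measurable_ft[OF meas[OF that]]]) measurable
  have kh_int: "integrable lborel (kh \<eta>)"
  proof (rule Bochner_Integration.integrable_bound[OF integrable_mult_left[OF integrable_weight[OF \<eta>], of M]])
    show "AE u in lborel. norm (kh \<eta> u) \<le> norm (E \<eta> u * M)"
    proof (rule AE_I2)
      fix u
      have "norm (kh \<eta> u) = E \<eta> u * norm (kh 0 u)" unfolding kh_eta by (simp add: norm_mult weight_nonneg)
      also have "\<dots> \<le> E \<eta> u * M" by (intro mult_left_mono kh_bound weight_nonneg) simp
      also have "\<dots> \<le> norm (E \<eta> u * M)" by simp
      finally show "norm (kh \<eta> u) \<le> norm (E \<eta> u * M)" .
    qed
  qed (use kh_meas[of \<eta>] \<eta> in simp)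
  have ft_eq: "ft (\<lambda>\<sigma>. k (\<sigma>, \<eta>)) v = kh \<eta> (0 - v)" for v by (simp add: kh_def)
  have inv: "(LINT v|lborel. ft (\<lambda>\<sigma>. k (\<sigma>, \<eta>)) v * cis (- (\<xi> \<bullet> v))) = ?c * k (\<xi>, \<eta>)"
  proof (rule fourier_inversion)
    show "integrable lborel (ft (\<lambda>\<sigma>. k (\<sigma>, \<eta>)))"
      using lborel_integral_reflect(2)[OF kh_meas[of \<eta>], of 0] kh_int \<eta> by (simp add: ft_eq[abs_def])
    show "continuous_on UNIV (\<lambda>\<sigma>. k (\<sigma>, \<eta>))"
      by (rule cdiff_continuous_slice[OF cd]) (simp add: \<eta>)
  qed (use int[of \<eta>] B[of \<eta>] \<eta> in auto)
  let ?F = "\<lambda>\<sigma> u. cis ((\<xi> - \<sigma>) \<bullet> u) * complex_of_real (E \<eta> u) * k (\<sigma>, 0)"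
  have kint: "integrable lborel (\<lambda>x. k (x, 0))" by (rule int) simp
  have Ei: "integrable lborel (\<lambda>u. complex_of_real (E \<eta> u))"
    using integrable_weight[OF \<eta>] by (simp only: complex_of_real_integrable_eq)
  have I: "integrable (lborel \<Otimes>\<^sub>M lborel) (\<lambda>(\<sigma>, u). ?F \<sigma> u)"
  proof (rule Bochner_Integration.integrable_bound[OF integrable_lborel_pairI[OF kint Ei]])
    have [measurable]: "(\<lambda>x. k (x, 0)) \<in> borel_measurable borel" by (rule meas) simp
    show "(\<lambda>(\<sigma>, u). ?F \<sigma> u) \<in> borel_measurable (lborel \<Otimes>\<^sub>M lborel)" by measurable
  qed (auto simp: norm_mult)
  have "(LINT \<sigma>|lborel. S (\<xi> - \<sigma>, \<eta>) * k (\<sigma>, 0)) = (LINT \<sigma>|lborel. (LINT u|lborel. ?F \<sigma> u) / ?c)"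
    by (simp add: cone_kernel_ft ft_def)
  also have "\<dots> = (LINT \<sigma>|lborel. LINT u|lborel. ?F \<sigma> u) / ?c"
    by (rule integral_divide_zero)
  also have "(LINT \<sigma>|lborel. LINT u|lborel. ?F \<sigma> u) = (LINT u|lborel. LINT \<sigma>|lborel. ?F \<sigma> u)"
    using lborel_pair.Fubini_integral[OF I] by simp
  also have "\<dots> = (LINT u|lborel. cis (\<xi> \<bullet> u) * kh \<eta> u)"
  proof (rule Bochner_Integration.integral_cong[OF refl])
    fix u
    have "cis ((\<xi> - \<sigma>) \<bullet> u) = cis (\<xi> \<bullet> u) * cis (- u \<bullet> \<sigma>)" for \<sigma>
      by (simp add: cis_mult inner_diff_left inner_commute[of u \<sigma>])
    then have "?F \<sigma> u = (cis (\<xi> \<bullet> u) * complex_of_real (E \<eta> u)) * (cis (- u \<bullet> \<sigma>) * k (\<sigma>, 0))" for \<sigma>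
      by (simp only: mult_ac)
    then have "(LINT \<sigma>|lborel. ?F \<sigma> u) = (cis (\<xi> \<bullet> u) * complex_of_real (E \<eta> u)) * kh 0 u"
      by (simp only: integral_mult_right_zero kh_def ft_def)
    then show "(LINT \<sigma>|lborel. ?F \<sigma> u) = cis (\<xi> \<bullet> u) * kh \<eta> u"
      by (simp only: kh_eta mult.assoc)
  qed
  also have "\<dots> = (LINT u|lborel. cis (\<xi> \<bullet> (0 - u)) * kh \<eta> (0 - u))"
  proof (rule lborel_integral_reflect(1)[symmetric])
    have [measurable]: "kh \<eta> \<in> borel_measurable borel" using kh_meas[of \<eta>] \<eta> by simp
    show "(\<lambda>u. cis (\<xi> \<bullet> u) * kh \<eta> u) \<in> borel_measurable borel" by measurable
  qed
  also have "\<dots> = ?c * k (\<xi>, \<eta>)"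
    using inv by (simp only: ft_eq diff_0 inner_minus_right mult.commute)
  finally show ?thesis by simp
qed

text \<open>Both claims follow from \<open>2ab \<le> a\<^sup>2 + b\<^sup>2\<close>. The sum on the right, cruder than the product of the norms,
suffices because only uniformity over the slices matters.\<close>

lemma square_integrable_product:
  fixes f g :: "'a \<Rightarrow> complex"
  assumes f: "integrable lborel (\<lambda>x. (norm (f x))\<^sup>2)" and g: "integrable lborel (\<lambda>x. (norm (g x))\<^sup>2)"
    and [measurable]: "f \<in> borel_measurable borel" "g \<in> borel_measurable borel"
  shows "integrable lborel (\<lambda>x. f x * g x)"
    and "(LINT x|lborel. norm (f x * g x)) \<le> (LINT x|lborel. (norm (f x))\<^sup>2) + (LINT x|lborel. (norm (g x))\<^sup>2)"
proof -
  have le: "norm (f x * g x) \<le> (norm (f x))\<^sup>2 + (norm (g x))\<^sup>2" for x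
  proof -
    have "norm (f x * g x) \<le> 2 * norm (f x) * norm (g x)" by (simp add: norm_mult)
    also have "\<dots> \<le> (norm (f x))\<^sup>2 + (norm (g x))\<^sup>2" by (rule sum_squares_bound)
    finally show ?thesis .
  qed
  have s: "integrable lborel (\<lambda>x. (norm (f x))\<^sup>2 + (norm (g x))\<^sup>2)" using f g by simp
  show i: "integrable lborel (\<lambda>x. f x * g x)"
    by (rule Bochner_Integration.integrable_bound[OF s]) (use le in \<open>auto intro!: AE_I2 order_trans[OF le]\<close>)
  have "(LINT x|lborel. norm (f x * g x)) \<le> (LINT x|lborel. (norm (f x))\<^sup>2 + (norm (g x))\<^sup>2)"
    by (intro integral_mono integrable_norm i s le)
  then show "(LINT x|lborel. norm (f x * g x)) \<le> (LINT x|lborel. (norm (f x))\<^sup>2) + (LINT x|lborel. (norm (g x))\<^sup>2)"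
    using f g by simp
qed

lemma kernel_measurable: "y \<in> \<Omega> \<Longrightarrow> (\<lambda>x. S (x, y)) \<in> borel_measurable borel"
  by (rule cdiff_measurable[OF kernel_cdiff])

lemma kernel_affine_square_integral:
  assumes y: "y \<in> \<Omega>" and y': "y' \<in> insert 0 \<Omega>" and c: "c \<noteq> 0"
  shows "integrable lborel (\<lambda>x. (norm (S (t + c *\<^sub>R x, y + y')))\<^sup>2)"
    and "(LINT x|lborel. (norm (S (t + c *\<^sub>R x, y + y')))\<^sup>2)
      \<le> (LINT u|lborel. E (2 *\<^sub>R y) u) / (2 * pi) ^ DIM('a) / \<bar>c\<bar> ^ DIM('a)"
proof -
  have m: "(\<lambda>x. (norm (S (x, y + y')))\<^sup>2) \<in> borel_measurable borel"
    using kernel_measurable[OF add_insert[OF y y']] by simp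
  note K = kernel_square_integral[OF y y'] and A = lborel_integral_affine[OF m c, of t]
  show "integrable lborel (\<lambda>x. (norm (S (t + c *\<^sub>R x, y + y')))\<^sup>2)" using A(2) K(1) by simp
  have "(LINT x|lborel. (norm (S (t + c *\<^sub>R x, y + y')))\<^sup>2) = (LINT x|lborel. (norm (S (x, y + y')))\<^sup>2) / \<bar>c\<bar> ^ DIM('a)"
    using A(1) c by (simp add: field_simps)
  also have "\<dots> \<le> (LINT u|lborel. E (2 *\<^sub>R y) u) / (2 * pi) ^ DIM('a) / \<bar>c\<bar> ^ DIM('a)"
    using K(2) by (rule divide_right_mono) simp
  finally show "(LINT x|lborel. (norm (S (t + c *\<^sub>R x, y + y')))\<^sup>2)
      \<le> (LINT u|lborel. E (2 *\<^sub>R y) u) / (2 * pi) ^ DIM('a) / \<bar>c\<bar> ^ DIM('a)" .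
qed

lemma kernel_product_integrable:
  assumes "\<eta>\<^sub>1 \<in> \<Omega>" "\<eta>\<^sub>2 \<in> \<Omega>"
  shows "integrable lborel (\<lambda>\<sigma>. S (\<xi>\<^sub>1 - \<sigma>, \<eta>\<^sub>1) * S (\<sigma> - \<xi>\<^sub>2, \<eta>\<^sub>2))"
proof (rule square_integrable_product(1))
  show "integrable lborel (\<lambda>\<sigma>. (norm (S (\<xi>\<^sub>1 - \<sigma>, \<eta>\<^sub>1)))\<^sup>2)"
    using kernel_affine_square_integral(1)[of "\<eta>\<^sub>1" 0 "-1" "\<xi>\<^sub>1"] assms by simp
  show "integrable lborel (\<lambda>\<sigma>. (norm (S (\<sigma> - \<xi>\<^sub>2, \<eta>\<^sub>2)))\<^sup>2)"
    using kernel_affine_square_integral(1)[of "\<eta>\<^sub>2" 0 1 "-\<xi>\<^sub>2"] assms by simp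
  show "(\<lambda>\<sigma>. S (\<xi>\<^sub>1 - \<sigma>, \<eta>\<^sub>1)) \<in> borel_measurable borel"
    by (rule measurable_compose[OF _ kernel_measurable[OF assms(1)]]) measurable
  show "(\<lambda>\<sigma>. S (\<sigma> - \<xi>\<^sub>2, \<eta>\<^sub>2)) \<in> borel_measurable borel"
    by (rule measurable_compose[OF _ kernel_measurable[OF assms(2)]]) measurable
qed

text \<open>The product of a kernel with a bounded function is only square integrable on the slices.
Multiplication by \<open>\<theta> \<delta>\<close>, the kernel at the scaled point \<open>\<delta> p + i \<eta>\<^sub>2\<close> normalised to \<open>1\<close> at \<open>\<delta> = 0\<close>,
makes it integrable with bounds that do not depend on the height; moreover \<open>\<theta> \<delta>\<close> is bounded by
\<open>1\<close> and tends to \<open>1\<close> as \<open>\<delta> \<rightarrow> 0\<close>.\<close>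

lemma reproducing_bounded:
  assumes cd: "\<And>x y. y \<in> insert 0 \<Omega> \<Longrightarrow> cdiff G (x, y)"
    and B: "\<And>x y. y \<in> insert 0 \<Omega> \<Longrightarrow> norm (G (x, y)) \<le> B"
    and \<eta>1: "\<eta>\<^sub>1 \<in> \<Omega>" and \<eta>2: "\<eta>\<^sub>2 \<in> \<Omega>"
  shows "(LINT \<sigma>|lborel. S (\<xi>\<^sub>1 - \<sigma>, \<eta>\<^sub>1) * S (\<sigma> - \<xi>\<^sub>2, \<eta>\<^sub>2) * G (\<sigma>, 0)) =
    S (\<xi>\<^sub>1 - \<xi>\<^sub>2, \<eta>\<^sub>1 + \<eta>\<^sub>2) * G (\<xi>\<^sub>1, \<eta>\<^sub>1)"
proof (cases "S (0, \<eta>\<^sub>2) = 0")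
  case True
  \<comment> \<open>The polar cone is then a null set, and both sides vanish.\<close>
  have "S (x, \<eta>\<^sub>2 + y) = 0" if "y \<in> insert 0 \<Omega>" for x y
    using kernel_norm_le[OF \<eta>2 that, of x] True by simp
  from this[of 0] this[of "\<eta>\<^sub>1"] \<eta>1 show ?thesis by (simp add: add.commute)
next
  case False
  let ?N = "norm (S (0, \<eta>\<^sub>2))"
  have N: "?N > 0" using False by simp
  have B0: "0 \<le> B" using B[of 0 0] norm_ge_zero order_trans by blast
  have mem: "\<delta> *\<^sub>R y \<in> insert 0 \<Omega>" if "y \<in> insert 0 \<Omega>" "0 < \<delta>" for \<delta> y
    using that scale_closed by auto
  define \<theta> where "\<theta> \<delta> p = S (\<delta> *\<^sub>R p + (0, \<eta>\<^sub>2)) / S (0, \<eta>\<^sub>2)" for \<delta> p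
  have \<theta>_eq: "\<theta> \<delta> (x, y) = S (\<delta> *\<^sub>R x, \<eta>\<^sub>2 + \<delta> *\<^sub>R y) / S (0, \<eta>\<^sub>2)" for \<delta> x y
    by (simp add: \<theta>_def add.commute)
  have \<theta>_le: "norm (\<theta> \<delta> (x, y)) \<le> 1" if "y \<in> insert 0 \<Omega>" "0 < \<delta>" for \<delta> x y
    unfolding \<theta>_eq norm_divide using kernel_norm_le[OF \<eta>2 mem[OF that]] N by simp
  have \<theta>_cd: "cdiff (\<theta> \<delta>) (x, y)" if "y \<in> insert 0 \<Omega>" "0 < \<delta>" for \<delta> x y
  proof -
    have "cdiff S (\<delta> *\<^sub>R (x, y) + (0, \<eta>\<^sub>2))"
      using kernel_cdiff[OF add_insert[OF \<eta>2 mem[OF that]]] by (simp add: add.commute)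
    from cdiff_mult[OF cdiff_affine[OF this] cdiff_const[of "1 / S (0, \<eta>\<^sub>2)"]]
    show ?thesis by (simp add: \<theta>_def[abs_def])
  qed
  define T where "T p = S (1 *\<^sub>R p + (- \<xi>\<^sub>2, \<eta>\<^sub>2))" for p
  have T_eq: "T (x, y) = S (x - \<xi>\<^sub>2, \<eta>\<^sub>2 + y)" for x y
    by (simp add: T_def add.commute)
  have T_cd: "cdiff T (x, y)" if "y \<in> insert 0 \<Omega>" for x y
    unfolding T_def[abs_def]
    by (rule cdiff_affine) (use kernel_cdiff[OF add_insert[OF \<eta>2 that]] in \<open>simp add: add.commute\<close>)
  have T_le: "norm (T (x, y)) \<le> ?N" if "y \<in> insert 0 \<Omega>" for x y
    unfolding T_eq by (rule kernel_norm_le[OF \<eta>2 that])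
  let ?Q = "(LINT u|lborel. E (2 *\<^sub>R \<eta>\<^sub>2) u) / (2 * pi) ^ DIM('a)"
  have step: "(LINT \<sigma>|lborel. S (\<xi>\<^sub>1 - \<sigma>, \<eta>\<^sub>1) * (T (\<sigma>, 0) * \<theta> \<delta> (\<sigma>, 0) * G (\<sigma>, 0))) =
      T (\<xi>\<^sub>1, \<eta>\<^sub>1) * \<theta> \<delta> (\<xi>\<^sub>1, \<eta>\<^sub>1) * G (\<xi>\<^sub>1, \<eta>\<^sub>1)" if \<delta>: "0 < \<delta>" for \<delta>
  proof (rule reproducing_integrable[where k="\<lambda>p. T p * \<theta> \<delta> p * G p"])
    fix x y assume y: "y \<in> insert 0 \<Omega>"
    show "cdiff (\<lambda>p. T p * \<theta> \<delta> p * G p) (x, y)"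
      by (intro cdiff_mult T_cd \<theta>_cd cd y \<delta>)
    show "norm (T (x, y) * \<theta> \<delta> (x, y) * G (x, y)) \<le> ?N * 1 * B"
      unfolding norm_mult by (intro mult_mono T_le \<theta>_le B y \<delta>) auto
    have Tm: "(\<lambda>x. T (x, y)) \<in> borel_measurable borel" by (rule cdiff_measurable[OF T_cd[OF y]])
    have \<theta>m: "(\<lambda>x. \<theta> \<delta> (x, y)) \<in> borel_measurable borel" by (rule cdiff_measurable[OF \<theta>_cd[OF y \<delta>]])
    have Gm: "(\<lambda>x. G (x, y)) \<in> borel_measurable borel" by (rule cdiff_measurable[OF cd[OF y]])
    have T2: "integrable lborel (\<lambda>x. (norm (T (x, y)))\<^sup>2)" "(LINT x|lborel. (norm (T (x, y)))\<^sup>2) \<le> ?Q"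
      using kernel_affine_square_integral[OF \<eta>2 y, of 1 "- \<xi>\<^sub>2"] by (simp_all add: T_eq)
    have \<theta>2: "integrable lborel (\<lambda>x. (norm (\<theta> \<delta> (x, y)))\<^sup>2)"
      "(LINT x|lborel. (norm (\<theta> \<delta> (x, y)))\<^sup>2) \<le> ?Q / \<bar>\<delta>\<bar> ^ DIM('a) / ?N\<^sup>2"
      using kernel_affine_square_integral(1)[OF \<eta>2 mem[OF y \<delta>], of \<delta> 0] \<delta>
        divide_right_mono[OF kernel_affine_square_integral(2)[OF \<eta>2 mem[OF y \<delta>], of \<delta> 0], of "?N\<^sup>2"]
      by (simp_all add: \<theta>_eq norm_divide power_divide)
    note P = square_integrable_product[OF T2(1) \<theta>2(1) Tm \<theta>m]
    have le: "norm (T (x, y) * \<theta> \<delta> (x, y) * G (x, y)) \<le> norm (T (x, y) * \<theta> \<delta> (x, y)) * B" for x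
      unfolding norm_mult[of _ "G (x, y)"] by (intro mult_left_mono B y) simp
    show i: "integrable lborel (\<lambda>x. T (x, y) * \<theta> \<delta> (x, y) * G (x, y))"
    proof (rule Bochner_Integration.integrable_bound[OF integrable_mult_left[OF integrable_norm[OF P(1)], of B]])
      show "(\<lambda>x. T (x, y) * \<theta> \<delta> (x, y) * G (x, y)) \<in> borel_measurable lborel"
        using Tm \<theta>m Gm by simp
      show "AE x in lborel. norm (T (x, y) * \<theta> \<delta> (x, y) * G (x, y)) \<le> norm (norm (T (x, y) * \<theta> \<delta> (x, y)) * B)"
        using B0 by (intro AE_I2 order_trans[OF le]) simp
    qed
    have "(LINT x|lborel. norm (T (x, y) * \<theta> \<delta> (x, y) * G (x, y))) \<le> (LINT x|lborel. norm (T (x, y) * \<theta> \<delta> (x, y)) * B)"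
      by (intro integral_mono integrable_norm i integrable_mult_left P(1) le)
    also have "\<dots> = (LINT x|lborel. norm (T (x, y) * \<theta> \<delta> (x, y))) * B" by (rule integral_mult_left_zero)
    also have "\<dots> \<le> (?Q + ?Q / \<bar>\<delta>\<bar> ^ DIM('a) / ?N\<^sup>2) * B"
      using P(2) T2(2) \<theta>2(2) B0 by (intro mult_right_mono) auto
    finally show "(LINT x|lborel. norm (T (x, y) * \<theta> \<delta> (x, y) * G (x, y))) \<le> (?Q + ?Q / \<bar>\<delta>\<bar> ^ DIM('a) / ?N\<^sup>2) * B" .
  qed (rule \<eta>1)
  define \<delta> where "\<delta> n = inverse (real (Suc n))" for n
  have pos: "0 < \<delta> n" for n by (simp add: \<delta>_def)
  have lim: "\<delta> \<longlonglongrightarrow> 0" unfolding \<delta>_def by (rule LIMSEQ_inverse_real_of_nat)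
  have \<theta>_lim: "(\<lambda>n. \<theta> (\<delta> n) p) \<longlonglongrightarrow> 1" for p
  proof -
    have "(\<lambda>n. \<delta> n *\<^sub>R p + (0, \<eta>\<^sub>2)) \<longlonglongrightarrow> 0 *\<^sub>R p + (0, \<eta>\<^sub>2)"
      by (intro tendsto_intros lim)
    then have "(\<lambda>n. S (\<delta> n *\<^sub>R p + (0, \<eta>\<^sub>2))) \<longlonglongrightarrow> S (0, \<eta>\<^sub>2)"
      by (intro isCont_tendsto_compose[OF cdiff_isCont[OF kernel_cdiff[OF \<eta>2]]]) simp
    then have "(\<lambda>n. \<theta> (\<delta> n) p) \<longlonglongrightarrow> S (0, \<eta>\<^sub>2) / S (0, \<eta>\<^sub>2)"
      unfolding \<theta>_def using False by (intro tendsto_intros)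
    then show ?thesis using False by simp
  qed
  have Gm: "(\<lambda>x. G (x, 0)) \<in> borel_measurable borel" by (rule cdiff_measurable[OF cd]) simp
  have ST: "integrable lborel (\<lambda>\<sigma>. S (\<xi>\<^sub>1 - \<sigma>, \<eta>\<^sub>1) * T (\<sigma>, 0))"
    using kernel_product_integrable[OF \<eta>1 \<eta>2, of "\<xi>\<^sub>1" "\<xi>\<^sub>2"] by (simp add: T_eq)
  then have STm: "(\<lambda>\<sigma>. S (\<xi>\<^sub>1 - \<sigma>, \<eta>\<^sub>1) * T (\<sigma>, 0)) \<in> borel_measurable borel" by auto
  have "(\<lambda>n. LINT \<sigma>|lborel. S (\<xi>\<^sub>1 - \<sigma>, \<eta>\<^sub>1) * T (\<sigma>, 0) * G (\<sigma>, 0) * \<theta> (\<delta> n) (\<sigma>, 0)) \<longlonglongrightarrow>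
      (LINT \<sigma>|lborel. S (\<xi>\<^sub>1 - \<sigma>, \<eta>\<^sub>1) * T (\<sigma>, 0) * G (\<sigma>, 0))"
  proof (rule integral_dominated_convergence[where w="\<lambda>\<sigma>. norm (S (\<xi>\<^sub>1 - \<sigma>, \<eta>\<^sub>1) * T (\<sigma>, 0)) * B"])
    show "integrable lborel (\<lambda>\<sigma>. norm (S (\<xi>\<^sub>1 - \<sigma>, \<eta>\<^sub>1) * T (\<sigma>, 0)) * B)"
      by (intro integrable_mult_left integrable_norm ST)
    show "(\<lambda>\<sigma>. S (\<xi>\<^sub>1 - \<sigma>, \<eta>\<^sub>1) * T (\<sigma>, 0) * G (\<sigma>, 0)) \<in> borel_measurable lborel"
      using STm Gm by simp
    have "(\<lambda>x. \<theta> (\<delta> n) (x, 0)) \<in> borel_measurable borel" for n by (rule cdiff_measurable[OF \<theta>_cd[OF _ pos]]) simp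
    then show "(\<lambda>\<sigma>. S (\<xi>\<^sub>1 - \<sigma>, \<eta>\<^sub>1) * T (\<sigma>, 0) * G (\<sigma>, 0) * \<theta> (\<delta> n) (\<sigma>, 0)) \<in> borel_measurable lborel" for n
      using STm Gm by simp
    have "(\<lambda>n. S (\<xi>\<^sub>1 - \<sigma>, \<eta>\<^sub>1) * T (\<sigma>, 0) * G (\<sigma>, 0) * \<theta> (\<delta> n) (\<sigma>, 0)) \<longlonglongrightarrow>
        S (\<xi>\<^sub>1 - \<sigma>, \<eta>\<^sub>1) * T (\<sigma>, 0) * G (\<sigma>, 0) * 1" for \<sigma>
      by (intro tendsto_mult tendsto_const \<theta>_lim)
    then show "AE \<sigma> in lborel. (\<lambda>n. S (\<xi>\<^sub>1 - \<sigma>, \<eta>\<^sub>1) * T (\<sigma>, 0) * G (\<sigma>, 0) * \<theta> (\<delta> n) (\<sigma>, 0)) \<longlonglongrightarrow>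
        S (\<xi>\<^sub>1 - \<sigma>, \<eta>\<^sub>1) * T (\<sigma>, 0) * G (\<sigma>, 0)" by simp
    show "AE \<sigma> in lborel. norm (S (\<xi>\<^sub>1 - \<sigma>, \<eta>\<^sub>1) * T (\<sigma>, 0) * G (\<sigma>, 0) * \<theta> (\<delta> n) (\<sigma>, 0))
        \<le> norm (S (\<xi>\<^sub>1 - \<sigma>, \<eta>\<^sub>1) * T (\<sigma>, 0)) * B" for n
    proof (rule AE_I2)
      fix \<sigma>
      have "norm (S (\<xi>\<^sub>1 - \<sigma>, \<eta>\<^sub>1) * T (\<sigma>, 0) * G (\<sigma>, 0) * \<theta> (\<delta> n) (\<sigma>, 0)) \<le>
          norm (S (\<xi>\<^sub>1 - \<sigma>, \<eta>\<^sub>1) * T (\<sigma>, 0)) * B * 1"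
        unfolding norm_mult[of _ "\<theta> (\<delta> n) (\<sigma>, 0)"] norm_mult[of _ "G (\<sigma>, 0)"]
        using B0 by (intro mult_mono mult_left_mono B \<theta>_le pos) auto
      then show "norm (S (\<xi>\<^sub>1 - \<sigma>, \<eta>\<^sub>1) * T (\<sigma>, 0) * G (\<sigma>, 0) * \<theta> (\<delta> n) (\<sigma>, 0))
        \<le> norm (S (\<xi>\<^sub>1 - \<sigma>, \<eta>\<^sub>1) * T (\<sigma>, 0)) * B" by simp
    qed
  qed
  moreover have "(LINT \<sigma>|lborel. S (\<xi>\<^sub>1 - \<sigma>, \<eta>\<^sub>1) * T (\<sigma>, 0) * G (\<sigma>, 0) * \<theta> (\<delta> n) (\<sigma>, 0)) =
      T (\<xi>\<^sub>1, \<eta>\<^sub>1) * \<theta> (\<delta> n) (\<xi>\<^sub>1, \<eta>\<^sub>1) * G (\<xi>\<^sub>1, \<eta>\<^sub>1)" for n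
    using step[OF pos[of n]] by (simp only: mult_ac)
  moreover have "(\<lambda>n. T (\<xi>\<^sub>1, \<eta>\<^sub>1) * \<theta> (\<delta> n) (\<xi>\<^sub>1, \<eta>\<^sub>1) * G (\<xi>\<^sub>1, \<eta>\<^sub>1)) \<longlonglongrightarrow> T (\<xi>\<^sub>1, \<eta>\<^sub>1) * 1 * G (\<xi>\<^sub>1, \<eta>\<^sub>1)"
    by (intro tendsto_mult tendsto_const \<theta>_lim)
  ultimately have "(LINT \<sigma>|lborel. S (\<xi>\<^sub>1 - \<sigma>, \<eta>\<^sub>1) * T (\<sigma>, 0) * G (\<sigma>, 0)) = T (\<xi>\<^sub>1, \<eta>\<^sub>1) * 1 * G (\<xi>\<^sub>1, \<eta>\<^sub>1)"
    by (simp only: LIMSEQ_unique)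
  then show ?thesis by (simp add: T_eq add.commute)
qed

end

section \<open>The Herglotz representation over an open cone\<close>

context open_cone
begin

text \<open>The Herglotz kernel at \<open>\<zeta> = \<xi> + i\<eta>\<close> and \<open>\<alpha> = i\<omega>\<close>, as a function of the real point \<open>\<sigma>\<close>.\<close>

definition herglotz_density :: "'a \<Rightarrow> 'a \<Rightarrow> 'a \<Rightarrow> 'a \<Rightarrow> complex" where
  "herglotz_density \<xi> \<eta> \<omega> \<sigma> = 2 * (S (\<xi> - \<sigma>, \<eta>) * S (\<sigma>, \<omega>) / S (\<xi>, \<eta> + \<omega>))
     - complex_of_real ((norm (S (\<sigma>, \<omega>)))\<^sup>2) / S (0, \<omega> + \<omega>)"

lemma norm_kernel_square: "complex_of_real ((norm (S (\<sigma>, \<omega>)))\<^sup>2) = S (0 - \<sigma>, \<omega>) * S (\<sigma>, \<omega>)"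
  unfolding complex_norm_square kernel_cnj by (simp add: mult.commute)

text \<open>The weight at \<open>2\<omega>\<close> is the square of the weight at \<open>\<omega>\<close>. If its integral vanished, the weight at \<open>\<omega>\<close>
would vanish almost everywhere, and with it the kernel at every height above \<open>\<omega>\<close>.\<close>

lemma kernel_diagonal_nonzero:
  assumes \<omega>: "\<omega> \<in> \<Omega>" and \<eta>: "\<eta> \<in> \<Omega>" and nz: "S (\<xi>, \<eta> + \<omega>) \<noteq> 0"
  shows "S (0, \<omega> + \<omega>) \<noteq> 0"
proof
  assume "S (0, \<omega> + \<omega>) = 0"
  then have "(LINT u|lborel. E (2 *\<^sub>R \<omega>) u) = 0" by (simp add: kernel_imaginary scaleR_2)
  moreover have "2 *\<^sub>R \<omega> \<in> \<Omega>" using \<omega> by (intro scale_closed) auto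
  ultimately have "AE u in lborel. E (2 *\<^sub>R \<omega>) u = 0"
    by (subst (asm) integral_nonneg_eq_0_iff_AE) (auto simp: integrable_weight weight_nonneg)
  then have "AE u in lborel. E \<omega> u = 0"
    unfolding weight_square[symmetric] by simp
  then have "(LINT u|lborel. E \<omega> u) = 0" by (rule integral_eq_zero_AE)
  then have "S (0, \<omega>) = 0" by (simp add: kernel_imaginary)
  with kernel_norm_le[OF \<omega>, of \<eta> \<xi>] \<eta> nz show False by (simp add: add.commute)
qed

lemma integrable_herglotz_density:
  assumes "\<omega> \<in> \<Omega>" "\<eta> \<in> \<Omega>"
  shows "integrable lborel (herglotz_density \<xi> \<eta> \<omega>)"
proof -
  have *: "integrable lborel (\<lambda>\<sigma>. S (\<xi> - \<sigma>, \<eta>) * S (\<sigma>, \<omega>))" if "\<eta> \<in> \<Omega>" for \<xi> \<eta>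
    using kernel_product_integrable[OF that assms(1), of \<xi> 0] by simp
  show ?thesis
    unfolding herglotz_density_def[abs_def] norm_kernel_square
    by (intro Bochner_Integration.integrable_diff integrable_mult_right integrable_divide_zero * assms)
qed

text \<open>The integrals with \<open>G\<close> and with its conjugate are both values of the reproducing formula, the second
after conjugation and exchange of \<open>\<xi> + i\<eta>\<close> with \<open>i\<omega>\<close>. Their mean concerns \<open>Re G\<close> (\<open>main\<close>); the second
term of the Herglotz kernel is the case \<open>\<xi> = 0\<close>, \<open>\<eta> = \<omega>\<close> and removes \<open>Re G(i\<omega>)\<close>.\<close>

lemma herglotz_bounded:
  assumes cd: "\<And>x y. y \<in> insert 0 \<Omega> \<Longrightarrow> cdiff G (x, y)"
    and B: "\<And>x y. y \<in> insert 0 \<Omega> \<Longrightarrow> norm (G (x, y)) \<le> B"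
    and \<omega>: "\<omega> \<in> \<Omega>" and \<eta>: "\<eta> \<in> \<Omega>" and nz: "S (\<xi>, \<eta> + \<omega>) \<noteq> 0"
  shows "(LINT \<sigma>|lborel. herglotz_density \<xi> \<eta> \<omega> \<sigma> * complex_of_real (Re (G (\<sigma>, 0)))) =
    G (\<xi>, \<eta>) - \<i> * complex_of_real (Im (G (0, \<omega>)))"
proof -
  have Gm: "(\<lambda>\<sigma>. G (\<sigma>, 0)) \<in> borel_measurable borel" by (rule cdiff_measurable[OF cd]) simp
  have "(cnj :: complex \<Rightarrow> complex) \<in> borel_measurable borel"
    by (intro borel_measurable_continuous_onI continuous_intros)
  from measurable_compose[OF Gm this]
  have Gc: "(\<lambda>\<sigma>. cnj (G (\<sigma>, 0))) \<in> borel_measurable borel" .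
  have int: "integrable lborel (\<lambda>\<sigma>. S (\<xi> - \<sigma>, \<eta>) * S (\<sigma>, \<omega>) * g \<sigma>)"
    if \<eta>: "\<eta> \<in> \<Omega>" and g: "g \<in> borel_measurable borel" "\<And>\<sigma>. norm (g \<sigma>) \<le> B" for \<xi> \<eta> and g :: "'a \<Rightarrow> complex"
  proof -
    have i: "integrable lborel (\<lambda>\<sigma>. S (\<xi> - \<sigma>, \<eta>) * S (\<sigma>, \<omega>))"
      using kernel_product_integrable[OF \<eta> \<omega>, of \<xi> 0] by simp
    show ?thesis
    proof (rule Bochner_Integration.integrable_bound[OF integrable_mult_left[OF integrable_norm[OF i], of B]])
      show "(\<lambda>\<sigma>. S (\<xi> - \<sigma>, \<eta>) * S (\<sigma>, \<omega>) * g \<sigma>) \<in> borel_measurable lborel"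
        using borel_measurable_integrable[OF i] g(1) by simp
      show "AE \<sigma> in lborel. norm (S (\<xi> - \<sigma>, \<eta>) * S (\<sigma>, \<omega>) * g \<sigma>) \<le> norm (norm (S (\<xi> - \<sigma>, \<eta>) * S (\<sigma>, \<omega>)) * B)"
      proof (rule AE_I2)
        fix \<sigma>
        have "0 \<le> B" using g(2)[of 0] norm_ge_zero order_trans by blast
        then show "norm (S (\<xi> - \<sigma>, \<eta>) * S (\<sigma>, \<omega>) * g \<sigma>) \<le> norm (norm (S (\<xi> - \<sigma>, \<eta>) * S (\<sigma>, \<omega>)) * B)"
          unfolding norm_mult[of _ "g \<sigma>"] using g(2)[of \<sigma>] by (simp add: abs_mult mult_left_mono)
      qed
    qed
  qed
  have main: "(LINT \<sigma>|lborel. S (\<xi> - \<sigma>, \<eta>) * S (\<sigma>, \<omega>) * complex_of_real (Re (G (\<sigma>, 0)))) =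
      S (\<xi>, \<eta> + \<omega>) * (G (\<xi>, \<eta>) + cnj (G (0, \<omega>))) / 2" if \<eta>: "\<eta> \<in> \<Omega>" for \<xi> \<eta>
  proof -
    have 1: "(LINT \<sigma>|lborel. S (\<xi> - \<sigma>, \<eta>) * S (\<sigma>, \<omega>) * G (\<sigma>, 0)) = S (\<xi>, \<eta> + \<omega>) * G (\<xi>, \<eta>)"
      using reproducing_bounded[OF cd B \<eta> \<omega>, of \<xi> 0] by simp
    have "(LINT \<sigma>|lborel. cnj (S (0 - \<sigma>, \<omega>) * S (\<sigma> - \<xi>, \<eta>) * G (\<sigma>, 0))) = cnj (S (0 - \<xi>, \<omega> + \<eta>) * G (0, \<omega>))"
      unfolding Bochner_Integration.integral_cnj using reproducing_bounded[OF cd B \<omega> \<eta>, of 0 \<xi>] by simp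
    then have 2: "(LINT \<sigma>|lborel. S (\<xi> - \<sigma>, \<eta>) * S (\<sigma>, \<omega>) * cnj (G (\<sigma>, 0))) = S (\<xi>, \<eta> + \<omega>) * cnj (G (0, \<omega>))"
      unfolding complex_cnj_mult kernel_cnj by (simp add: mult.commute mult.left_commute add.commute)
    have re: "complex_of_real (Re z) = (z + cnj z) / 2" for z by (simp add: complex_eq_iff)
    have "(LINT \<sigma>|lborel. S (\<xi> - \<sigma>, \<eta>) * S (\<sigma>, \<omega>) * complex_of_real (Re (G (\<sigma>, 0)))) =
      (LINT \<sigma>|lborel. (S (\<xi> - \<sigma>, \<eta>) * S (\<sigma>, \<omega>) * G (\<sigma>, 0) + S (\<xi> - \<sigma>, \<eta>) * S (\<sigma>, \<omega>) * cnj (G (\<sigma>, 0))) / 2)"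
      by (simp only: re distrib_left times_divide_eq_right)
    also have "\<dots> = ((LINT \<sigma>|lborel. S (\<xi> - \<sigma>, \<eta>) * S (\<sigma>, \<omega>) * G (\<sigma>, 0))
        + (LINT \<sigma>|lborel. S (\<xi> - \<sigma>, \<eta>) * S (\<sigma>, \<omega>) * cnj (G (\<sigma>, 0)))) / 2"
      unfolding integral_divide_zero
      by (subst Bochner_Integration.integral_add) (use Gm Gc B in \<open>auto intro!: int[OF \<eta>]\<close>)
    finally show ?thesis unfolding 1 2 by (simp add: distrib_left)
  qed
  have re: "(LINT \<sigma>|lborel. herglotz_density \<xi> \<eta> \<omega> \<sigma> * complex_of_real (Re (G (\<sigma>, 0)))) =
     (LINT \<sigma>|lborel. 2 / S (\<xi>, \<eta> + \<omega>) * (S (\<xi> - \<sigma>, \<eta>) * S (\<sigma>, \<omega>) * complex_of_real (Re (G (\<sigma>, 0))))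
       - 1 / S (0, \<omega> + \<omega>) * (S (0 - \<sigma>, \<omega>) * S (\<sigma>, \<omega>) * complex_of_real (Re (G (\<sigma>, 0)))))"
    by (rule Bochner_Integration.integral_cong[OF refl])
       (simp only: herglotz_density_def norm_kernel_square left_diff_distrib, simp add: mult_ac)
  have Rm: "(\<lambda>\<sigma>. complex_of_real (Re (G (\<sigma>, 0)))) \<in> borel_measurable borel" using Gm by measurable
  have Rb: "norm (complex_of_real (Re (G (\<sigma>, 0)))) \<le> B" for \<sigma>
    using abs_Re_le_cmod[of "G (\<sigma>, 0)"] B[of 0 \<sigma>] by simp
  have "(LINT \<sigma>|lborel. herglotz_density \<xi> \<eta> \<omega> \<sigma> * complex_of_real (Re (G (\<sigma>, 0)))) =
     2 / S (\<xi>, \<eta> + \<omega>) * (LINT \<sigma>|lborel. S (\<xi> - \<sigma>, \<eta>) * S (\<sigma>, \<omega>) * complex_of_real (Re (G (\<sigma>, 0))))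
       - 1 / S (0, \<omega> + \<omega>) * (LINT \<sigma>|lborel. S (0 - \<sigma>, \<omega>) * S (\<sigma>, \<omega>) * complex_of_real (Re (G (\<sigma>, 0))))"
    unfolding re by (subst Bochner_Integration.integral_diff)
      (simp_all only: integral_mult_right_zero integrable_mult_right int[OF \<eta> Rm Rb] int[OF \<omega> Rm Rb])
  also have "\<dots> = G (\<xi>, \<eta>) + cnj (G (0, \<omega>)) - (G (0, \<omega>) + cnj (G (0, \<omega>))) / 2"
    unfolding main[OF \<eta>] main[OF \<omega>] using nz kernel_diagonal_nonzero[OF \<omega> \<eta> nz] by simp
  also have "\<dots> = G (\<xi>, \<eta>) - \<i> * complex_of_real (Im (G (0, \<omega>)))"
    by (simp add: complex_eq_iff)
  finally show ?thesis .
qed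

text \<open>Boundedness of each \<open>G n\<close> gives its own representation, by \<open>herglotz_bounded\<close>. The bound \<open>c\<close> common
to all the real parts is what provides a limit of the boundary functions.\<close>

theorem herglotz_representation:
  fixes G :: "nat \<Rightarrow> 'a \<times> 'a \<Rightarrow> complex"
  assumes \<omega>: "\<omega> \<in> \<Omega>"
    and cd: "\<And>n x y. y \<in> insert 0 \<Omega> \<Longrightarrow> cdiff (G n) (x, y)"
    and B: "\<And>n x y. y \<in> insert 0 \<Omega> \<Longrightarrow> norm (G n (x, y)) \<le> B n"
    and Re: "\<And>n x. Re (G n (x, 0)) \<in> {0..c}"
    and lim: "\<And>x y. y \<in> \<Omega> \<Longrightarrow> (\<lambda>n. G n (x, y)) \<longlonglongrightarrow> F (x, y)"
  obtains \<phi> :: "'a \<Rightarrow> real" where "\<phi> \<in> borel_measurable borel" "range \<phi> \<subseteq> {0..c}"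
    "\<And>\<xi> \<eta>. \<eta> \<in> \<Omega> \<Longrightarrow> S (\<xi>, \<eta> + \<omega>) \<noteq> 0 \<Longrightarrow>
      integrable lborel (\<lambda>\<sigma>. herglotz_density \<xi> \<eta> \<omega> \<sigma> * complex_of_real (\<phi> \<sigma>)) \<and>
      F (\<xi>, \<eta>) = \<i> * complex_of_real (Im (F (0, \<omega>))) +
        (LINT \<sigma>|lborel. herglotz_density \<xi> \<eta> \<omega> \<sigma> * complex_of_real (\<phi> \<sigma>))"
proof -
  have "(\<lambda>x. Re (G n (x, 0))) \<in> borel_measurable borel" for n
    using cdiff_measurable[OF cd, of 0 n] by simp
  from weak_star_cluster_point[of "\<lambda>n x. Re (G n (x, 0))", OF this Re]
  obtain \<phi> where \<phi>: "\<phi> \<in> borel_measurable borel" "range \<phi> \<subseteq> {0..c}"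
    "\<And>(h :: 'a \<Rightarrow> complex) l. integrable lborel h \<Longrightarrow>
       (\<lambda>n. LINT x|lborel. h x * complex_of_real (Re (G n (x, 0)))) \<longlonglongrightarrow> l \<Longrightarrow>
       (LINT x|lborel. h x * complex_of_real (\<phi> x)) = l"
    by blast
  show thesis
  proof (rule that[OF \<phi>(1,2)])
    fix \<xi> \<eta> assume \<eta>: "\<eta> \<in> \<Omega>" and nz: "S (\<xi>, \<eta> + \<omega>) \<noteq> 0"
    let ?h = "herglotz_density \<xi> \<eta> \<omega>"
    have h: "integrable lborel ?h" by (rule integrable_herglotz_density[OF \<omega> \<eta>])
    have c: "0 \<le> c" using Re[of 0 0] by auto
    have "integrable lborel (\<lambda>\<sigma>. ?h \<sigma> * complex_of_real (\<phi> \<sigma>))"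
    proof (rule Bochner_Integration.integrable_bound[OF integrable_mult_left[OF h, of "complex_of_real c"]])
      show "(\<lambda>\<sigma>. ?h \<sigma> * complex_of_real (\<phi> \<sigma>)) \<in> borel_measurable lborel"
        using borel_measurable_integrable[OF h] \<phi>(1) by simp
      have "\<bar>\<phi> \<sigma>\<bar> \<le> \<bar>c\<bar>" for \<sigma> using \<phi>(2) c by (auto simp: image_subset_iff)
      then show "AE \<sigma> in lborel. norm (?h \<sigma> * complex_of_real (\<phi> \<sigma>)) \<le> norm (?h \<sigma> * complex_of_real c)"
        by (intro AE_I2) (simp add: norm_mult mult_left_mono)
    qed
    moreover have "(LINT \<sigma>|lborel. ?h \<sigma> * complex_of_real (\<phi> \<sigma>)) = F (\<xi>, \<eta>) - \<i> * complex_of_real (Im (F (0, \<omega>)))"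
    proof (rule \<phi>(3)[OF h])
      have "(\<lambda>n. G n (\<xi>, \<eta>) - \<i> * complex_of_real (Im (G n (0, \<omega>)))) \<longlonglongrightarrow>
          F (\<xi>, \<eta>) - \<i> * complex_of_real (Im (F (0, \<omega>)))"
        by (intro tendsto_diff tendsto_mult tendsto_const tendsto_of_real tendsto_Im lim \<eta> \<omega>)
      then show "(\<lambda>n. LINT x|lborel. ?h x * complex_of_real (Re (G n (x, 0)))) \<longlonglongrightarrow>
          F (\<xi>, \<eta>) - \<i> * complex_of_real (Im (F (0, \<omega>)))"
        by (simp only: herglotz_bounded[OF cd B \<omega> \<eta> nz])
    qed
    ultimately show "integrable lborel (\<lambda>\<sigma>. ?h \<sigma> * complex_of_real (\<phi> \<sigma>)) \<and>
      F (\<xi>, \<eta>) = \<i> * complex_of_real (Im (F (0, \<omega>))) + (LINT \<sigma>|lborel. ?h \<sigma> * complex_of_real (\<phi> \<sigma>))"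
      by simp
  qed
qed

end

section \<open>Exponents of functions with values in the upper half-plane\<close>

definition log_exponent :: "complex \<Rightarrow> complex" where
  "log_exponent v = - \<i> * Ln v"

lemma Im_pos_nonpos_Reals: "0 < Im v \<Longrightarrow> v \<notin> \<real>\<^sub>\<le>\<^sub>0"
  by (auto simp: complex_nonpos_Reals_iff)

lemma log_exponent_deriv:
  "0 < Im v \<Longrightarrow> (log_exponent has_field_derivative - \<i> * inverse v) (at v)"
  unfolding log_exponent_def[abs_def]
  by (intro DERIV_cmult has_field_derivative_Ln Im_pos_nonpos_Reals)

lemma Re_log_exponent:
  assumes "0 < Im v"
  shows "Re (log_exponent v) \<in> {0..pi}"
proof -
  have "v \<noteq> 0" using assms by auto
  then have "0 < Im (Ln v)" "Im (Ln v) < pi" using assms Im_Ln_pos_lt by blast+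
  then show ?thesis by (simp add: log_exponent_def)
qed

lemma norm_log_exponent_le:
  assumes m: "0 < m" "m \<le> norm v" and M: "norm v \<le> M"
  shows "norm (log_exponent v) \<le> \<bar>ln m\<bar> + \<bar>ln M\<bar> + pi"
proof -
  have v: "v \<noteq> 0" using m by auto
  have "norm (log_exponent v) \<le> \<bar>Re (Ln v)\<bar> + \<bar>Im (Ln v)\<bar>"
    unfolding log_exponent_def norm_mult by (simp add: cmod_le)
  moreover have "\<bar>Im (Ln v)\<bar> \<le> pi"
    using mpi_less_Im_Ln[OF v] Im_Ln_le_pi[OF v] by simp
  moreover have "Re (Ln v) = ln (norm v)" by (rule Re_Ln[OF v])
  moreover have "ln m \<le> ln (norm v)" using m v by (subst ln_le_cancel_iff) auto
  moreover have "ln (norm v) \<le> ln M"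
    using M v less_le_trans[of 0 "norm v" M] by (subst ln_le_cancel_iff) auto
  ultimately show ?thesis by linarith
qed

context open_cone
begin

text \<open>The function \<open>h n\<close> below, a translate of \<open>g\<close> into the tube plus \<open>i t\<close> with \<open>t = 1/(n+1)\<close>, is analytic across the
real points and has norm between \<open>t\<close> and a constant, so its logarithm is bounded.\<close>

theorem herglotz_upper_half_plane:
  assumes \<omega>: "\<omega> \<in> \<Omega>"
    and cd: "\<And>x y. y \<in> \<Omega> \<Longrightarrow> cdiff g (x, y)"
    and Im: "\<And>x y. y \<in> \<Omega> \<Longrightarrow> 0 < Im (g (x, y))"
    and B: "\<And>t x y. 0 < t \<Longrightarrow> y \<in> insert 0 \<Omega> \<Longrightarrow> norm (g (x, t *\<^sub>R \<omega> + y)) \<le> B t"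
  obtains \<phi> :: "'a \<Rightarrow> real" where "\<phi> \<in> borel_measurable borel" "range \<phi> \<subseteq> {0..pi}"
    "\<And>\<xi> \<eta>. \<eta> \<in> \<Omega> \<Longrightarrow> S (\<xi>, \<eta> + \<omega>) \<noteq> 0 \<Longrightarrow>
      integrable lborel (\<lambda>\<sigma>. herglotz_density \<xi> \<eta> \<omega> \<sigma> * complex_of_real (\<phi> \<sigma>)) \<and>
      log_exponent (g (\<xi>, \<eta>)) = \<i> * complex_of_real (Im (log_exponent (g (0, \<omega>)))) +
        (LINT \<sigma>|lborel. herglotz_density \<xi> \<eta> \<omega> \<sigma> * complex_of_real (\<phi> \<sigma>))"
proof -
  define t where "t n = inverse (real (Suc n))" for n
  have t: "0 < t n" for n by (simp add: t_def)
  have tlim: "t \<longlonglongrightarrow> 0" unfolding t_def by (rule LIMSEQ_inverse_real_of_nat)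
  define h where "h n p = g (1 *\<^sub>R p + (0, t n *\<^sub>R \<omega>)) + \<i> * complex_of_real (t n)" for n p
  have h_eq: "h n (x, y) = g (x, t n *\<^sub>R \<omega> + y) + \<i> * complex_of_real (t n)" for n x y
    by (simp add: h_def add.commute)
  have mem: "t n *\<^sub>R \<omega> + y \<in> \<Omega>" if "y \<in> insert 0 \<Omega>" for n y
    using add_insert[OF scale_closed[OF t \<omega>] that] .
  have h_Im: "t n < Im (h n (x, y))" if "y \<in> insert 0 \<Omega>" for n x y
    using Im[OF mem[OF that, of n], of x] by (simp add: h_eq)
  have h_Im0: "0 < Im (h n (x, y))" if "y \<in> insert 0 \<Omega>" for n x y
    using h_Im[OF that, of n x] t[of n] by linarith
  have h_cd: "cdiff (h n) (x, y)" if "y \<in> insert 0 \<Omega>" for n x y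
  proof -
    have "cdiff g (1 *\<^sub>R (x, y) + (0, t n *\<^sub>R \<omega>))"
      using cd[OF mem[OF that, of n], of x] by (simp add: add.commute)
    from cdiff_add[OF cdiff_affine[OF this] cdiff_const] show ?thesis by (simp add: h_def[abs_def])
  qed
  show thesis
  proof (rule herglotz_representation[where G="\<lambda>n p. log_exponent (h n p)" and c=pi
        and F="\<lambda>p. log_exponent (g p)", OF \<omega>])
    fix n x y assume y: "y \<in> insert 0 \<Omega>"
    show "cdiff (\<lambda>p. log_exponent (h n p)) (x, y)"
      by (rule cdiff_compose[OF h_cd[OF y] log_exponent_deriv[OF h_Im0[OF y]]])
    show "norm (log_exponent (h n (x, y))) \<le> \<bar>ln (t n)\<bar> + \<bar>ln (B (t n) + t n)\<bar> + pi"
    proof (rule norm_log_exponent_le[OF t])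
      show "t n \<le> norm (h n (x, y))"
        using h_Im[OF y, of n x] abs_Im_le_cmod[of "h n (x, y)"] by linarith
      have "norm (h n (x, y)) \<le> norm (g (x, t n *\<^sub>R \<omega> + y)) + norm (\<i> * complex_of_real (t n))"
        unfolding h_eq by (rule norm_triangle_ineq)
      also have "\<dots> \<le> B (t n) + t n"
        using B[OF t y, of x n] t[of n] by (simp add: norm_mult)
      finally show "norm (h n (x, y)) \<le> B (t n) + t n" .
    qed
  next
    fix n x
    show "Re (log_exponent (h n (x, 0))) \<in> {0..pi}"
      by (rule Re_log_exponent[OF h_Im0]) simp
  next
    fix x y :: 'a assume y: "y \<in> \<Omega>"
    have "(\<lambda>n. 1 *\<^sub>R (x, y) + (0, t n *\<^sub>R \<omega>)) \<longlonglongrightarrow> 1 *\<^sub>R (x, y) + (0, 0 *\<^sub>R \<omega>)"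
      by (intro tendsto_intros tlim)
    then have "(\<lambda>n. 1 *\<^sub>R (x, y) + (0, t n *\<^sub>R \<omega>)) \<longlonglongrightarrow> (x, y)" by (simp add: zero_prod_def[symmetric])
    then have "(\<lambda>n. g (1 *\<^sub>R (x, y) + (0, t n *\<^sub>R \<omega>))) \<longlonglongrightarrow> g (x, y)"
      by (rule isCont_tendsto_compose[OF cdiff_isCont[OF cd[OF y]]])
    then have "(\<lambda>n. h n (x, y)) \<longlonglongrightarrow> g (x, y) + \<i> * complex_of_real 0"
      unfolding h_def by (intro tendsto_intros tlim)
    then show "(\<lambda>n. log_exponent (h n (x, y))) \<longlonglongrightarrow> log_exponent (g (x, y))"
      by (intro isCont_tendsto_compose[OF DERIV_isCont[OF log_exponent_deriv[OF Im[OF y]]]]) simp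
  qed (rule that)
qed

end

section \<open>The Fantappie transform\<close>

lemma open_cone_interior:
  fixes \<Gamma> :: "'b::euclidean_space set"
  assumes "convex_cone \<Gamma>"
  shows "open_cone ({0<..} \<times> interior \<Gamma> :: (real \<times> 'b) set)"
proof
  show "open ({0<..} \<times> interior \<Gamma> :: (real \<times> 'b) set)" by (intro open_Times) auto
  have add: "x + y \<in> interior \<Gamma>" if x: "x \<in> interior \<Gamma>" and y: "y \<in> interior \<Gamma>" for x y
  proof -
    have "(+) x ` interior \<Gamma> \<subseteq> interior \<Gamma>"
      using x interior_subset[of \<Gamma>] convex_cone_add[OF assms]
      by (intro interior_maximal open_translation open_interior) blast
    with y show ?thesis by blast
  qed
  have scale: "c *\<^sub>R x \<in> interior \<Gamma>" if c: "0 < c" and x: "x \<in> interior \<Gamma>" for c x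
  proof -
    have "(*\<^sub>R) c ` interior \<Gamma> \<subseteq> interior \<Gamma>"
      using c interior_subset[of \<Gamma>] convex_cone_scaleR[OF assms, of c]
      by (intro interior_maximal open_scaling open_interior) auto
    with x show ?thesis by blast
  qed
  show "x + y \<in> {0<..} \<times> interior \<Gamma>" if "x \<in> {0<..} \<times> interior \<Gamma>" "y \<in> {0<..} \<times> interior \<Gamma>" for x y :: "real \<times> 'b"
    using that add by (auto simp: mem_Times_iff)
  show "c *\<^sub>R x \<in> {0<..} \<times> interior \<Gamma>" if "0 < c" "x \<in> {0<..} \<times> interior \<Gamma>" for c and x :: "real \<times> 'b"
    using that scale by (auto simp: mem_Times_iff)
qed

text \<open>The remainder of the first-order expansion of the reciprocal, which is quadratic in \<open>M\<close>.\<close>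

lemma reciprocal_remainder:
  fixes L M :: complex
  assumes L: "L \<noteq> 0" and LM: "L + M \<noteq> 0"
  shows "1 / (L + M) - 1 / L + M / L\<^sup>2 = M\<^sup>2 / (L\<^sup>2 * (L + M))"
proof -
  define N where "N = L + M"
  have M: "M = N - L" and N: "N \<noteq> 0" using LM by (auto simp: N_def)
  have "1 / N - 1 / L + (N - L) / L\<^sup>2 = (N - L)\<^sup>2 / (L\<^sup>2 * N)"
    using L N by (simp add: divide_simps power2_eq_square) (simp add: algebra_simps)
  then show ?thesis by (simp add: M)
qed

locale cone_measure =
  fixes \<Gamma> :: "'b::euclidean_space set" and \<mu> :: "'b measure"
  assumes cone: "convex_cone \<Gamma>"
    and sets_\<mu>: "sets \<mu> = sets borel"
    and finite_\<mu>: "finite_measure \<mu>"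
begin

abbreviation "P \<equiv> polar_cone \<Gamma>"
abbreviation "\<Omega> \<equiv> {0<..} \<times> interior \<Gamma> :: (real \<times> 'b) set"

sublocale cone: open_cone \<Omega>
  by (rule open_cone_interior[OF cone])

lemma borel_measurable_\<mu> [simp]: "borel_measurable \<mu> = borel_measurable borel"
  by (rule measurable_cong_sets[OF sets_\<mu> refl])

lemma space_\<mu>: "space \<mu> = UNIV"
  using sets_eq_imp_space_eq[OF sets_\<mu>] by simp

lemma polar_measurable [measurable]: "P \<in> sets borel"
proof -
  have "P = (\<Inter>\<omega>\<in>\<Gamma>. {x. 0 \<le> \<omega> \<bullet> x})" by (auto simp: polar_cone_def)
  then have "closed P" by (auto intro!: closed_INT closed_halfspace_ge simp: inner_commute)
  then show ?thesis by (rule borel_closed)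
qed

text \<open>
  The affine form \<open>z\<^sub>0 + z \<cdot> u\<close>, written with the vector \<open>(1, u)\<close>. For \<open>u\<close> in the polar cone of \<open>\<Gamma>\<close>
  that vector lies in the polar cone of \<open>\<Omega>\<close>, which makes the form coercive on the tube.
\<close>

definition lin :: "(real \<times> 'b) \<times> (real \<times> 'b) \<Rightarrow> 'b \<Rightarrow> complex" where
  "lin p u = Complex (fst p \<bullet> (1, u)) (snd p \<bullet> (1, u))"

lemma lin_add: "lin (p + q) u = lin p u + lin q u"
  by (simp add: lin_def inner_add_left complex_eq_iff)

lemma lin_scaleR: "lin (c *\<^sub>R p) u = c *\<^sub>R lin p u"
  by (simp add: lin_def complex_eq_iff)

lemma lin_rotate: "lin (- b, a) u = \<i> * lin (a, b) u"
  by (simp add: lin_def complex_eq_iff)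

lemma lin_measurable [measurable]: "lin p \<in> borel_measurable borel"
  unfolding lin_def[abs_def]
  by (intro borel_measurable_continuous_onI continuous_intros)

lemma polar_lift: "u \<in> P \<Longrightarrow> (1, u) \<in> polar_cone \<Omega>"
  using interior_subset[of \<Gamma>] by (auto simp: polar_cone_def inner_Pair)

lemma Im_lin_ge: "y \<in> \<Omega> \<Longrightarrow> u \<in> P \<Longrightarrow> fst y \<le> Im (lin (x, y) u)"
  using interior_subset[of \<Gamma>] by (cases y) (auto simp: polar_cone_def lin_def inner_Pair)

definition neg_transform :: "(real \<times> 'b) \<times> (real \<times> 'b) \<Rightarrow> complex" where
  "neg_transform p = - (LINT u:P|\<mu>. 1 / lin p u)"

lemma integrable_const_\<mu>: "integrable \<mu> (\<lambda>u. c :: real)"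
  using finite_\<mu> by (rule finite_measure.integrable_const)

lemma lin_inverse_le:
  assumes "y \<in> \<Omega>"
  shows "norm (indicator P u *\<^sub>R (1 / lin (x, y) u)) \<le> 1 / fst y"
proof (cases "u \<in> P")
  case True
  have "0 < fst y" using assms by auto
  moreover have "fst y \<le> norm (lin (x, y) u)"
    using Im_lin_ge[OF assms True, of x] abs_Im_le_cmod[of "lin (x, y) u"] by linarith
  ultimately show ?thesis using True by (simp add: norm_divide divide_left_mono frac_le)
qed (use assms in auto)

lemma transform_integrable:
  assumes "y \<in> \<Omega>"
  shows "integrable \<mu> (\<lambda>u. indicator P u *\<^sub>R (1 / lin (x, y) u))"
proof (rule Bochner_Integration.integrable_bound[OF integrable_const_\<mu>[of "1 / fst y"]])
  show "(\<lambda>u. indicator P u *\<^sub>R (1 / lin (x, y) u)) \<in> borel_measurable \<mu>"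
    unfolding borel_measurable_\<mu> by measurable
  show "AE u in \<mu>. norm (indicator P u *\<^sub>R (1 / lin (x, y) u)) \<le> norm (1 / fst y)"
    by (intro AE_I2 order_trans[OF lin_inverse_le[OF assms]]) (simp only: real_norm_def abs_ge_self)
qed

lemma transform_norm_le:
  assumes "y \<in> \<Omega>"
  shows "norm (neg_transform (x, y)) \<le> measure \<mu> UNIV / fst y"
proof -
  have "norm (neg_transform (x, y)) \<le> (LINT u|\<mu>. norm (indicator P u *\<^sub>R (1 / lin (x, y) u)))"
    unfolding neg_transform_def set_lebesgue_integral_def norm_minus_cancel by (rule integral_norm_bound)
  also have "\<dots> \<le> (LINT u|\<mu>. 1 / fst y)"
    by (intro integral_mono integrable_norm transform_integrable assms integrable_const_\<mu> lin_inverse_le)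
  also have "\<dots> = measure \<mu> UNIV / fst y"
    by (simp add: space_\<mu>)
  finally show ?thesis .
qed

lemma transform_Im_pos:
  assumes y: "y \<in> \<Omega>" and nz: "emeasure \<mu> UNIV \<noteq> 0" and supp: "emeasure \<mu> (- P) = 0"
  shows "0 < Im (neg_transform (x, y))"
proof -
  let ?f = "\<lambda>u. Im (indicator P u *\<^sub>R (- 1 / lin (x, y) u))"
  have pos: "0 < Im (- 1 / lin (x, y) u)" if "u \<in> P" for u
  proof -
    have "0 < Im (lin (x, y) u)" using Im_lin_ge[OF y that, of x] y by auto
    then show ?thesis by (simp add: Im_divide sum_power2_gt_zero_iff)
  qed
  have f0: "0 \<le> ?f u" for u using pos[of u] by (cases "u \<in> P") auto
  have i: "integrable \<mu> (\<lambda>u. indicator P u *\<^sub>R (- 1 / lin (x, y) u))"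
    using Bochner_Integration.integrable_minus[OF transform_integrable[OF y, of x]] by simp
  have Im_eq: "Im (neg_transform (x, y)) = (LINT u|\<mu>. ?f u)"
  proof -
    have "neg_transform (x, y) = (LINT u|\<mu>. indicator P u *\<^sub>R (- 1 / lin (x, y) u))"
      unfolding neg_transform_def set_lebesgue_integral_def
      by (subst Bochner_Integration.integral_minus[symmetric]) simp
    then show ?thesis using integral_Im[OF i] by simp
  qed
  have "(LINT u|\<mu>. ?f u) \<noteq> 0"
  proof
    assume "(LINT u|\<mu>. ?f u) = 0"
    then have "AE u in \<mu>. ?f u = 0"
      using integral_nonneg_eq_0_iff_AE[OF integrable_Im[OF i]] f0 by simp
    moreover have "AE u in \<mu>. u \<in> P"
      by (rule AE_I[of _ _ "- P"]) (use supp in \<open>auto simp: sets_\<mu>\<close>)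
    ultimately have "AE u in \<mu>. False"
    proof eventually_elim
      case (elim u)
      with pos[of u] show False by simp
    qed
    then have "ae_filter \<mu> = bot" by (simp add: eventually_False)
    then have "emeasure \<mu> (space \<mu>) = 0" by (simp add: ae_filter_eq_bot_iff)
    with nz show False by (simp add: space_\<mu>)
  qed
  moreover have "0 \<le> (LINT u|\<mu>. ?f u)" using f0 by (intro integral_nonneg_AE AE_I2)
  ultimately show ?thesis unfolding Im_eq by linarith
qed

text \<open>Coercivity bounds \<open>\<bar>lin (x, y) u\<bar>\<close> below by \<open>c \<parallel>(1, u)\<parallel>\<close>, while a variation \<open>h\<close> of the point changes
it by at most \<open>2 \<parallel>h\<parallel> \<parallel>(1, u)\<parallel>\<close>. The powers of \<open>\<parallel>(1, u)\<parallel>\<close> cancel, so the remainder is bounded uniformly in \<open>u\<close>,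
and a finite measure integrates constants.\<close>

lemma transform_cdiff:
  assumes y: "y \<in> \<Omega>"
  shows "cdiff neg_transform (x, y)"
proof -
  obtain c where c: "c > 0" "\<And>v. v \<in> polar_cone \<Omega> \<Longrightarrow> c * norm v \<le> y \<bullet> v"
    using cone.polar_coercive[OF y] by blast
  let ?v = "\<lambda>u::'b. norm (1::real, u)"
  let ?f = "\<lambda>p u. indicator P u *\<^sub>R (1 / lin p u)"
  let ?D = "\<lambda>h u. indicator P u *\<^sub>R (- (lin h u) / (lin (x, y) u)\<^sup>2)"
  define A where "A = 2 / c\<^sup>2 + 8 / c ^ 3"
  have v1: "1 \<le> ?v u" for u using norm_fst_le[of "1::real" u] by simp
  have lin_le: "norm (lin h u) \<le> 2 * norm h * ?v u" for h u
  proof -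
    have "norm (lin h u) \<le> \<bar>fst h \<bullet> (1, u)\<bar> + \<bar>snd h \<bullet> (1, u)\<bar>"
      unfolding lin_def using cmod_le[of "Complex (fst h \<bullet> (1, u)) (snd h \<bullet> (1, u))"] by simp
    also have "\<dots> \<le> norm (fst h) * ?v u + norm (snd h) * ?v u"
      by (intro add_mono Cauchy_Schwarz_ineq2)
    also have "\<dots> \<le> norm h * ?v u + norm h * ?v u"
      using norm_fst_le[of "fst h" "snd h"] norm_snd_le[of "snd h" "fst h"]
      by (intro add_mono mult_right_mono) simp_all
    finally show ?thesis by (simp add: mult_ac)
  qed
  have lower: "c / 2 * ?v u \<le> norm (lin ((x, y) + h) u)" if u: "u \<in> P" and h: "norm h < c / 2" for u h
  proof -
    have "\<bar>snd h \<bullet> (1, u)\<bar> \<le> norm (snd h) * ?v u" by (rule Cauchy_Schwarz_ineq2)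
    also have "\<dots> \<le> c / 2 * ?v u"
      using h norm_snd_le[of "snd h" "fst h"] by (intro mult_right_mono) auto
    finally have "c / 2 * ?v u \<le> Im (lin ((x, y) + h) u)"
      using c(2)[OF polar_lift[OF u]] by (simp add: lin_def inner_add_left)
    also have "\<dots> \<le> norm (lin ((x, y) + h) u)" using abs_Im_le_cmod[of "lin ((x, y) + h) u"] by linarith
    finally show ?thesis .
  qed
  have lower0: "c * ?v u \<le> norm (lin (x, y) u)" if u: "u \<in> P" for u
  proof -
    have "c * ?v u \<le> Im (lin (x, y) u)" using c(2)[OF polar_lift[OF u]] by (simp add: lin_def)
    also have "\<dots> \<le> norm (lin (x, y) u)" using abs_Im_le_cmod[of "lin (x, y) u"] by linarith
    finally show ?thesis .
  qed
  have "((\<lambda>p. LINT u|\<mu>. ?f p u) has_derivative (\<lambda>h. LINT u|\<mu>. ?D h u)) (at (x, y))"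
  proof (rule has_derivative_integral_quadratic)
    show "0 < c / 2" using c by simp
    show "integrable \<mu> (\<lambda>u. A)" by (rule integrable_const_\<mu>)
    show "integrable \<mu> (\<lambda>u. ?f ((x, y) + h) u)" if h: "norm h < c / 2" for h
    proof (rule Bochner_Integration.integrable_bound[OF integrable_const_\<mu>[of "2 / c"]])
      show "(\<lambda>u. ?f ((x, y) + h) u) \<in> borel_measurable \<mu>"
        unfolding borel_measurable_\<mu> by measurable
      have "norm (?f ((x, y) + h) u) \<le> 2 / c" for u
      proof (cases "u \<in> P")
        case True
        have "c / 2 * 1 \<le> c / 2 * ?v u" using c v1[of u] by (intro mult_left_mono) auto
        with lower[OF True h] have "c / 2 \<le> norm (lin ((x, y) + h) u)" by linarith
        then have "1 / norm (lin ((x, y) + h) u) \<le> 1 / (c / 2)" using c by (intro frac_le) auto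
        with True show ?thesis by (simp add: norm_divide)
      qed (use c in simp)
      from order_trans[OF this] show "AE u in \<mu>. norm (?f ((x, y) + h) u) \<le> norm (2 / c)"
        by (intro AE_I2) (simp only: real_norm_def abs_ge_self)
    qed
    show "(\<lambda>u. ?D h u) \<in> borel_measurable \<mu>" for h
      unfolding borel_measurable_\<mu> by measurable
    show "linear (\<lambda>h. ?D h u)" for u
      by (rule linearI) (simp_all add: lin_add lin_scaleR add_divide_distrib diff_divide_distrib algebra_simps scaleR_conv_of_real)
    show "norm (?D h u) \<le> A * norm h" for h u
    proof (cases "u \<in> P")
      case True
      have "norm (?D h u) = norm (lin h u) / (norm (lin (x, y) u))\<^sup>2"
        using True by (simp add: norm_divide norm_power)
      also have "\<dots> \<le> (2 * norm h * ?v u) / (c * ?v u)\<^sup>2"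
        using c v1[of u] lower0[OF True] lin_le[of h u]
        by (intro frac_le power_mono mult_nonneg_nonneg zero_less_power mult_pos_pos) auto
      also have "\<dots> = 2 / c\<^sup>2 * norm h / ?v u"
        using v1[of u] c by (simp add: power2_eq_square field_simps)
      also have "\<dots> \<le> 2 / c\<^sup>2 * norm h / 1"
        using v1[of u] c by (intro divide_left_mono) auto
      also have "\<dots> \<le> A * norm h" unfolding A_def using c by (simp add: distrib_right)
      finally show ?thesis .
    qed (use c in \<open>simp add: A_def\<close>)
    show "norm (?f ((x, y) + h) u - ?f (x, y) u - ?D h u) \<le> A * (norm h)\<^sup>2" if h: "norm h < c / 2" for h u
    proof (cases "u \<in> P")
      case True
      let ?L = "lin (x, y) u" and ?M = "lin h u"
      have LM: "lin ((x, y) + h) u = ?L + ?M" by (rule lin_add)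
      have v0: "0 < ?v u" using v1[of u] by linarith
      have nz: "?L \<noteq> 0" "?L + ?M \<noteq> 0"
        using lower0[OF True] lower[OF True h] c v0 unfolding LM
        by (metis mult_pos_pos norm_zero not_le, metis half_gt_zero mult_pos_pos norm_zero not_le)
      have "?f ((x, y) + h) u - ?f (x, y) u - ?D h u = 1 / (?L + ?M) - 1 / ?L + ?M / ?L\<^sup>2"
        using True by (simp add: LM)
      also have "\<dots> = ?M\<^sup>2 / (?L\<^sup>2 * (?L + ?M))"
        by (rule reciprocal_remainder[OF nz])
      also have "norm \<dots> = (norm ?M)\<^sup>2 / ((norm ?L)\<^sup>2 * norm (?L + ?M))"
        by (simp add: norm_divide norm_mult norm_power)
      also have "\<dots> \<le> (2 * norm h * ?v u)\<^sup>2 / ((c * ?v u)\<^sup>2 * (c / 2 * ?v u))"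
        using lower0[OF True] lower[OF True h] lin_le[of h u] c v0 unfolding LM
        by (intro frac_le mult_mono power_mono) auto
      also have "\<dots> = 8 / c ^ 3 * (norm h)\<^sup>2 / ?v u"
        using v0 c by (simp add: power2_eq_square power3_eq_cube field_simps)
      also have "\<dots> \<le> 8 / c ^ 3 * (norm h)\<^sup>2 / 1"
        using v1[of u] c by (intro divide_left_mono) auto
      also have "\<dots> \<le> A * (norm h)\<^sup>2" unfolding A_def using c by (simp add: distrib_right)
      finally show ?thesis .
    qed (use c in \<open>simp add: A_def\<close>)
  qed
  then have "cdiff (\<lambda>p. LINT u|\<mu>. ?f p u) (x, y)"
    unfolding cdiff_def
  proof (intro exI conjI allI)
    fix a b :: "real \<times> 'b"
    have "?D (- b, a) u = \<i> * ?D (a, b) u" for u by (simp add: lin_rotate)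
    then show "(LINT u|\<mu>. ?D (- b, a) u) = \<i> * (LINT u|\<mu>. ?D (a, b) u)"
      by (simp only: integral_mult_right_zero)
  qed
  from cdiff_mult[OF this cdiff_const[of "- 1"]]
  show ?thesis by (simp add: neg_transform_def[abs_def] set_lebesgue_integral_def)
qed

end

section \<open>Complex coordinates\<close>

definition re_point :: "complex \<times> (complex^'d) \<Rightarrow> real \<times> (real^'d)" where
  "re_point Z = (Re (fst Z), \<chi> k. Re (snd Z $ k))"

definition im_point :: "complex \<times> (complex^'d) \<Rightarrow> real \<times> (real^'d)" where
  "im_point Z = (Im (fst Z), \<chi> k. Im (snd Z $ k))"

lemma bounded_linear_re_point: "bounded_linear re_point"
  by (subst linear_conv_bounded_linear[symmetric], rule linearI)
     (simp_all add: re_point_def vec_eq_iff)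

lemma bounded_linear_im_point: "bounded_linear im_point"
  by (subst linear_conv_bounded_linear[symmetric], rule linearI)
     (simp_all add: im_point_def vec_eq_iff)

lemma im_point_complex_point [simp]: "im_point (complex_point x y) = y"
  by (simp add: im_point_def complex_point_def)

lemma complex_point_re_im [simp]: "complex_point (re_point Z) (im_point Z) = Z"
  by (simp add: re_point_def im_point_def complex_point_def prod_eq_iff vec_eq_iff)

lemma tube_eq: "tube \<Omega> = im_point -` \<Omega>"
proof (intro set_eqI iffI)
  fix Z assume "Z \<in> im_point -` \<Omega>"
  then show "Z \<in> tube \<Omega>"
    unfolding tube_def using complex_point_re_im[of Z, symmetric] by blast
qed (auto simp: tube_def)

lemma open_tube: "open \<Omega> \<Longrightarrow> open (tube \<Omega>)"
  unfolding tube_eq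
  by (intro open_vimage continuous_at_imp_continuous_on ballI linear_continuous_at bounded_linear_im_point)

text \<open>The \<open>i\<close>-linearity required of \<open>D\<close> becomes linearity over the complex numbers, because \<open>D\<close> is
linear over the reals.\<close>

lemma complex_differentiable_at_cdiff:
  assumes "cdiff F (re_point Z, im_point Z)"
  shows "complex_differentiable_at (\<lambda>Z. F (re_point Z, im_point Z)) Z"
proof -
  from assms obtain D where D: "(F has_derivative D) (at (re_point Z, im_point Z))"
    "\<And>a b. D (- b, a) = \<i> * D (a, b)" unfolding cdiff_def by blast
  interpret D: bounded_linear D using D(1) by (rule has_derivative_bounded_linear)
  have "((\<lambda>Z. (re_point Z, im_point Z)) has_derivative (\<lambda>V. (re_point V, im_point V))) (at Z)"
    by (intro has_derivative_Pair bounded_linear_imp_has_derivative bounded_linear_re_point bounded_linear_im_point)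
  from has_derivative_compose[OF this D(1)]
  have "((\<lambda>Z. F (re_point Z, im_point Z)) has_derivative (\<lambda>V. D (re_point V, im_point V))) (at Z)" .
  moreover have "D (re_point (c * fst V, c *s snd V), im_point (c * fst V, c *s snd V)) =
      c * D (re_point V, im_point V)" for c V
  proof -
    have "(re_point (c * fst V, c *s snd V), im_point (c * fst V, c *s snd V)) =
        Re c *\<^sub>R (re_point V, im_point V) + Im c *\<^sub>R (- im_point V, re_point V)"
      by (simp add: re_point_def im_point_def vec_eq_iff)
    then have "D (re_point (c * fst V, c *s snd V), im_point (c * fst V, c *s snd V)) =
        Re c *\<^sub>R D (re_point V, im_point V) + Im c *\<^sub>R D (- im_point V, re_point V)"
      by (simp only: D.add D.scaleR)
    also have "\<dots> = c * D (re_point V, im_point V)"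
      unfolding D(2) by (simp add: complex_eq_iff)
    finally show ?thesis .
  qed
  ultimately show ?thesis unfolding complex_differentiable_at_def by blast
qed

lemma pdot_complex_point:
  "pdot (complex_point a b - cnj_point (complex_point c e)) (complex_point x 0) =
    Complex ((a - c) \<bullet> x) ((b + e) \<bullet> x)"
  by (simp add: pdot_def vdot_def complex_point_def cnj_point_def complex_eq_iff inner_prod_def inner_vec_def)

lemma szego_cone_kernel:
  fixes \<Omega> :: "(real \<times> (real^'d)) set"
  shows "szego \<Omega> (complex_point a b) (complex_point c e) = cone_kernel (polar_cone \<Omega>) (a - c, b + e)"
  by (simp add: szego_def cone_kernel_def pdot_complex_point add.commute)

lemma lin_re_im:
  fixes Z :: "complex \<times> (complex^'d)"
  shows "fst Z + vdot (snd Z) (complex_vec u) = Complex (re_point Z \<bullet> (1, u)) (im_point Z \<bullet> (1, u))"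
  by (simp add: vdot_def complex_vec_def re_point_def im_point_def complex_eq_iff inner_prod_def inner_vec_def)

theorem proposition7:
  fixes \<Gamma> :: "(real^'d) set"
    and \<mu> :: "(real^'d) measure"
    and \<Omega> :: "(real \<times> (real^'d)) set"
  assumes "closed \<Gamma>" and "solid_cone \<Gamma>" and "acute_cone \<Gamma>"
    and "sets \<mu> = sets borel" and "finite_measure \<mu>"
    and "emeasure \<mu> UNIV \<noteq> 0"
    and "emeasure \<mu> (- polar_cone \<Gamma>) = 0"
    and "\<Omega> = {0<..} \<times> interior \<Gamma>"
  shows "(\<forall>Z\<in>tube \<Omega>.
            set_integrable \<mu> (polar_cone \<Gamma>) (\<lambda>x. 1 / (fst Z + vdot (snd Z) (complex_vec x))) \<and>
            0 < Im (- fantappie (polar_cone \<Gamma>) \<mu> Z) \<and>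
            fantappie (polar_cone \<Gamma>) \<mu> Z = - exp (\<i> * fantappie_exponent (polar_cone \<Gamma>) \<mu> Z)) \<and>
         multi_analytic_on (fantappie_exponent (polar_cone \<Gamma>) \<mu>) (tube \<Omega>) \<and>
         (\<forall>\<alpha>\<in>{complex_point 0 \<omega> | \<omega>. \<omega> \<in> \<Omega>}.
            \<exists>(\<phi> :: real \<times> (real^'d) \<Rightarrow> real) (C :: real).
              \<phi> \<in> borel_measurable borel \<and> range \<phi> \<subseteq> {0..pi} \<and>
              (\<forall>\<zeta>\<in>tube \<Omega>. szego \<Omega> \<zeta> \<alpha> \<noteq> 0 \<longrightarrow>
                 integrable lborel
                   (\<lambda>\<sigma>. herglotz \<Omega> \<zeta> (complex_point \<sigma> 0) \<alpha> * complex_of_real (\<phi> \<sigma>)) \<and>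
                 fantappie_exponent (polar_cone \<Gamma>) \<mu> \<zeta> =
                   \<i> * complex_of_real C +
                   (LINT \<sigma>|lborel.
                      herglotz \<Omega> \<zeta> (complex_point \<sigma> 0) \<alpha> * complex_of_real (\<phi> \<sigma>))))"
proof -
  interpret cone_measure \<Gamma> \<mu>
    using assms(2,4,5) by (simp add: cone_measure_def solid_cone_def)
  note \<Omega> = assms(8)
  let ?K = "polar_cone \<Gamma>"
  let ?g = "\<lambda>Z. neg_transform (re_point Z, im_point Z)"
  have lin_eq: "fst Z + vdot (snd Z) (complex_vec u) = lin (re_point Z, im_point Z) u" for Z u
    by (simp add: lin_re_im lin_def)
  have neg: "- fantappie ?K \<mu> Z = ?g Z" for Z
    by (simp add: fantappie_def neg_transform_def lin_eq)
  have exponent: "fantappie_exponent ?K \<mu> Z = log_exponent (?g Z)" for Z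
    by (simp add: fantappie_exponent_def log_exponent_def neg)
  have Im_pos: "0 < Im (neg_transform (x, y))" if "y \<in> \<Omega>" for x y
    using transform_Im_pos[of y x] that assms(6,7) by (simp add: \<Omega>)
  have cd: "cdiff neg_transform (x, y)" if "y \<in> \<Omega>" for x y
    using transform_cdiff that by (simp add: \<Omega>)
  have cd_exp: "cdiff (\<lambda>p. log_exponent (neg_transform p)) (x, y)" if "y \<in> \<Omega>" for x y
    by (rule cdiff_compose[OF cd[OF that] log_exponent_deriv[OF Im_pos[OF that]]])
  have tube: "im_point Z \<in> \<Omega>" if "Z \<in> tube \<Omega>" for Z
    using that by (simp add: tube_eq)
  have part1: "set_integrable \<mu> ?K (\<lambda>x. 1 / (fst Z + vdot (snd Z) (complex_vec x))) \<and>
      0 < Im (- fantappie ?K \<mu> Z) \<and>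
      fantappie ?K \<mu> Z = - exp (\<i> * fantappie_exponent ?K \<mu> Z)" if Z: "Z \<in> tube \<Omega>" for Z
  proof (intro conjI)
    show "set_integrable \<mu> ?K (\<lambda>x. 1 / (fst Z + vdot (snd Z) (complex_vec x)))"
      using transform_integrable tube[OF Z] by (simp add: set_integrable_def lin_eq \<Omega>)
    show pos: "0 < Im (- fantappie ?K \<mu> Z)"
      unfolding neg by (rule Im_pos[OF tube[OF Z]])
    then have "- fantappie ?K \<mu> Z \<noteq> 0" by auto
    then have "exp (Ln (- fantappie ?K \<mu> Z)) = - fantappie ?K \<mu> Z" by (rule exp_Ln)
    then show "fantappie ?K \<mu> Z = - exp (\<i> * fantappie_exponent ?K \<mu> Z)"
      by (simp add: fantappie_exponent_def mult.assoc[symmetric])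
  qed
  have part2: "multi_analytic_on (fantappie_exponent ?K \<mu>) (tube \<Omega>)"
    unfolding multi_analytic_on_def
  proof (rule ballI)
    fix Z assume "Z \<in> tube \<Omega>"
    moreover have "open (tube \<Omega>)" using cone.open_cone by (intro open_tube) (simp add: \<Omega>)
    ultimately obtain e where e: "e > 0" "ball Z e \<subseteq> tube \<Omega>" by (auto simp: open_contains_ball)
    have "complex_differentiable_at (fantappie_exponent ?K \<mu>) W" if "W \<in> ball Z e" for W
      unfolding exponent[abs_def]
      using e that by (intro complex_differentiable_at_cdiff[of "\<lambda>p. log_exponent (neg_transform p)"] cd_exp tube) auto
    with e show "\<exists>e>0. \<forall>W\<in>ball Z e. complex_differentiable_at (fantappie_exponent ?K \<mu>) W" by blast
  qed
  have part3: "\<exists>(\<phi> :: real \<times> (real^'d) \<Rightarrow> real) (C :: real).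
      \<phi> \<in> borel_measurable borel \<and> range \<phi> \<subseteq> {0..pi} \<and>
      (\<forall>\<zeta>\<in>tube \<Omega>. szego \<Omega> \<zeta> \<alpha> \<noteq> 0 \<longrightarrow>
         integrable lborel
           (\<lambda>\<sigma>. herglotz \<Omega> \<zeta> (complex_point \<sigma> 0) \<alpha> * complex_of_real (\<phi> \<sigma>)) \<and>
         fantappie_exponent ?K \<mu> \<zeta> =
           \<i> * complex_of_real C +
           (LINT \<sigma>|lborel. herglotz \<Omega> \<zeta> (complex_point \<sigma> 0) \<alpha> * complex_of_real (\<phi> \<sigma>)))"
    if \<alpha>: "\<alpha> = complex_point 0 \<omega>" and \<omega>: "\<omega> \<in> \<Omega>" for \<alpha> \<omega>
  proof -
    have bound: "norm (neg_transform (x, t *\<^sub>R \<omega> + y)) \<le> measure \<mu> UNIV / (t * fst \<omega>)"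
      if t: "0 < t" and y: "y \<in> insert 0 \<Omega>" for t x y
    proof -
      have mem: "t *\<^sub>R \<omega> + y \<in> \<Omega>"
        using cone.add_insert[OF cone.scale_closed[OF t], of \<omega> y] \<omega> y by (simp add: \<Omega>)
      have "0 < fst \<omega>" "0 \<le> fst y" using \<omega> y by (auto simp: \<Omega>)
      then have le: "t * fst \<omega> \<le> fst (t *\<^sub>R \<omega> + y)" "0 < t * fst \<omega>" using t by auto
      have "norm (neg_transform (x, t *\<^sub>R \<omega> + y)) \<le> measure \<mu> UNIV / fst (t *\<^sub>R \<omega> + y)"
        using transform_norm_le[of "t *\<^sub>R \<omega> + y" x] mem by (simp add: \<Omega>)
      also have "\<dots> \<le> measure \<mu> UNIV / (t * fst \<omega>)"
        by (intro frac_le le) auto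
      finally show ?thesis .
    qed
    obtain \<phi> :: "real \<times> (real^'d) \<Rightarrow> real" where \<phi>: "\<phi> \<in> borel_measurable borel" "range \<phi> \<subseteq> {0..pi}"
      "\<And>\<xi> \<eta>. \<eta> \<in> \<Omega> \<Longrightarrow> cone_kernel (polar_cone \<Omega>) (\<xi>, \<eta> + \<omega>) \<noteq> 0 \<Longrightarrow>
        integrable lborel (\<lambda>\<sigma>. cone.herglotz_density \<xi> \<eta> \<omega> \<sigma> * complex_of_real (\<phi> \<sigma>)) \<and>
        log_exponent (neg_transform (\<xi>, \<eta>)) = \<i> * complex_of_real (Im (log_exponent (neg_transform (0, \<omega>)))) +
          (LINT \<sigma>|lborel. cone.herglotz_density \<xi> \<eta> \<omega> \<sigma> * complex_of_real (\<phi> \<sigma>))"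
      using cone.herglotz_upper_half_plane[of \<omega> neg_transform "\<lambda>t. measure \<mu> UNIV / (t * fst \<omega>)"] \<omega> cd Im_pos bound
      unfolding \<Omega> by blast
    have herglotz: "herglotz \<Omega> \<zeta> (complex_point \<sigma> 0) \<alpha> = cone.herglotz_density (re_point \<zeta>) (im_point \<zeta>) \<omega> \<sigma>" for \<zeta> \<sigma>
    proof -
      have "herglotz \<Omega> (complex_point (re_point \<zeta>) (im_point \<zeta>)) (complex_point \<sigma> 0) \<alpha> =
          cone.herglotz_density (re_point \<zeta>) (im_point \<zeta>) \<omega> \<sigma>"
        unfolding herglotz_def \<alpha> szego_cone_kernel cone.herglotz_density_def by (simp add: \<Omega>)
      then show ?thesis by simp
    qed
    have szego: "szego \<Omega> \<zeta> \<alpha> = cone_kernel (polar_cone \<Omega>) (re_point \<zeta>, im_point \<zeta> + \<omega>)" for \<zeta>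
      using szego_cone_kernel[of \<Omega> "re_point \<zeta>" "im_point \<zeta>" 0 \<omega>] by (simp add: \<alpha>)
    show ?thesis
      unfolding herglotz exponent szego
      using \<phi> tube by (intro exI[of _ \<phi>] exI[of _ "Im (log_exponent (neg_transform (0, \<omega>)))"]) blast
  qed
  from part1 part2 part3 show ?thesis by blast
qed

end
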